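(* Let $\kappa',\kappa$ be cardinals with $\aleph_0 \leq \kappa' < \kappa$ and let $\mathfrak{C}$ be a topological, closed hereditary and $\mathbf{I}$-stable class of spaces. If $\Omega$ is a $\mathfrak{C}(\kappa')$-absorbing set in $\ell_2(\kappa')$, then $\ell_2^f(\kappa) \times \Omega$ is a $\bigoplus_{\kappa} \mathfrak{C}(\kappa')$-absorbing set in $\ell_2(\kappa) \times \ell_2(\kappa')$.
   Context: All spaces are metrizable and all maps are continuous. $\mathbf{I}=[0,1]$. $\ell_2(\kappa)$ is the Hilbert space of density $\kappa$, and $\ell_2^f(\kappa)=\{(x(\gamma))_{\gamma<\kappa}\in\ell_2(\kappa)\mid x(\gamma)=0\text{ except for finitely many }\gamma<\kappa\}$, with the subspace topology. A class $\mathfrak{C}$ of spaces is topological if every space homeomorphic to a member of $\mathfrak{C}$ belongs to $\mathfrak{C}$; closed hereditary if every closed subspace of a member of $\mathfrak{C}$ belongs to $\mathfrak{C}$; $\mathbf{I}$-stable if $A\times\mathbf{I}\in\mathfrak{C}$ for each $A\in\mathfrak{C}$. For a class $\mathfrak{C}$ and a cardinal $\lambda$: $\mathfrak{C}_\sigma$ is the class of spaces $\bigcup_{n\in\omega}A_n$ with each $A_n\in\mathfrak{C}$ closed in the union; $\bigoplus_\lambda\mathfrak{C}$ is the class of topological sums $\bigoplus_{\gamma<\lambda}A_\gamma$ with each $A_\gamma\in\mathfrak{C}$; $\mathfrak{C}(\lambda)$ is the class of $A\in\mathfrak{C}$ of density $\leq\lambda$. Maps $f,g:X\to Y$ are $\mathcal{U}$-close,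 for an open cover $\mathcal{U}$ of $Y$, if for every $x\in X$ some $U\in\mathcal{U}$ contains $\{f(x),g(x)\}$. A closed set $A\subset X$ is a $Z$-set (resp. strong $Z$-set) in $X$ if for each open cover $\mathcal{U}$ of $X$ there is a map $f:X\to X$ that is $\mathcal{U}$-close to $\mathrm{id}_X$ with $f(X)\cap A=\emptyset$ (resp. with $\operatorname{cl} f(X)\cap A=\emptyset$). $X$ is a strong $Z_\sigma$-set in itself if $X$ is a countable union of strong $Z$-sets in $X$. A $Z$-embedding is an embedding whose image is a $Z$-set. $X$ is strongly $\mathfrak{D}$-universal, for a class $\mathfrak{D}$, if for every $A\in\mathfrak{D}$, every map $f:A\to X$, every closed $B\subset A$ such that $f|_B$ is a $Z$-embedding, and every open cover $\mathcal{U}$ of $X$, there is a $Z$-embedding $g:A\to X$ that is $\mathcal{U}$-close to $f$ with $g|_B=f|_B$. $X\subset M$ is homotopy dense in $M$ if there is a homotopy $h:M\times\mathbf{I}\to M$ with $h(x,0)=x$ for all $x\in M$ and $h(M\times(0,1])\subset X$. For $X\subset M$, $X$ is a $\mathfrak{D}$-absorbing set in $M$ if $X$ is homotopy dense in $M$, $X\in\mathfrak{D}_\sigma$, $X$ is strongly $\mathfrak{D}$-universal, and $X$ is a strong $Z_\sigma$-set in itself. *)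

theory Defs
  imports "HOL-Analysis.Analysis"
begin

unbundle cardinal_syntax

text \<open>
  Cardinals are represented by cardinal orders (\<^const>\<open>Card_order\<close>); the index set
  of all \<open>\<gamma> < \<kappa>\<close> is \<open>Field \<kappa>\<close>.

  A class of spaces is represented by a set of topologies on one arbitrary type \<open>'u\<close>.
  A space over another type belongs to the class iff it is homeomorphic to one of these
  representatives; this is \<open>in_class\<close>.  Since \<open>'u\<close> is a type variable, it can be taken as large
  as desired.
\<close>

definition in_class :: "'a topology \<Rightarrow> 'u topology set \<Rightarrow> bool" where
  "in_class X \<CC> \<longleftrightarrow> (\<exists>Y\<in>\<CC>. X homeomorphic_space Y)"

definition topological_class :: "'u topology set \<Rightarrow> bool" where
  "topological_class \<CC> \<longleftrightarrow>
     (\<forall>A\<in>\<CC>. \<forall>B::'u topology. A homeomorphic_space B \<longrightarrow> B \<in> \<CC>)"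

definition closed_hereditary_class :: "'u topology set \<Rightarrow> bool" where
  "closed_hereditary_class \<CC> \<longleftrightarrow>
     (\<forall>A\<in>\<CC>. \<forall>F. closedin A F \<longrightarrow> subtopology A F \<in> \<CC>)"

text \<open>The product lives on \<open>'u \<times> real\<close>, so \<open>in_class\<close> also asks that \<open>'u\<close> has room for a copy of it.\<close>

definition I_stable_class :: "'u topology set \<Rightarrow> bool" where
  "I_stable_class \<CC> \<longleftrightarrow>
     (\<forall>A\<in>\<CC>. in_class (prod_topology A (top_of_set {0..1::real})) \<CC>)"

definition density_le :: "'a topology \<Rightarrow> 'k rel \<Rightarrow> bool" where
  "density_le X \<kappa> \<longleftrightarrow>
     (\<exists>D\<subseteq>topspace X. X closure_of D = topspace X \<and> |D| \<le>o \<kappa>)"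

definition density_class :: "'u topology set \<Rightarrow> 'k rel \<Rightarrow> 'u topology set" where
  "density_class \<CC> \<kappa> = {A \<in> \<CC>. density_le A \<kappa>}"

definition sigma_class :: "'u topology set \<Rightarrow> 'a topology set" where
  "sigma_class \<CC> =
     {X. metrizable_space X \<and>
         (\<exists>A :: nat \<Rightarrow> 'a set. topspace X = (\<Union>n. A n) \<and>
            (\<forall>n. closedin X (A n) \<and> in_class (subtopology X (A n)) \<CC>))}"

definition sum_class :: "'k rel \<Rightarrow> 'u topology set \<Rightarrow> ('k \<times> 'u) topology set" where
  "sum_class \<kappa> \<CC> =
     {X. \<exists>A. (\<forall>\<gamma>\<in>Field \<kappa>. A \<gamma> \<in> \<CC>) \<and> X homeomorphic_space sum_topology A (Field \<kappa>)}"

definition open_cover :: "'a topology \<Rightarrow> 'a set set \<Rightarrow> bool" where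
  "open_cover X \<U> \<longleftrightarrow> (\<forall>U\<in>\<U>. openin X U) \<and> \<Union>\<U> = topspace X"

definition cover_close ::
    "'a topology \<Rightarrow> 'b set set \<Rightarrow> ('a \<Rightarrow> 'b) \<Rightarrow> ('a \<Rightarrow> 'b) \<Rightarrow> bool" where
  "cover_close X \<U> f g \<longleftrightarrow> (\<forall>x\<in>topspace X. \<exists>U\<in>\<U>. f x \<in> U \<and> g x \<in> U)"

definition Z_set :: "'a topology \<Rightarrow> 'a set \<Rightarrow> bool" where
  "Z_set X A \<longleftrightarrow> closedin X A \<and>
     (\<forall>\<U>. open_cover X \<U> \<longrightarrow>
        (\<exists>f. continuous_map X X f \<and> cover_close X \<U> f id \<and> f ` topspace X \<inter> A = {}))"

definition strong_Z_set :: "'a topology \<Rightarrow> 'a set \<Rightarrow> bool" where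
  "strong_Z_set X A \<longleftrightarrow> closedin X A \<and>
     (\<forall>\<U>. open_cover X \<U> \<longrightarrow>
        (\<exists>f. continuous_map X X f \<and> cover_close X \<U> f id \<and>
             X closure_of (f ` topspace X) \<inter> A = {}))"

definition strong_Z_sigma_in_itself :: "'a topology \<Rightarrow> bool" where
  "strong_Z_sigma_in_itself X \<longleftrightarrow>
     (\<exists>A :: nat \<Rightarrow> 'a set. (\<forall>n. strong_Z_set X (A n)) \<and> topspace X = (\<Union>n. A n))"

definition Z_embedding :: "'a topology \<Rightarrow> 'b topology \<Rightarrow> ('a \<Rightarrow> 'b) \<Rightarrow> bool" where
  "Z_embedding A X f \<longleftrightarrow> embedding_map A X f \<and> Z_set X (f ` topspace A)"

definition strongly_universal :: "'u topology set \<Rightarrow> 'a topology \<Rightarrow> bool" where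
  "strongly_universal \<DD> X \<longleftrightarrow>
     (\<forall>A\<in>\<DD>. \<forall>f B \<U>.
        continuous_map A X f \<and> closedin A B \<and> Z_embedding (subtopology A B) X f \<and>
        open_cover X \<U> \<longrightarrow>
        (\<exists>g. Z_embedding A X g \<and> cover_close A \<U> g f \<and> (\<forall>x\<in>B. g x = f x)))"

definition homotopy_dense :: "'a topology \<Rightarrow> 'a set \<Rightarrow> bool" where
  "homotopy_dense M X \<longleftrightarrow> X \<subseteq> topspace M \<and>
     (\<exists>h. continuous_map (prod_topology M (top_of_set {0..1::real})) M h \<and>
          (\<forall>x\<in>topspace M. h (x, 0) = x) \<and>
          h ` (topspace M \<times> {0<..1}) \<subseteq> X)"

definition absorbing_set :: "'u topology set \<Rightarrow> 'a topology \<Rightarrow> 'a set \<Rightarrow> bool" where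
  "absorbing_set \<DD> M X \<longleftrightarrow> X \<subseteq> topspace M \<and>
     homotopy_dense M X \<and>
     subtopology M X \<in> sigma_class \<DD> \<and>
     strongly_universal \<DD> (subtopology M X) \<and>
     strong_Z_sigma_in_itself (subtopology M X)"

text \<open>
  Points of the Hilbert space are functions on the whole index type that vanish off the index set.
\<close>

definition ell2_space :: "'i set \<Rightarrow> ('i \<Rightarrow> real) set" where
  "ell2_space I = {x. (\<forall>i. i \<notin> I \<longrightarrow> x i = 0) \<and> (\<lambda>i. (x i)\<^sup>2) summable_on I}"

definition ell2_dist :: "'i set \<Rightarrow> ('i \<Rightarrow> real) \<Rightarrow> ('i \<Rightarrow> real) \<Rightarrow> real" where
  "ell2_dist I x y = sqrt (\<Sum>\<^sub>\<infinity>i\<in>I. (x i - y i)\<^sup>2)"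

lemma summable_on_diff_squares:
  fixes x y :: "'i \<Rightarrow> real"
  assumes "(\<lambda>i. (x i)\<^sup>2) summable_on I" "(\<lambda>i. (y i)\<^sup>2) summable_on I"
  shows "(\<lambda>i. (x i - y i)\<^sup>2) summable_on I"
proof (rule summable_on_comparison_test)
  show "(\<lambda>i. 2 * (x i)\<^sup>2 + 2 * (y i)\<^sup>2) summable_on I"
    by (intro summable_on_add summable_on_cmult_right assms)
  show "(x i - y i)\<^sup>2 \<le> 2 * (x i)\<^sup>2 + 2 * (y i)\<^sup>2" for i
    using zero_le_power2[of "x i + y i"] by (simp add: power2_eq_square algebra_simps)
qed simp

lemma Metric_space_ell2: "Metric_space (ell2_space I) (ell2_dist I)"
proof
  fix x y :: "'a \<Rightarrow> real"
  show "0 \<le> ell2_dist I x y"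
    by (simp add: ell2_dist_def infsum_nonneg)
  show "ell2_dist I x y = ell2_dist I y x"
    by (simp add: ell2_dist_def power2_commute)
next
  fix x y :: "'a \<Rightarrow> real"
  assume xy: "x \<in> ell2_space I" "y \<in> ell2_space I"
  then have sm: "(\<lambda>i. (x i - y i)\<^sup>2) summable_on I"
    by (auto simp: ell2_space_def intro: summable_on_diff_squares)
  show "ell2_dist I x y = 0 \<longleftrightarrow> x = y"
  proof
    assume "ell2_dist I x y = 0"
    then have 0: "(\<Sum>\<^sub>\<infinity>i\<in>I. (x i - y i)\<^sup>2) = 0"
      by (simp add: ell2_dist_def)
    have "x i = y i" if "i \<in> I" for i
      using finite_sum_le_infsum[OF sm, of "{i}"] that 0 by simp
    then show "x = y"
      using xy by (fastforce simp: ell2_space_def)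
  qed (simp add: ell2_dist_def)
next
  fix x y z :: "'a \<Rightarrow> real"
  assume "x \<in> ell2_space I" "y \<in> ell2_space I" "z \<in> ell2_space I"
  then have sm: "(\<lambda>i. (x i - y i)\<^sup>2) summable_on I" "(\<lambda>i. (y i - z i)\<^sup>2) summable_on I"
      "(\<lambda>i. (x i - z i)\<^sup>2) summable_on I"
    by (auto simp: ell2_space_def intro: summable_on_diff_squares)
  have nn: "0 \<le> ell2_dist I x y + ell2_dist I y z"
    by (simp add: ell2_dist_def infsum_nonneg)
  have "(\<Sum>\<^sub>\<infinity>i\<in>I. (x i - z i)\<^sup>2) \<le> (ell2_dist I x y + ell2_dist I y z)\<^sup>2"
  proof (rule infsum_le_finite_sums[OF sm(3)])
    fix F assume F: "finite F" "F \<subseteq> I"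
    have le: "L2_set (\<lambda>i. u i - v i) F \<le> ell2_dist I u v"
      if "(\<lambda>i. (u i - v i)\<^sup>2) summable_on I" for u v
      unfolding L2_set_def ell2_dist_def
      using finite_sum_le_infsum[OF that F] by simp
    have "L2_set (\<lambda>i. x i - z i) F \<le> L2_set (\<lambda>i. x i - y i) F + L2_set (\<lambda>i. y i - z i) F"
      using L2_set_triangle_ineq[of "\<lambda>i. x i - y i" "\<lambda>i. y i - z i" F] by simp
    also have "\<dots> \<le> ell2_dist I x y + ell2_dist I y z"
      by (intro add_mono le sm)
    finally have "sqrt (\<Sum>i\<in>F. (x i - z i)\<^sup>2) \<le> ell2_dist I x y + ell2_dist I y z"
      by (simp add: L2_set_def)
    then show "(\<Sum>i\<in>F. (x i - z i)\<^sup>2) \<le> (ell2_dist I x y + ell2_dist I y z)\<^sup>2"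
      by (rule sqrt_le_D)
  qed
  then show "ell2_dist I x z \<le> ell2_dist I x y + ell2_dist I y z"
    unfolding ell2_dist_def[of I x z] using nn by (rule real_le_lsqrt[rotated -1])
qed

definition ell2 :: "'k rel \<Rightarrow> ('k \<Rightarrow> real) topology" where
  "ell2 \<kappa> = Metric_space.mtopology (ell2_space (Field \<kappa>)) (ell2_dist (Field \<kappa>))"

definition ell2f :: "'k rel \<Rightarrow> ('k \<Rightarrow> real) set" where
  "ell2f \<kappa> = {x \<in> ell2_space (Field \<kappa>). finite {\<gamma> \<in> Field \<kappa>. x \<gamma> \<noteq> 0}}"

end

theory Submission
  imports Defs
begin

text \<open>
  Write \<open>X = \<ell>\<^sub>2\<^sup>f(\<kappa>) \<times> \<Omega>\<close>.  Two of the four conditions come straight from soft thresholding, which moves every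
  coordinate of a point of \<open>\<ell>\<^sub>2(\<kappa>)\<close> towards \<open>0\<close> by at most \<open>t\<close>.  This homotopy of \<open>\<ell>\<^sub>2(\<kappa>)\<close> enters
  \<open>\<ell>\<^sub>2\<^sup>f(\<kappa>)\<close> at once, so \<open>X\<close> is homotopy dense (\<open>homotopy_dense_fin_sqsum_times\<close>).  Moreover, after
  thresholding, a small bump can be added on coordinates of a prescribed infinite set on which the point
  has become zero, and this can be done continuously (\<open>free_unit\<close>).  The sets of points that vanish on the
  tail of a fixed sequence of coordinates are strong Z-sets for this reason, and they cover \<open>X\<close>
  (\<open>strong_Z_sigma_fin_sqsum\<close>).

  For membership in the class of \<open>\<sigma>\<close>-unions, \<open>\<ell>\<^sub>2\<^sup>f(\<kappa>)\<close> is the union over \<open>m\<close> of the closed sets of points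
  whose nonzero coordinates have absolute value between \<open>1/m\<close> and \<open>m\<close>.  Such a set is a sum of compacta,
  one in a finite-dimensional cube for each finite support, because points with different supports are at
  distance at least \<open>1/m\<close>.  As the class is stable under products with the interval, a cube times a closed
  piece of \<open>\<Omega>\<close> stays in it (\<open>sigma_class_fin_sqsum_times\<close>).

  Strong universality is the heart (\<open>Z_embedding_approximation\<close>).  Let \<open>A\<close> be a sum of pieces \<open>A\<^sub>\<gamma>\<close> of density
  at most \<open>\<kappa>'\<close>, let \<open>f : A \<rightarrow> X\<close> be a map and let \<open>B \<subseteq> A\<close> be the closed set on which \<open>f\<close> has to be kept.
  Take a control function \<open>s : A \<rightarrow> [0,1]\<close> that vanishes exactly on \<open>B\<close> and is small with respect to
  the cover; the new map \<open>g\<close> differs from \<open>f\<close> by at most \<open>3s\<close>.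

  \<^item> In the factor \<open>\<Omega>\<close>, each piece is moved by a fan \<open>G\<^sub>\<gamma> : A\<^sub>\<gamma> \<times> [0,1] \<rightarrow> \<Omega>\<close> that starts with \<open>f\<close> and
    is a closed embedding in the first variable at every positive time (\<open>embedding_fan\<close>).  It is
    concatenated from Z-embeddings of \<open>A\<^sub>\<gamma> \<times> [0,1]\<close> that the universality of \<open>\<Omega>\<close> provides.
  \<^item> In the factor \<open>\<ell>\<^sub>2\<^sup>f(\<kappa>)\<close>, the first component of \<open>f\<close> on one piece uses only \<open>\<kappa>'\<close> many indices, so
    there is room for new ones.  The value \<open>s(a)\<close> is recorded in an index \<open>\<theta>(\<gamma>)\<close> that no earlier piece
    uses.  It keeps \<open>g(a)\<close> at distance at least \<open>s(a)\<close> from the images of the earlier pieces, and it tells the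
    time at which the fan is evaluated.  A second new index makes \<open>g(A\<^sub>\<gamma> - B)\<close> disjoint from
    \<open>f(B \<inter> A\<^sub>\<delta>)\<close> for \<open>\<delta> \<noteq> \<gamma>\<close>.

  The family \<open>f(B \<inter> A\<^sub>\<delta>)\<close> is discrete, so near each point of \<open>X\<close> only one \<open>\<delta>\<close> matters, and one bump function
  per \<open>\<delta>\<close> suffices.  Finally, the image of \<open>g\<close> is a Z-set because every closed set that is a discrete union of sets
  using at most \<open>\<kappa>'\<close> many indices each is one (\<open>Z_set_discrete_union\<close>).

  All of this takes place in a normed space of square-summable families; the conclusion is carried
  back along a homeomorphism at the end.
\<close>

section \<open>The space of square-summable families\<close>

text \<open>One type contains every \<open>\<ell>\<^sub>2(\<kappa>)\<close> over the same index type, as the closed subspace of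
  points supported in \<open>Field \<kappa>\<close>.  In this way the points form an instance of the class of normed spaces.\<close>

typedef 'i sqsum = "ell2_space (UNIV :: 'i set)"
  morphisms coord of_coords
  by (rule exI[of _ "\<lambda>_. 0"]) (simp add: ell2_space_def)

lemma coord_sq_summable: "(\<lambda>i. (coord x i)\<^sup>2) summable_on A"
  using coord[of x] by (auto simp: ell2_space_def intro: summable_on_subset)

lemma in_ell2_space_UNIV: "f \<in> ell2_space UNIV \<longleftrightarrow> (\<lambda>i. (f i)\<^sup>2) summable_on UNIV"
  by (simp add: ell2_space_def)

lemma sq_summable_dominated:
  fixes f :: "'i \<Rightarrow> real"
  assumes "(\<lambda>i. (g i)\<^sup>2) summable_on UNIV" "\<And>i. \<bar>f i\<bar> \<le> \<bar>g i\<bar>"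
  shows "(\<lambda>i. (f i)\<^sup>2) summable_on UNIV"
  using assms(1) by (rule summable_on_comparison_test) (use assms(2) in \<open>auto simp: abs_le_square_iff\<close>)

lemma sq_summable_add:
  fixes f g :: "'i \<Rightarrow> real"
  assumes "(\<lambda>i. (f i)\<^sup>2) summable_on UNIV" "(\<lambda>i. (g i)\<^sup>2) summable_on UNIV"
  shows "(\<lambda>i. (f i + g i)\<^sup>2) summable_on UNIV"
  using summable_on_diff_squares[of f UNIV "\<lambda>i. - g i"] assms by simp

lemma sq_summable_finite_support:
  fixes f :: "'i \<Rightarrow> real"
  assumes "finite {i. f i \<noteq> 0}"
  shows "(\<lambda>i. (f i)\<^sup>2) summable_on UNIV"
  using summable_on_cong_neutral[of UNIV "{i. f i \<noteq> 0}" "\<lambda>i. (f i)\<^sup>2" "\<lambda>i. (f i)\<^sup>2"] assms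
  by auto

instantiation sqsum :: (type) real_vector
begin

definition "0 = of_coords (\<lambda>_. 0)"
definition "x + y = of_coords (\<lambda>i. coord x i + coord y i)"
definition "x - y = of_coords (\<lambda>i. coord x i - coord y i)"
definition "- x = of_coords (\<lambda>i. - coord x i)"
definition "r *\<^sub>R x = of_coords (\<lambda>i. r * coord x i)"
lemma coord_of_coords: "(\<lambda>i. (f i)\<^sup>2) summable_on UNIV \<Longrightarrow> coord (of_coords f) = f"
  by (simp add: of_coords_inverse in_ell2_space_UNIV)

lemma coord_zero [simp]: "coord 0 i = 0"
  by (simp add: zero_sqsum_def coord_of_coords)

lemma coord_add [simp]: "coord (x + y) i = coord x i + coord y i"
  by (simp add: plus_sqsum_def coord_of_coords sq_summable_add coord_sq_summable)

lemma coord_diff [simp]: "coord (x - y) i = coord x i - coord y i"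
  by (simp add: minus_sqsum_def coord_of_coords summable_on_diff_squares coord_sq_summable)

lemma coord_minus [simp]: "coord (- x) i = - coord x i"
  by (simp add: uminus_sqsum_def coord_of_coords coord_sq_summable)

lemma coord_scaleR [simp]: "coord (r *\<^sub>R x) i = r * coord x i"
proof -
  have "(\<lambda>i. (r * coord x i)\<^sup>2) summable_on UNIV"
    by (simp add: power_mult_distrib summable_on_cmult_right coord_sq_summable)
  then show ?thesis
    by (simp add: scaleR_sqsum_def coord_of_coords)
qed

lemma sqsum_eqI: "(\<And>i. coord x i = coord y i) \<Longrightarrow> x = y"
  by (metis coord_inject ext)

instance
  by standard (auto intro!: sqsum_eqI simp: algebra_simps)

end

instantiation sqsum :: (type) real_normed_vector
begin

definition norm_sqsum_def:
  "norm (x :: 'a sqsum) = sqrt (\<Sum>\<^sub>\<infinity>i. (coord x i)\<^sup>2)"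
definition dist_sqsum_def:
  "dist (x :: 'a sqsum) y = norm (x - y)"
definition "sgn x = x /\<^sub>R norm x" for x :: "'a sqsum"
definition uniformity_sqsum_def:
  "(uniformity :: ('a sqsum \<times> 'a sqsum) filter) = (INF e\<in>{0 <..}. principal {(x, y). dist x y < e})"
definition open_sqsum_def:
  "open (U :: 'a sqsum set) = (\<forall>x\<in>U. eventually (\<lambda>(x', y). x' = x \<longrightarrow> y \<in> U) uniformity)"

lemma dist_eq_ell2_dist: "dist x y = ell2_dist UNIV (coord x) (coord y)"
  by (simp add: dist_sqsum_def norm_sqsum_def ell2_dist_def)

instance
proof
  interpret M: Metric_space "ell2_space (UNIV :: 'a set)" "ell2_dist UNIV"
    by (rule Metric_space_ell2)
  fix x y z :: "'a sqsum" and r s :: real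
  show "norm x = 0 \<longleftrightarrow> x = 0"
    using M.zero[OF coord[of x] coord[of 0]]
    by (simp add: norm_sqsum_def ell2_dist_def coord_inject)
  show "norm (r *\<^sub>R x) = \<bar>r\<bar> * norm x"
    by (simp add: norm_sqsum_def power_mult_distrib infsum_cmult_right' real_sqrt_mult)
  show "norm (x + y) \<le> norm x + norm y"
    using M.triangle[OF coord[of x] coord[of 0] coord[of "-y"]]
    by (simp add: norm_sqsum_def ell2_dist_def)
qed (simp_all add: dist_sqsum_def sgn_sqsum_def uniformity_sqsum_def open_sqsum_def)

end

lemma norm_sqsum_sq: "(norm x)\<^sup>2 = (\<Sum>\<^sub>\<infinity>i. (coord x i)\<^sup>2)" for x :: "'i sqsum"
  by (simp add: norm_sqsum_def infsum_nonneg)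

lemma norm_sqsum_mono:
  fixes x y :: "'i sqsum"
  assumes "\<And>i. \<bar>coord x i\<bar> \<le> \<bar>coord y i\<bar>"
  shows "norm x \<le> norm y"
  unfolding norm_sqsum_def
  by (intro real_sqrt_le_mono infsum_mono coord_sq_summable) (use assms abs_le_square_iff in blast)

lemma abs_coord_le_norm: "\<bar>coord x i\<bar> \<le> norm x" for x :: "'i sqsum"
proof -
  have "(coord x i)\<^sup>2 \<le> (norm x)\<^sup>2"
    using finite_sum_le_infsum[of "\<lambda>i. (coord x i)\<^sup>2" UNIV "{i}"] coord_sq_summable[of x UNIV]
    by (simp add: norm_sqsum_sq)
  then show ?thesis
    by (simp add: abs_le_square_iff[symmetric])
qed

lemma abs_coord_diff_le_dist: "\<bar>coord x i - coord y i\<bar> \<le> dist x y" for x :: "'i sqsum"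
  using abs_coord_le_norm[of "x - y" i] by (simp add: dist_norm)

lemma bounded_linear_coord: "bounded_linear (\<lambda>x. coord x i)"
  by (rule bounded_linear_intro[of _ 1]) (auto simp: abs_coord_le_norm)

lemmas continuous_on_coord [continuous_intros] = bounded_linear.continuous_on[OF bounded_linear_coord]

definition basis_vec :: "'i \<Rightarrow> 'i sqsum" where
  "basis_vec i = of_coords (\<lambda>j. if j = i then 1 else 0)"

lemma coord_basis_vec [simp]: "coord (basis_vec i) j = (if j = i then 1 else 0)"
proof -
  have "(\<lambda>j. (if j = i then 1 else 0 :: real)\<^sup>2) summable_on UNIV"
    by (rule sq_summable_finite_support) simp
  then show ?thesis
    by (simp add: basis_vec_def coord_of_coords)
qed

lemma norm_basis_vec [simp]: "norm (basis_vec i) = 1"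
proof -
  have "(\<Sum>\<^sub>\<infinity>j. (coord (basis_vec i) j)\<^sup>2) = (\<Sum>\<^sub>\<infinity>j\<in>{i}. 1)"
    by (rule infsum_cong_neutral) auto
  then show ?thesis
    by (simp add: norm_sqsum_def)
qed

definition supp :: "'i sqsum \<Rightarrow> 'i set" where
  "supp x = {i. coord x i \<noteq> 0}"

lemma supp_add: "supp (x + y) \<subseteq> supp x \<union> supp y"
  by (auto simp: supp_def)

lemma supp_scaleR: "supp (r *\<^sub>R x) \<subseteq> supp x"
  by (auto simp: supp_def)

lemma closed_supp_subset: "closed {x :: 'i sqsum. supp x \<subseteq> J}"
proof -
  have "{x :: 'i sqsum. supp x \<subseteq> J} = (\<Inter>i\<in>-J. {x. coord x i = 0})"
    by (auto simp: supp_def)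
  also have "closed \<dots>"
    by (intro closed_INT ballI closed_Collect_eq continuous_intros)
  finally show ?thesis .
qed

section \<open>Soft thresholding\<close>

definition shrink :: "real \<Rightarrow> real \<Rightarrow> real" where
  "shrink t c = (if c \<ge> 0 then max (c - t) 0 else min (c + t) 0)"

lemma shrink_zero [simp]: "shrink 0 c = c" "t \<ge> 0 \<Longrightarrow> shrink t 0 = 0"
  by (auto simp: shrink_def)

lemma shrink_eq_0: "t \<ge> 0 \<Longrightarrow> shrink t c = 0 \<longleftrightarrow> \<bar>c\<bar> \<le> t \<or> c = 0"
  by (auto simp: shrink_def max_def min_def)

lemma shrink_le: "t \<ge> 0 \<Longrightarrow> \<bar>shrink t c\<bar> \<le> \<bar>c\<bar>"
  by (auto simp: shrink_def max_def min_def)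

lemma shrink_nonexpansive: "t \<ge> 0 \<Longrightarrow> \<bar>shrink t c - shrink t d\<bar> \<le> \<bar>c - d\<bar>"
  by (auto simp: shrink_def max_def min_def)

lemma shrink_lipschitz: "t \<ge> 0 \<Longrightarrow> s \<ge> 0 \<Longrightarrow> \<bar>shrink t c - shrink s c\<bar> \<le> \<bar>t - s\<bar>"
  by (auto simp: shrink_def max_def min_def)

lemma shrink_diff_le: "t \<ge> 0 \<Longrightarrow> s \<ge> 0 \<Longrightarrow> \<bar>shrink t c - shrink s c\<bar> \<le> \<bar>c\<bar>"
  by (auto simp: shrink_def max_def min_def)

definition threshold :: "real \<Rightarrow> 'i sqsum \<Rightarrow> 'i sqsum" where
  "threshold t x = of_coords (\<lambda>i. shrink t (coord x i))"

lemma coord_threshold [simp]: "t \<ge> 0 \<Longrightarrow> coord (threshold t x) i = shrink t (coord x i)"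
  unfolding threshold_def
  by (subst coord_of_coords) (auto intro: sq_summable_dominated[OF coord_sq_summable] shrink_le)

lemma threshold_0 [simp]: "threshold 0 x = x"
  by (rule sqsum_eqI) simp

lemma supp_threshold: "t \<ge> 0 \<Longrightarrow> supp (threshold t x) \<subseteq> supp x"
  by (auto simp: supp_def)

lemma finite_large_coords:
  fixes x :: "'i sqsum"
  assumes "t > 0"
  shows "finite {i. \<bar>coord x i\<bar> \<ge> t}"
proof (rule ccontr)
  assume inf: "infinite {i. \<bar>coord x i\<bar> \<ge> t}"
  obtain n :: nat where n: "(norm x)\<^sup>2 < n * t\<^sup>2"
    using reals_Archimedean3[of "t\<^sup>2"] assms by auto
  obtain F where F: "F \<subseteq> {i. \<bar>coord x i\<bar> \<ge> t}" "finite F" "card F = n"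
    using infinite_arbitrarily_large[OF inf] by metis
  have "n * t\<^sup>2 = (\<Sum>i\<in>F. t\<^sup>2)"
    using F by simp
  also have "\<dots> \<le> (\<Sum>i\<in>F. (coord x i)\<^sup>2)"
    using F assms by (intro sum_mono) (auto simp: abs_le_square_iff[symmetric])
  also have "\<dots> \<le> (norm x)\<^sup>2"
    unfolding norm_sqsum_sq using F by (intro finite_sum_le_infsum coord_sq_summable) auto
  finally show False
    using n by simp
qed

lemma finite_supp_threshold: "t > 0 \<Longrightarrow> finite (supp (threshold t x))"
  by (rule finite_subset[OF _ finite_large_coords[of t x]]) (auto simp: supp_def shrink_eq_0)

lemma norm_threshold_diff: "t \<ge> 0 \<Longrightarrow> norm (threshold t x - threshold t y) \<le> norm (x - y)"
  by (rule norm_sqsum_mono) (simp add: shrink_nonexpansive)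

lemma sqsum_tail_small:
  fixes x :: "'i sqsum"
  assumes "e > 0"
  shows "\<exists>F. finite F \<and> (\<Sum>\<^sub>\<infinity>i\<in>-F. (coord x i)\<^sup>2) < e"
proof -
  have "((\<lambda>i. (coord x i)\<^sup>2) has_sum (norm x)\<^sup>2) UNIV"
    unfolding norm_sqsum_sq by (rule has_sum_infsum[OF coord_sq_summable])
  then have "(sum (\<lambda>i. (coord x i)\<^sup>2) \<longlongrightarrow> (norm x)\<^sup>2) (finite_subsets_at_top UNIV)"
    by (simp add: has_sum_def)
  then have "eventually (\<lambda>F. dist (\<Sum>i\<in>F. (coord x i)\<^sup>2) ((norm x)\<^sup>2) < e) (finite_subsets_at_top UNIV)"
    using assms by (rule tendstoD)
  then obtain F where F: "finite F" "dist (\<Sum>i\<in>F. (coord x i)\<^sup>2) ((norm x)\<^sup>2) < e"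
    by (auto simp: eventually_finite_subsets_at_top)
  have "(norm x)\<^sup>2 = (\<Sum>\<^sub>\<infinity>i\<in>F \<union> -F. (coord x i)\<^sup>2)"
    by (simp add: norm_sqsum_sq Un_commute)
  also have "\<dots> = (\<Sum>i\<in>F. (coord x i)\<^sup>2) + (\<Sum>\<^sub>\<infinity>i\<in>-F. (coord x i)\<^sup>2)"
    using F by (subst infsum_Un_disjoint) (auto intro: coord_sq_summable)
  finally show ?thesis
    using F by (intro exI[of _ F]) (auto simp: dist_real_def)
qed

text \<open>Two facts work together: outside a finite set \<open>F\<close> the point has small norm, and so has any change
  caused by thresholding; on \<open>F\<close> each coordinate changes by at most \<open>\<bar>s - t\<bar>\<close>.\<close>

lemma threshold_tendsto:
  fixes x :: "'i sqsum"
  assumes "t \<ge> 0" "e > 0"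
  shows "\<exists>d>0. \<forall>s\<ge>0. \<bar>s - t\<bar> < d \<longrightarrow> norm (threshold s x - threshold t x) < e"
proof -
  obtain F where F: "finite F" "(\<Sum>\<^sub>\<infinity>i\<in>-F. (coord x i)\<^sup>2) < e\<^sup>2 / 2"
    using sqsum_tail_small[of "e\<^sup>2 / 2" x] assms by auto
  define d where "d = e / (2 * sqrt (card F + 1))"
  have "d > 0"
    using assms by (simp add: d_def)
  moreover have "norm (threshold s x - threshold t x) < e" if s: "s \<ge> 0" "\<bar>s - t\<bar> < d" for s
  proof -
    let ?z = "threshold s x - threshold t x"
    have "(norm ?z)\<^sup>2 = (\<Sum>\<^sub>\<infinity>i\<in>F \<union> -F. (coord ?z i)\<^sup>2)"
      unfolding norm_sqsum_sq by (simp add: Un_commute)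
    also have "\<dots> = (\<Sum>i\<in>F. (coord ?z i)\<^sup>2) + (\<Sum>\<^sub>\<infinity>i\<in>-F. (coord ?z i)\<^sup>2)"
      using F by (subst infsum_Un_disjoint) (auto intro: coord_sq_summable simp del: coord_diff)
    also have "(\<Sum>i\<in>F. (coord ?z i)\<^sup>2) \<le> (\<Sum>i\<in>F. d\<^sup>2)"
    proof (rule sum_mono)
      fix i
      have "\<bar>coord ?z i\<bar> \<le> \<bar>d\<bar>"
        using s assms shrink_lipschitz[of s t "coord x i"] by simp
      then show "(coord ?z i)\<^sup>2 \<le> d\<^sup>2"
        by (simp add: abs_le_square_iff)
    qed
    also have "(\<Sum>i\<in>F. d\<^sup>2) \<le> (card F + 1) * d\<^sup>2"
      by (simp add: algebra_simps)
    also have "(card F + 1) * d\<^sup>2 = e\<^sup>2 / 4"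
      by (simp add: d_def power_divide power_mult_distrib field_simps)
    also have "(\<Sum>\<^sub>\<infinity>i\<in>-F. (coord ?z i)\<^sup>2) \<le> (\<Sum>\<^sub>\<infinity>i\<in>-F. (coord x i)\<^sup>2)"
      using s assms
      by (intro infsum_mono coord_sq_summable) (simp add: abs_le_square_iff[symmetric] shrink_diff_le)
    also note F(2)
    finally have "(norm ?z)\<^sup>2 < e\<^sup>2"
      using zero_le_power2[of e] by linarith
    then show ?thesis
      using assms power2_less_imp_less by fastforce
  qed
  ultimately show ?thesis
    by blast
qed

text \<open>Joint continuity follows from continuity in the level for each point, because thresholding at a fixed
  level does not increase distances.\<close>

lemma continuous_threshold:
  "continuous_on ({0..} \<times> UNIV) (\<lambda>p. threshold (fst p) (snd p) :: 'i sqsum)"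
proof (rule continuous_onI)
  fix p :: "real \<times> 'i sqsum" and e :: real
  assume p: "p \<in> {0..} \<times> UNIV" and e: "e > 0"
  obtain t x where tx: "p = (t, x)" "t \<ge> 0"
    using p by auto
  obtain d where d: "d > 0" "\<forall>s\<ge>0. \<bar>s - t\<bar> < d \<longrightarrow> norm (threshold s x - threshold t x) < e / 2"
    using threshold_tendsto[OF tx(2), of "e/2" x] e by auto
  show "\<exists>d>0. \<forall>q\<in>{0..} \<times> UNIV. dist q p < d \<longrightarrow>
            dist (threshold (fst q) (snd q)) (threshold (fst p) (snd p)) \<le> e"
  proof (intro exI[of _ "min d (e/2)"] conjI ballI impI)
    fix q :: "real \<times> 'i sqsum"
    assume q: "q \<in> {0..} \<times> UNIV" "dist q p < min d (e / 2)"
    obtain s y where sy: "q = (s, y)" "s \<ge> 0"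
      using q by auto
    have "\<bar>s - t\<bar> < d" "norm (y - x) < e / 2"
      using q dist_fst_le[of q p] dist_snd_le[of q p] by (auto simp: sy tx dist_norm)
    then have "norm (threshold s y - threshold s x) < e / 2" "norm (threshold s x - threshold t x) < e/2"
      using norm_threshold_diff[OF sy(2), of y x] d sy by auto
    then show "dist (threshold (fst q) (snd q)) (threshold (fst p) (snd p)) \<le> e"
      using norm_triangle_ineq[of "threshold s y - threshold s x" "threshold s x - threshold t x"]
      by (simp add: sy tx dist_norm)
  qed (use d e in auto)
qed

lemma continuous_on_threshold [continuous_intros]:
  assumes "continuous_on S f" "continuous_on S g" "\<And>s. s \<in> S \<Longrightarrow> f s \<ge> 0"
  shows "continuous_on S (\<lambda>s. threshold (f s) (g s))"
  using continuous_on_compose2[OF continuous_threshold, of S "\<lambda>s. (f s, g s)"] assms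
  by (auto intro: continuous_on_Pair)

section \<open>Controlled radii\<close>

definition contraction_on :: "'a::metric_space set \<Rightarrow> ('a \<Rightarrow> real) \<Rightarrow> bool" where
  "contraction_on S e \<longleftrightarrow> (\<forall>x\<in>S. \<forall>y\<in>S. \<bar>e x - e y\<bar> \<le> dist x y)"

lemma contraction_on_continuous: "contraction_on S e \<Longrightarrow> continuous_on S e"
  unfolding contraction_on_def continuous_on_iff dist_real_def
  by (meson dual_order.strict_trans2 le_less_trans)

text \<open>If a property of balls holds for small radii and passes to smaller balls inside, then admissible radii can be
  chosen in a \<open>1\<close>-Lipschitz way: half the supremum of the admissible radii does it.  This is
  used in place of paracompactness, for covers, for homotopies and for discrete families.\<close>

lemma controlled_radius:
  fixes S :: "'a::metric_space set" and P :: "'a \<Rightarrow> real \<Rightarrow> bool"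
  assumes ex: "\<And>x. x \<in> S \<Longrightarrow> \<exists>r>0. P x r"
    and mono: "\<And>x y r s. x \<in> S \<Longrightarrow> y \<in> S \<Longrightarrow> P x r \<Longrightarrow> 0 < s \<Longrightarrow> s + dist x y \<le> r \<Longrightarrow> P y s"
  obtains e where "contraction_on S e" "\<And>x. x \<in> S \<Longrightarrow> 0 < e x \<and> e x \<le> 1 \<and> P x (e x)"
proof -
  define R where "R x = {r. 0 < r \<and> r \<le> 2 \<and> P x r}" for x
  define e where "e x = Sup (R x) / 2" for x
  have bdd: "bdd_above (R x)" for x
    by (rule bdd_aboveI[of _ 2]) (simp add: R_def)
  have ne: "R x \<noteq> {}" if x: "x \<in> S" for x
  proof -
    obtain r where "r > 0" "P x r"
      using ex[OF x] by auto
    then have "min r 2 \<in> R x"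
      using mono[of x x r "min r 2"] x by (auto simp: R_def)
    then show ?thesis by auto
  qed
  have pos: "0 < e x" if x: "x \<in> S" for x
  proof -
    obtain r where "r \<in> R x"
      using ne[OF x] by auto
    then show ?thesis
      using cSup_upper[OF _ bdd, of r x] by (auto simp: e_def R_def)
  qed
  have le1: "e x \<le> 1" if "x \<in> S" for x
    unfolding e_def using cSup_least[OF ne[OF that], of 2] by (auto simp: R_def)
  have P: "P x (e x)" if x: "x \<in> S" for x
  proof -
    have "e x < Sup (R x)"
      using pos[OF x] by (simp add: e_def)
    then obtain r where r: "r \<in> R x" "e x < r"
      using less_cSup_iff[OF ne[OF x] bdd] by auto
    then show ?thesis
      using mono[of x x r "e x"] x pos[OF x] by (auto simp: R_def)
  qed
  have *: "Sup (R x) \<le> Sup (R y) + dist x y" if "x \<in> S" "y \<in> S" for x y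
  proof (rule cSup_least[OF ne[OF that(1)]])
    fix r assume r: "r \<in> R x"
    show "r \<le> Sup (R y) + dist x y"
    proof (cases "r \<le> dist x y")
      case True
      then show ?thesis
        using pos[OF that(2)] by (simp add: e_def)
    next
      case False
      then have "P y (r - dist x y)"
        using r mono[of x y r "r - dist x y"] that by (auto simp: R_def)
      then have "r - dist x y \<in> R y"
        using r False zero_le_dist[of x y] by (auto simp: R_def simp del: zero_le_dist)
      then show ?thesis
        using cSup_upper[OF _ bdd, of "r - dist x y" y] by simp
    qed
  qed
  have "contraction_on S e"
    unfolding contraction_on_def
  proof (intro ballI)
    fix x y assume "x \<in> S" "y \<in> S"
    then show "\<bar>e x - e y\<bar> \<le> dist x y"
      using *[of x y] *[of y x] zero_le_dist[of x y] dist_commute[of x y]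
      unfolding e_def by linarith
  qed
  then show thesis
    using that pos le1 P by blast
qed

lemma contraction_on_min:
  assumes "contraction_on S e" "contraction_on S f"
  shows "contraction_on S (\<lambda>x. min (e x) (f x))"
  unfolding contraction_on_def
proof (intro ballI)
  fix x y assume "x \<in> S" "y \<in> S"
  then have "\<bar>e x - e y\<bar> \<le> dist x y" "\<bar>f x - f y\<bar> \<le> dist x y"
    using assms by (auto simp: contraction_on_def)
  then show "\<bar>min (e x) (f x) - min (e y) (f y)\<bar> \<le> dist x y"
    by linarith
qed

lemma contraction_on_scale:
  assumes "contraction_on S e" "0 \<le> c" "c \<le> 1"
  shows "contraction_on S (\<lambda>x. c * e x)"
  unfolding contraction_on_def
proof (intro ballI)
  fix x y assume "x \<in> S" "y \<in> S"
  then have "\<bar>e x - e y\<bar> \<le> dist x y"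
    using assms by (auto simp: contraction_on_def)
  moreover have "\<bar>c * e x - c * e y\<bar> = c * \<bar>e x - e y\<bar>"
    using assms by (simp add: abs_mult flip: right_diff_distrib)
  moreover have "\<dots> \<le> \<bar>e x - e y\<bar>"
    using assms by (simp add: mult_left_le_one_le)
  ultimately show "\<bar>c * e x - c * e y\<bar> \<le> dist x y"
    by linarith
qed

lemma open_cover_radius:
  fixes S :: "'a::metric_space set"
  assumes "open_cover (top_of_set S) \<U>"
  obtains e where "contraction_on S e"
    "\<And>x. x \<in> S \<Longrightarrow> 0 < e x \<and> e x \<le> 1"
    "\<And>x y. x \<in> S \<Longrightarrow> y \<in> S \<Longrightarrow> dist x y < e x \<Longrightarrow> \<exists>U\<in>\<U>. x \<in> U \<and> y \<in> U"
proof -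
  define P where "P x r \<longleftrightarrow> (\<exists>U\<in>\<U>. \<forall>y\<in>S. dist x y < r \<longrightarrow> y \<in> U)" for x r
  have "\<exists>r>0. P x r" if x: "x \<in> S" for x
  proof -
    obtain U where U: "U \<in> \<U>" "x \<in> U" "openin (top_of_set S) U"
      using assms x by (auto simp: open_cover_def)
    then obtain r where "r > 0" "ball x r \<inter> S \<subseteq> U"
      by (auto simp: openin_contains_ball)
    then show ?thesis
      using U unfolding P_def by (intro exI[of _ r]) (auto simp: subset_iff)
  qed
  moreover have "P y s" if "P x r" "s + dist x y \<le> r" for x y r s
  proof -
    have "dist x z < r" if "dist y z < s" for z
      using that \<open>s + dist x y \<le> r\<close> dist_triangle[of x z y] by linarith
    then show ?thesis
      using that(1) unfolding P_def by blast
  qed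
  ultimately obtain e where e: "contraction_on S e" "\<And>x. x \<in> S \<Longrightarrow> 0 < e x \<and> e x \<le> 1 \<and> P x (e x)"
    using controlled_radius[of S P] by metis
  show thesis
  proof (rule that[OF e(1)])
    fix x y assume xy: "x \<in> S" "y \<in> S" "dist x y < e x"
    then obtain U where "U \<in> \<U>" "\<forall>y\<in>S. dist x y < e x \<longrightarrow> y \<in> U"
      using e(2) P_def by blast
    then show "\<exists>U\<in>\<U>. x \<in> U \<and> y \<in> U"
      using xy e(2) by (intro bexI[of _ U]) auto
  qed (use e(2) in auto)
qed

text \<open>By continuity at time \<open>0\<close>, all sufficiently short times are admissible near a given point, and controlled
  radii select a positive one continuously.\<close>

lemma controlled_homotopy_time:
  fixes S :: "'a::metric_space set" and h :: "'a \<Rightarrow> real \<Rightarrow> 'a"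
  assumes h: "continuous_on (S \<times> {0..1}) (\<lambda>p. h (fst p) (snd p))"
    and h0: "\<And>x. x \<in> S \<Longrightarrow> h x 0 = x"
    and e: "continuous_on S e" "\<And>x. x \<in> S \<Longrightarrow> 0 < e x"
  obtains T where "continuous_on S T" "\<And>x. x \<in> S \<Longrightarrow> 0 < T x \<and> T x \<le> 1"
    "\<And>x t. x \<in> S \<Longrightarrow> 0 \<le> t \<Longrightarrow> t \<le> T x \<Longrightarrow> dist (h x t) x < e x"
proof -
  define P where "P x r \<longleftrightarrow> (\<forall>y\<in>S. dist x y < r \<longrightarrow> (\<forall>t. 0 \<le> t \<and> t \<le> 1 \<and> t < r \<longrightarrow> dist (h y t) y < e y))" for x r
  have "\<exists>r>0. P x r" if x: "x \<in> S" for x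
  proof -
    define a where "a = e x / 4"
    have a: "a > 0"
      using e x by (simp add: a_def)
    obtain d where d: "d > 0" "\<forall>p\<in>S \<times> {0..1}. dist p (x, 0) < d \<longrightarrow> dist (h (fst p) (snd p)) (h x 0) < a"
      using h[unfolded continuous_on_iff, rule_format, of "(x, 0)" a] x a by auto
    obtain d' where d': "d' > 0" "\<forall>y\<in>S. dist y x < d' \<longrightarrow> dist (e y) (e x) < a"
      using e(1)[unfolded continuous_on_iff, rule_format, of x a] x a by auto
    define r where "r = min (d / 2) (min d' a)"
    have "dist (h y t) y < e y" if y: "y \<in> S" "dist x y < r" "0 \<le> t" "t \<le> 1" "t < r" for y t
    proof -
      have "dist (y, t) (x, 0) \<le> dist y x + \<bar>t\<bar>"
        using sqrt_sum_squares_le_sum_abs[of "dist y x" t] by (simp add: dist_Pair_Pair)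
      also have "\<dots> < d"
        using y by (simp add: r_def dist_commute)
      finally have "dist (h y t) x < a"
        using d(2)[rule_format, of "(y,t)"] y h0[OF x] by auto
      moreover have "dist (e y) (e x) < a" "dist x y < a"
        using d' y by (auto simp: r_def dist_commute)
      moreover have "dist (h y t) y \<le> dist (h y t) x + dist x y"
        by (rule dist_triangle)
      ultimately show ?thesis
        unfolding a_def dist_real_def by linarith
    qed
    then show ?thesis
      unfolding P_def using d d' a by (intro exI[of _ r]) (auto simp: r_def)
  qed
  moreover have "P y s" if "P x r" "0 < s" "s + dist x y \<le> r" for x y r s
    unfolding P_def
  proof (intro ballI allI impI)
    fix z t assume "z \<in> S" "dist y z < s" "0 \<le> t \<and> t \<le> 1 \<and> t < s"
    moreover from this have "dist x z < r" "t < r"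
      using that dist_triangle[of x z y] zero_le_dist[of x y] by linarith+
    ultimately show "dist (h z t) z < e z"
      using that(1) unfolding P_def by blast
  qed
  ultimately obtain T where T: "contraction_on S T" "\<And>x. x \<in> S \<Longrightarrow> 0 < T x \<and> T x \<le> 1 \<and> P x (T x)"
    using controlled_radius[of S P] by metis
  show thesis
  proof (rule that[of "\<lambda>x. T x / 2"])
    show "continuous_on S (\<lambda>x. T x / 2)"
      by (intro continuous_intros contraction_on_continuous T) auto
    fix x t assume x: "x \<in> S" 
    show "0 < T x / 2 \<and> T x / 2 \<le> 1"
      using T(2)[OF x] by auto
    assume t: "0 \<le> t" "t \<le> T x / 2"
    then show "dist (h x t) x < e x"
      using T(2)[OF x] x unfolding P_def by auto
  qed
qed

section \<open>A unit vector on free coordinates\<close>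

definition clamp :: "real \<Rightarrow> real" where
  "clamp c = min 1 (max 0 c)"

lemma continuous_on_clamp [continuous_intros]:
  "continuous_on S f \<Longrightarrow> continuous_on S (\<lambda>x. clamp (f x))"
  unfolding clamp_def by (intro continuous_intros)

lemma clamp_bounds [simp]: "0 \<le> clamp c" "clamp c \<le> 1"
  by (auto simp: clamp_def)

text \<open>The number \<open>occupied \<pi> t x n\<close> is \<open>1\<close> where thresholding at level \<open>t\<close> leaves the coordinate \<open>\<pi> n\<close> nonzero, and
  \<open>0\<close> where the coordinate is below \<open>t/2\<close>.\<close>

definition occupied :: "(nat \<Rightarrow> 'i) \<Rightarrow> real \<Rightarrow> 'i sqsum \<Rightarrow> nat \<Rightarrow> real" where
  "occupied \<pi> t x n = clamp (2 * \<bar>coord x (\<pi> n)\<bar> / t - 1)"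

text \<open>Stick breaking: at each coordinate the share \<open>1 - occupied\<close> of what is left is spent.  Only coordinates that
  thresholding kills receive a share, nothing is left after the first unoccupied coordinate, and so
  locally only finitely many weights are nonzero.\<close>

definition free_weight :: "(nat \<Rightarrow> 'i) \<Rightarrow> real \<Rightarrow> 'i sqsum \<Rightarrow> nat \<Rightarrow> real" where
  "free_weight \<pi> t x n = (\<Prod>i<n. occupied \<pi> t x i) * (1 - occupied \<pi> t x n)"

definition free_sum :: "(nat \<Rightarrow> 'i) \<Rightarrow> real \<Rightarrow> 'i sqsum \<Rightarrow> 'i sqsum" where
  "free_sum \<pi> t x = (\<Sum>n | free_weight \<pi> t x n \<noteq> 0. free_weight \<pi> t x n *\<^sub>R basis_vec (\<pi> n))"

lemma sum_free_weight: "(\<Sum>i<n. free_weight \<pi> t x i) = 1 - (\<Prod>i<n. occupied \<pi> t x i)"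
  by (induction n) (auto simp: free_weight_def algebra_simps)

lemma free_weight_eq_0: "occupied \<pi> t x m = 0 \<Longrightarrow> m < n \<Longrightarrow> free_weight \<pi> t x n = 0"
  by (auto simp: free_weight_def)

lemma free_sum_eq:
  assumes "occupied \<pi> t x m = 0"
  shows "free_sum \<pi> t x = (\<Sum>n\<le>m. free_weight \<pi> t x n *\<^sub>R basis_vec (\<pi> n))"
  unfolding free_sum_def
proof (rule sum.mono_neutral_left)
  show "{n. free_weight \<pi> t x n \<noteq> 0} \<subseteq> {..m}"
    using free_weight_eq_0[OF assms] not_le by blast
qed auto

lemma ex_free_index:
  fixes x :: "'i sqsum" and \<pi> :: "nat \<Rightarrow> 'i"
  assumes "inj \<pi>" "t > 0"
  shows "\<exists>m. \<bar>coord x (\<pi> m)\<bar> < t"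
proof (rule ccontr)
  assume "\<not> ?thesis"
  then have "range \<pi> \<subseteq> {i. t \<le> \<bar>coord x i\<bar>}"
    by (auto simp: not_less)
  then have "finite (range \<pi>)"
    using finite_large_coords[OF assms(2), of x] by (rule finite_subset)
  then show False
    using finite_imageD[OF _ assms(1)] infinite_UNIV_nat by blast
qed

lemma ex_unoccupied: 
  assumes "inj \<pi>" "t > 0"
  obtains m where "occupied \<pi> t x m = 0"
proof -
  obtain m where "\<bar>coord x (\<pi> m)\<bar> < t / 2"
    using ex_free_index[OF assms(1), of "t/2" x] assms(2) by auto
  then have "2 * \<bar>coord x (\<pi> m)\<bar> / t \<le> 1"
    using assms(2) by (simp add: field_simps)
  then have "occupied \<pi> t x m = 0"
    by (simp add: occupied_def clamp_def)
  then show thesis by (rule that)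
qed

lemma coord_free_sum:
  assumes "inj \<pi>" "t > 0"
  shows "coord (free_sum \<pi> t x) (\<pi> n) = free_weight \<pi> t x n"
    and "i \<notin> range \<pi> \<Longrightarrow> coord (free_sum \<pi> t x) i = 0"
proof -
  obtain m where m: "occupied \<pi> t x m = 0"
    using ex_unoccupied[OF assms] by blast
  have sum: "coord (\<Sum>n\<in>A. f n *\<^sub>R basis_vec (\<pi> n)) i = (\<Sum>n\<in>A. f n * (if i = \<pi> n then 1 else 0))"
    if "finite A" for A f i
    using that by (induction A rule: finite_induct) auto
  have "coord (free_sum \<pi> t x) (\<pi> n) = (\<Sum>k\<le>m. if k = n then free_weight \<pi> t x k else 0)"
    unfolding free_sum_eq[OF m] sum[OF finite_atMost]
    using assms(1) by (intro sum.cong) (auto simp: inj_eq)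
  also have "\<dots> = free_weight \<pi> t x n"
    using free_weight_eq_0[OF m] by (auto simp: sum.delta)
  finally show "coord (free_sum \<pi> t x) (\<pi> n) = free_weight \<pi> t x n" .
  show "coord (free_sum \<pi> t x) i = 0" if "i \<notin> range \<pi>"
    unfolding free_sum_eq[OF m] using that by (auto simp: sum intro!: sum.neutral)
qed

lemma free_sum_nonzero:
  assumes "inj \<pi>" "t > 0"
  shows "free_sum \<pi> t x \<noteq> 0"
proof
  assume 0: "free_sum \<pi> t x = 0"
  obtain m where m: "occupied \<pi> t x m = 0"
    using ex_unoccupied[OF assms] by blast
  have "(\<Sum>i<Suc m. free_weight \<pi> t x i) = 1"
    unfolding sum_free_weight using m by (simp add: prod.lessThan_Suc)
  moreover have "free_weight \<pi> t x n = 0" for n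
    using coord_free_sum(1)[OF assms, of x n] 0 by simp
  ultimately show False by simp
qed

lemma free_sum_threshold:
  assumes "inj \<pi>" "t > 0" "i \<in> supp (free_sum \<pi> t x)"
  shows "i \<in> range \<pi>" "coord (threshold t x) i = 0"
proof -
  show i: "i \<in> range \<pi>"
    using assms coord_free_sum(2)[OF assms(1,2), of i] by (auto simp: supp_def)
  then obtain n where n: "i = \<pi> n" by auto
  then have "free_weight \<pi> t x n \<noteq> 0"
    using assms coord_free_sum(1)[OF assms(1,2), of x n] by (auto simp: supp_def)
  then have "occupied \<pi> t x n \<noteq> 1"
    by (auto simp: free_weight_def)
  then have "2 * \<bar>coord x i\<bar> / t < 2"
    by (auto simp: occupied_def clamp_def n min_def max_def split: if_splits)
  then have "\<bar>coord x i\<bar> < t"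
    using assms(2) by (simp add: field_simps)
  then show "coord (threshold t x) i = 0"
    using assms by (simp add: shrink_eq_0)
qed

lemma finite_supp_free_sum:
  assumes "inj \<pi>" "t > 0" shows "finite (supp (free_sum \<pi> t x))"
proof -
  obtain m where m: "occupied \<pi> t x m = 0"
    using ex_unoccupied[OF assms] by blast
  have "supp (free_sum \<pi> t x) \<subseteq> \<pi> ` {..m}"
  proof
    fix i assume i: "i \<in> supp (free_sum \<pi> t x)"
    then obtain n where n: "i = \<pi> n"
      using free_sum_threshold(1)[OF assms] by blast
    then have "free_weight \<pi> t x n \<noteq> 0"
      using i coord_free_sum(1)[OF assms] by (auto simp: supp_def)
    then show "i \<in> \<pi> ` {..m}"
      using free_weight_eq_0[OF m] n by (metis atMost_iff imageI linorder_not_le)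
  qed
  then show ?thesis
    using finite_subset by blast
qed

text \<open>Near a point the same coordinate stays unoccupied, so the sum has a fixed finite range there.\<close>

lemma continuous_free_sum:
  assumes "inj \<pi>"
  shows "continuous_on ({0<..} \<times> UNIV) (\<lambda>p. free_sum \<pi> (fst p) (snd p))"
proof -
  let ?S = "{0<..} \<times> UNIV :: (real \<times> 'a sqsum) set"
  have occupied: "continuous_on S (\<lambda>p. occupied \<pi> (fst p) (snd p) n)" if "S \<subseteq> ?S" for n S
    unfolding occupied_def using that by (intro continuous_intros) auto
  show ?thesis
  proof (rule continuous_at_imp_continuous_on, rule ballI)
    fix p assume p: "p \<in> ?S"
    obtain t x where tx: "p = (t, x)" "t > 0"
      using p by auto
    obtain m where m: "\<bar>coord x (\<pi> m)\<bar> < t / 2"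
      using ex_free_index[OF assms(1), of "t/2" x] tx by auto
    define U where "U = {q \<in> ?S. \<bar>coord (snd q) (\<pi> m)\<bar> < fst q / 2}"
    have "U = {q :: real \<times> 'a sqsum. 0 < fst q} \<inter> {q. \<bar>coord (snd q) (\<pi> m)\<bar> < fst q / 2}"
      by (auto simp: U_def)
    also have "open \<dots>"
      by (intro open_Int open_Collect_less continuous_intros) auto
    finally have "open U" .
    have eq: "free_sum \<pi> (fst q) (snd q) = (\<Sum>n\<le>m. free_weight \<pi> (fst q) (snd q) n *\<^sub>R basis_vec (\<pi> n))"
      if "q \<in> U" for q
    proof (rule free_sum_eq)
      have "2 * \<bar>coord (snd q) (\<pi> m)\<bar> / fst q \<le> 1"
        using that by (auto simp: U_def field_simps)
      then show "occupied \<pi> (fst q) (snd q) m = 0"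
        by (simp add: occupied_def clamp_def)
    qed
    have "continuous_on U (\<lambda>q. (\<Sum>n\<le>m. free_weight \<pi> (fst q) (snd q) n *\<^sub>R basis_vec (\<pi> n)))"
      unfolding free_weight_def by (intro continuous_intros occupied) (auto simp: U_def)
    then have "continuous_on U (\<lambda>q. free_sum \<pi> (fst q) (snd q))"
      by (rule continuous_on_eq) (simp add: eq)
    moreover have "p \<in> U"
      using m tx by (simp add: U_def)
    ultimately show "isCont (\<lambda>q. free_sum \<pi> (fst q) (snd q)) p"
      using \<open>open U\<close> continuous_on_eq_continuous_at by blast
  qed
qed

definition free_unit :: "(nat \<Rightarrow> 'i) \<Rightarrow> real \<Rightarrow> 'i sqsum \<Rightarrow> 'i sqsum" where
  "free_unit \<pi> t x = sgn (free_sum \<pi> t x)"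

lemma norm_free_unit: "inj \<pi> \<Longrightarrow> t > 0 \<Longrightarrow> norm (free_unit \<pi> t x) = 1"
  by (simp add: free_unit_def norm_sgn free_sum_nonzero)

lemma supp_free_unit: "inj \<pi> \<Longrightarrow> t > 0 \<Longrightarrow> supp (free_unit \<pi> t x) = supp (free_sum \<pi> t x)"
  using free_sum_nonzero[of \<pi> t x] by (auto simp: free_unit_def supp_def sgn_sqsum_def)

lemma continuous_on_free_unit [continuous_intros]:
  assumes "inj \<pi>" "continuous_on S f" "continuous_on S g" "\<And>s. s \<in> S \<Longrightarrow> f s > 0"
  shows "continuous_on S (\<lambda>s. free_unit \<pi> (f s) (g s))"
proof -
  have "continuous_on S (\<lambda>s. free_sum \<pi> (f s) (g s))"
    using continuous_on_compose2[OF continuous_free_sum[OF assms(1)], of S "\<lambda>s. (f s, g s)"] assms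
    by (auto intro: continuous_on_Pair)
  then show ?thesis
    unfolding free_unit_def sgn_div_norm using assms(1,4)
    by (intro continuous_intros) (auto simp: free_sum_nonzero)
qed

section \<open>Z-sets\<close>

text \<open>The subspace of finitely supported families, which corresponds to \<open>\<ell>\<^sub>2\<^sup>f\<close> when \<open>K\<close> is the field of the cardinal.\<close>

definition fin_sqsum :: "'i set \<Rightarrow> 'i sqsum set" where
  "fin_sqsum K = {x. finite (supp x) \<and> supp x \<subseteq> K}"

lemma fin_sqsum_add: "x \<in> fin_sqsum K \<Longrightarrow> y \<in> fin_sqsum K \<Longrightarrow> x + y \<in> fin_sqsum K"
  using supp_add[of x y] by (auto simp: fin_sqsum_def intro: finite_subset)

lemma fin_sqsum_scaleR: "x \<in> fin_sqsum K \<Longrightarrow> r *\<^sub>R x \<in> fin_sqsum K"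
  using supp_scaleR[of r x] by (auto simp: fin_sqsum_def intro: finite_subset)

lemma fin_sqsum_basis_vec: "i \<in> K \<Longrightarrow> basis_vec i \<in> fin_sqsum K"
  by (auto simp: fin_sqsum_def supp_def)

lemma fin_sqsum_threshold: "t \<ge> 0 \<Longrightarrow> x \<in> fin_sqsum K \<Longrightarrow> threshold t x \<in> fin_sqsum K"
  using supp_threshold[of t x] by (auto simp: fin_sqsum_def intro: finite_subset)

lemma fin_sqsum_free_unit:
  "inj \<pi> \<Longrightarrow> range \<pi> \<subseteq> K \<Longrightarrow> t > 0 \<Longrightarrow> free_unit \<pi> t x \<in> fin_sqsum K"
  using free_sum_threshold(1)[of \<pi> t _ x]
  by (auto simp: fin_sqsum_def supp_free_unit finite_supp_free_sum)

lemma threshold_time: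
  fixes S :: "('i sqsum \<times> 'b::metric_space) set"
  assumes "continuous_on S e" "\<And>p. p \<in> S \<Longrightarrow> 0 < e p"
  obtains T where "continuous_on S T" "\<And>p. p \<in> S \<Longrightarrow> 0 < T p"
    "\<And>p. p \<in> S \<Longrightarrow> norm (threshold (T p) (fst p) - fst p) < e p"
proof -
  define h :: "'i sqsum \<times> 'b \<Rightarrow> real \<Rightarrow> 'i sqsum \<times> 'b" where
    "h p t = (threshold t (fst p), snd p)" for p t
  have "continuous_on (S \<times> {0..1}) (\<lambda>p. h (fst p) (snd p))"
    unfolding h_def by (intro continuous_intros) auto
  moreover have "h p 0 = p" for p
    by (simp add: h_def)
  ultimately obtain T where T: "continuous_on S T" "\<And>x. x \<in> S \<Longrightarrow> 0 < T x \<and> T x \<le> 1"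
    "\<And>x t. x \<in> S \<Longrightarrow> 0 \<le> t \<Longrightarrow> t \<le> T x \<Longrightarrow> dist (h x t) x < e x"
    by (rule controlled_homotopy_time[OF _ _ assms]) blast+
  show thesis
  proof (rule that[OF T(1)])
    fix p assume p: "p \<in> S"
    show "0 < T p"
      using T(2)[OF p] by simp
    have "dist (h p (T p)) p < e p"
      using T(2,3)[OF p] by auto
    then show "norm (threshold (T p) (fst p) - fst p) < e p"
      using dist_fst_le[of "h p (T p)" p] by (simp add: h_def dist_norm)
  qed
qed

text \<open>The map thresholds the first component and adds a vector of length \<open>e p\<close> on coordinates in the range of \<open>\<pi>\<close> that have become
  zero.  Its values are at distance at least \<open>e p\<close> from the set, and \<open>p\<close> moves by less than \<open>2 * e p\<close>; as
  \<open>e\<close> is Lipschitz, this bounds the distance of the whole image from each point of the set from below.\<close>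

lemma strong_Z_set_vanishing:
  fixes \<Omega> :: "'b::metric_space set" and \<pi> :: "nat \<Rightarrow> 'i"
  assumes pi: "inj \<pi>" "range \<pi> \<subseteq> K"
  shows "strong_Z_set (top_of_set (fin_sqsum K \<times> \<Omega>))
           {p \<in> fin_sqsum K \<times> \<Omega>. \<forall>n. coord (fst p) (\<pi> n) = 0}"
    (is "strong_Z_set (top_of_set ?X) ?A")
  unfolding strong_Z_set_def
proof (intro conjI allI impI)
  have "?A = ?X \<inter> (\<Inter>n. {p. coord (fst p) (\<pi> n) = 0})"
    by auto
  moreover have "closed (\<Inter>n. {p :: 'i sqsum \<times> 'b. coord (fst p) (\<pi> n) = 0})"
    by (intro closed_INT ballI closed_Collect_eq continuous_intros)
  ultimately show "closedin (top_of_set ?X) ?A"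
    by (simp add: closedin_closed_Int)
next
  fix \<U> assume "open_cover (top_of_set ?X) \<U>"
  then obtain e0 where e0: "contraction_on ?X e0" "\<And>x. x \<in> ?X \<Longrightarrow> 0 < e0 x \<and> e0 x \<le> 1"
    "\<And>x y. x \<in> ?X \<Longrightarrow> y \<in> ?X \<Longrightarrow> dist x y < e0 x \<Longrightarrow> \<exists>U\<in>\<U>. x \<in> U \<and> y \<in> U"
    by (rule open_cover_radius) blast
  define e where "e x = (1/4) * e0 x" for x
  have e: "contraction_on ?X e" "\<And>x. x \<in> ?X \<Longrightarrow> 0 < e x"
    unfolding e_def by (intro contraction_on_scale e0) (use e0 in auto)
  note ce = contraction_on_continuous[OF e(1)]
  obtain T where T: "continuous_on ?X T" "\<And>p. p \<in> ?X \<Longrightarrow> 0 < T p"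
    "\<And>p. p \<in> ?X \<Longrightarrow> norm (threshold (T p) (fst p) - fst p) < e p"
    using threshold_time[OF ce e(2)] by blast
  define f where "f p = (threshold (T p) (fst p) + e p *\<^sub>R free_unit \<pi> (T p) (fst p), snd p)" for p
  have contf: "continuous_on ?X f"
    unfolding f_def by (intro continuous_intros T ce pi) (use T(2) in \<open>auto intro: less_imp_le\<close>)
  have f_in: "f p \<in> ?X" if "p \<in> ?X" for p
    using that T(2)[OF that] pi unfolding f_def
    by (auto intro!: fin_sqsum_add fin_sqsum_scaleR fin_sqsum_threshold fin_sqsum_free_unit)
  have near: "dist p (f p) < 2 * e p" if p: "p \<in> ?X" for p
  proof -
    have "dist p (f p) = norm (threshold (T p) (fst p) - fst p + e p *\<^sub>R free_unit \<pi> (T p) (fst p))"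
      by (subst dist_commute) (simp add: dist_prod_def f_def dist_norm algebra_simps)
    also have "\<dots> \<le> norm (threshold (T p) (fst p) - fst p) + norm (e p *\<^sub>R free_unit \<pi> (T p) (fst p))"
      by (rule norm_triangle_ineq)
    also have "\<dots> < e p + e p"
      using T(2,3)[OF p] e(2)[OF p] pi by (simp add: norm_free_unit)
    finally show ?thesis by simp
  qed
  have far: "e p \<le> dist (f p) z" if p: "p \<in> ?X" and z: "z \<in> ?A" for p z
  proof -
    have "norm (e p *\<^sub>R free_unit \<pi> (T p) (fst p)) \<le> norm (fst (f p) - fst z)"
    proof (rule norm_sqsum_mono)
      fix i
      show "\<bar>coord (e p *\<^sub>R free_unit \<pi> (T p) (fst p)) i\<bar> \<le> \<bar>coord (fst (f p) - fst z) i\<bar>"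
      proof (cases "i \<in> supp (free_unit \<pi> (T p) (fst p))")
        case True
        then have "i \<in> range \<pi>" "coord (threshold (T p) (fst p)) i = 0"
          using free_sum_threshold[of \<pi> "T p" i "fst p"] pi(1) T(2)[OF p]
          by (simp_all add: supp_free_unit)
        then show ?thesis
          using z by (auto simp: f_def)
      qed (simp add: supp_def)
    qed
    then show ?thesis
      using dist_fst_le[of "f p" z] T(2)[OF p] e(2)[OF p] pi by (simp add: norm_free_unit dist_norm)
  qed
  have "top_of_set ?X closure_of (f ` ?X) \<inter> ?A = {}"
  proof (rule equals0I)
    fix z assume "z \<in> top_of_set ?X closure_of (f ` ?X) \<inter> ?A"
    then have z: "z \<in> ?A" "z \<in> closure (f ` ?X)"
      using f_in by (auto simp: closure_of_subtopology)
        (metis (no_types, lifting) closure_mono inf_le2 subsetD)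
    moreover have "0 < e z / 4"
      using e(2)[of z] z(1) by simp
    ultimately have "\<exists>w\<in>f ` ?X. dist w z < e z / 4"
      unfolding closure_approachable by blast
    then obtain p where p: "p \<in> ?X" "dist (f p) z < e z / 4"
      by blast
    have "\<bar>e z - e p\<bar> \<le> dist z p"
      using e(1) p(1) z(1) unfolding contraction_on_def by blast
    moreover have "dist z p \<le> dist p (f p) + dist (f p) z"
      by (metis dist_commute dist_triangle)
    ultimately show False
      using near[OF p(1)] far[OF p(1) z(1)] p(2) by linarith
  qed
  moreover have "cover_close (top_of_set ?X) \<U> f id"
    unfolding cover_close_def
  proof (intro ballI)
    fix p assume "p \<in> topspace (top_of_set ?X)"
    then have p: "p \<in> ?X" by simp
    have "dist p (f p) < e0 p"
      using near[OF p] e0(2)[OF p] by (simp add: e_def)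
    then show "\<exists>U\<in>\<U>. f p \<in> U \<and> id p \<in> U"
      using e0(3)[OF p f_in[OF p]] by auto
  qed
  ultimately show "\<exists>f. continuous_map (top_of_set ?X) (top_of_set ?X) f \<and>
      cover_close (top_of_set ?X) \<U> f id \<and>
      top_of_set ?X closure_of f ` topspace (top_of_set ?X) \<inter> ?A = {}"
    using contf f_in by (intro exI[of _ f]) (auto simp del: Sigma_cong)
qed

text \<open>A finitely supported family vanishes at all but finitely many members of a sequence of indices.\<close>

lemma strong_Z_sigma_fin_sqsum:
  fixes \<Omega> :: "'b::metric_space set"
  assumes "infinite K"
  shows "strong_Z_sigma_in_itself (top_of_set (fin_sqsum K \<times> \<Omega>))"
proof -
  obtain \<pi> :: "nat \<Rightarrow> 'a" where pi: "inj \<pi>" "range \<pi> \<subseteq> K"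
    using infinite_countable_subset[OF assms] by blast
  define A where "A m = {p \<in> fin_sqsum K \<times> \<Omega>. \<forall>n. coord (fst p) (\<pi> (m + n)) = 0}" for m
  have "strong_Z_set (top_of_set (fin_sqsum K \<times> \<Omega>)) (A m)" for m
    unfolding A_def using pi(2)
    by (intro strong_Z_set_vanishing) (auto intro!: injI dest: injD[OF pi(1)])
  moreover have "\<exists>m. p \<in> A m" if p: "p \<in> fin_sqsum K \<times> \<Omega>" for p
  proof -
    have "finite (\<pi> -` supp (fst p))"
      using p pi by (intro finite_vimageI) (auto simp: fin_sqsum_def)
    then obtain m where "\<pi> -` supp (fst p) \<subseteq> {..<m}"
      using finite_nat_iff_bounded by blast
    then have "p \<in> A m"
      using p by (auto simp: A_def supp_def)
    then show ?thesis ..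
  qed
  then have "topspace (top_of_set (fin_sqsum K \<times> \<Omega>)) = (\<Union>m. A m)"
    by (auto simp: A_def)
  ultimately show ?thesis
    unfolding strong_Z_sigma_in_itself_def by blast
qed

text \<open>The family is indexed, and only one index may occur near a point; so members with different indices are disjoint
  on \<open>S\<close>.\<close>

definition discrete_family :: "'a::metric_space set \<Rightarrow> ('k \<Rightarrow> 'a set) \<Rightarrow> bool" where
  "discrete_family S F \<longleftrightarrow>
     (\<forall>x\<in>S. \<exists>r>0. \<exists>\<gamma>\<^sub>0. \<forall>\<gamma>. \<forall>y\<in>F \<gamma>. dist x y < r \<longrightarrow> \<gamma> = \<gamma>\<^sub>0)"

text \<open>Bump functions about the members, of which at most one is active near each point.  The function \<open>b \<gamma>\<close> is
  positive at every point that is closer than \<open>e\<close> to \<open>F \<gamma>\<close>, so that a map that moves points by less than \<open>e\<close> can only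
  hit \<open>F \<gamma>\<close> from where \<open>b \<gamma>\<close> is positive.\<close>

lemma discrete_bumps:
  fixes S :: "'a::metric_space set" and F :: "'k \<Rightarrow> 'a set"
  assumes disc: "discrete_family S F"
    and e0: "contraction_on S e0" "\<And>x. x \<in> S \<Longrightarrow> 0 < e0 x"
  obtains e b where "contraction_on S e" "\<And>x. x \<in> S \<Longrightarrow> 0 < e x \<and> e x \<le> 1 \<and> e x \<le> e0 x"
    "\<And>\<gamma>. continuous_on S (b \<gamma>)"
    "\<And>x \<gamma>. x \<in> S \<Longrightarrow> 0 \<le> b \<gamma> x \<and> b \<gamma> x \<le> e x / 2"
    "\<And>x. x \<in> S \<Longrightarrow> \<exists>r>0. \<exists>\<gamma>\<^sub>0. \<forall>y\<in>S. dist x y < r \<longrightarrow> (\<forall>\<gamma>. b \<gamma> y \<noteq> 0 \<longrightarrow> \<gamma> = \<gamma>\<^sub>0)"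
    "\<And>x \<gamma> y. x \<in> S \<Longrightarrow> y \<in> F \<gamma> \<Longrightarrow> dist x y < e x \<Longrightarrow> 0 < b \<gamma> x"
proof -
  define P where "P x r \<longleftrightarrow> (\<exists>\<gamma>\<^sub>0. \<forall>\<gamma>. \<forall>y\<in>F \<gamma>. dist x y < r \<longrightarrow> \<gamma> = \<gamma>\<^sub>0)" for x r
  have "P y s" if P: "P x r" and r: "s + dist x y \<le> r" for x y r s
  proof -
    have "dist x z < r" if "dist y z < s" for z
      using that r dist_triangle[of x z y] by linarith
    then show ?thesis
      using P unfolding P_def by blast
  qed
  moreover have "\<exists>r>0. P x r" if "x \<in> S" for x
    using disc that unfolding discrete_family_def P_def by blast
  ultimately obtain e1 where e1: "contraction_on S e1" "\<And>x. x \<in> S \<Longrightarrow> 0 < e1 x \<and> e1 x \<le> 1 \<and> P x (e1 x)"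
    using controlled_radius[of S P] by metis
  define e2 where "e2 x = min (e1 x) (e0 x)" for x
  have e2: "contraction_on S e2" "\<And>x. x \<in> S \<Longrightarrow> 0 < e2 x \<and> e2 x \<le> 1 \<and> P x (e2 x) \<and> e2 x \<le> e0 x"
  proof -
    show "contraction_on S e2"
      unfolding e2_def by (intro contraction_on_min e1 e0)
    fix x assume x: "x \<in> S"
    obtain \<gamma>0 where "\<forall>\<gamma>. \<forall>y\<in>F \<gamma>. dist x y < e1 x \<longrightarrow> \<gamma> = \<gamma>0"
      using e1(2)[OF x] unfolding P_def by blast
    then have "P x (e2 x)"
      unfolding P_def e2_def min_less_iff_conj by blast
    then show "0 < e2 x \<and> e2 x \<le> 1 \<and> P x (e2 x) \<and> e2 x \<le> e0 x"
      using e1(2)[OF x] e0(2)[OF x] by (simp add: e2_def min_le_iff_disj)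
  qed
  define e where "e x = (1/2) * e2 x" for x
  define b where "b \<gamma> x = (if F \<gamma> = {} then 0 else max 0 (e x - infdist x (F \<gamma>)) / 2)" for \<gamma> x
  have bD: "\<exists>y\<in>F \<gamma>. dist x y < e x" if "b \<gamma> x \<noteq> 0" for x \<gamma>
  proof -
    have "F \<gamma> \<noteq> {}" "infdist x (F \<gamma>) < e x"
      using that by (auto simp: b_def max_def split: if_splits)
    then show ?thesis
      by (auto simp: infdist_def cINF_less_iff)
  qed
  have ce: "contraction_on S e"
    unfolding e_def by (intro contraction_on_scale e2) auto
  show thesis
  proof (rule that[of e b])
    show "contraction_on S e" by (rule ce)
    show "continuous_on S (b \<gamma>)" for \<gamma>
      unfolding b_def
      by (cases "F \<gamma> = {}") (auto intro!: continuous_intros contraction_on_continuous[OF ce])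
  next
    fix x assume x: "x \<in> S"
    show "0 < e x \<and> e x \<le> 1 \<and> e x \<le> e0 x"
      using e2(2)[OF x] by (auto simp: e_def)
    show "0 \<le> b \<gamma> x \<and> b \<gamma> x \<le> e x / 2" for \<gamma>
      using e2(2)[OF x] infdist_nonneg[of x "F \<gamma>"] by (auto simp: b_def e_def max_def)
    obtain \<gamma>0 where \<gamma>0: "\<forall>\<gamma>. \<forall>y\<in>F \<gamma>. dist x y < e2 x \<longrightarrow> \<gamma> = \<gamma>0"
      using e2(2)[OF x] unfolding P_def by blast
    show "\<exists>r>0. \<exists>\<gamma>\<^sub>0. \<forall>y\<in>S. dist x y < r \<longrightarrow> (\<forall>\<gamma>. b \<gamma> y \<noteq> 0 \<longrightarrow> \<gamma> = \<gamma>\<^sub>0)"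
    proof (intro exI[of _ "e2 x / 4"] exI[of _ \<gamma>0] conjI ballI impI allI)
      fix y \<gamma> assume y: "y \<in> S" "dist x y < e2 x / 4" "b \<gamma> y \<noteq> 0"
      obtain z where z: "z \<in> F \<gamma>" "dist y z < e y"
        using bD y by blast
      have "\<bar>e2 x - e2 y\<bar> \<le> dist x y"
        using e2(1) x y by (auto simp: contraction_on_def)
      then have "dist x z < e2 x"
        using z(2) y(2) dist_triangle[of x z y] e2(2)[OF x] by (simp add: e_def)
      then show "\<gamma> = \<gamma>0"
        using \<gamma>0 z by blast
    qed (use e2(2)[OF x] in auto)
    fix \<gamma> y assume y: "y \<in> F \<gamma>" "dist x y < e x"
    then show "0 < b \<gamma> x"
      using infdist_le[of y "F \<gamma>" x] by (auto simp: b_def)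
  qed
qed

text \<open>The sum has at most one term wherever it is used; it is a sum only to avoid a choice of the active index.\<close>

definition glue :: "('k \<Rightarrow> 'a \<Rightarrow> real) \<Rightarrow> ('k \<Rightarrow> 'a \<Rightarrow> 'b::real_normed_vector) \<Rightarrow> 'a \<Rightarrow> 'b" where
  "glue b u x = (\<Sum>\<gamma> | b \<gamma> x \<noteq> 0. b \<gamma> x *\<^sub>R u \<gamma> x)"

lemma glue_eq:
  assumes "\<And>\<gamma>. b \<gamma> x \<noteq> 0 \<Longrightarrow> \<gamma> = \<gamma>\<^sub>0"
  shows "glue b u x = b \<gamma>\<^sub>0 x *\<^sub>R u \<gamma>\<^sub>0 x"
proof (cases "b \<gamma>\<^sub>0 x = 0")
  case True
  then have "{\<gamma>. b \<gamma> x \<noteq> 0} = {}"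
    using assms by blast
  then have "glue b u x = (\<Sum>\<gamma>\<in>{}. b \<gamma> x *\<^sub>R u \<gamma> x)"
    by (simp only: glue_def)
  then show ?thesis
    using True by simp
next
  case False
  then have "{\<gamma>. b \<gamma> x \<noteq> 0} = {\<gamma>\<^sub>0}"
    using assms by blast
  then have "glue b u x = (\<Sum>\<gamma>\<in>{\<gamma>\<^sub>0}. b \<gamma> x *\<^sub>R u \<gamma> x)"
    by (simp only: glue_def)
  then show ?thesis
    by simp
qed

lemma continuous_on_glue:
  fixes S :: "'a::metric_space set"
  assumes b: "\<And>\<gamma>. continuous_on S (b \<gamma>)" and u: "\<And>\<gamma>. continuous_on S (u \<gamma>)"
    and loc: "\<And>x. x \<in> S \<Longrightarrow> \<exists>r>0. \<exists>\<gamma>\<^sub>0. \<forall>y\<in>S. dist x y < r \<longrightarrow> (\<forall>\<gamma>. b \<gamma> y \<noteq> 0 \<longrightarrow> \<gamma> = \<gamma>\<^sub>0)"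
  shows "continuous_on S (glue b u)"
  unfolding continuous_on_eq_continuous_within
proof
  fix x assume x: "x \<in> S"
  obtain r \<gamma>0 where r: "r > 0" "\<And>y \<gamma>. y \<in> S \<Longrightarrow> dist x y < r \<Longrightarrow> b \<gamma> y \<noteq> 0 \<Longrightarrow> \<gamma> = \<gamma>0"
    using loc[OF x] by blast
  have "continuous (at x within S) (\<lambda>y. b \<gamma>0 y *\<^sub>R u \<gamma>0 y)"
    using b u x by (intro continuous_intros) (auto simp: continuous_on_eq_continuous_within)
  then show "continuous (at x within S) (glue b u)"
  proof (rule continuous_transform_within[OF _ r(1) x])
    fix y assume y: "y \<in> S" "dist y x < r"
    then have "dist x y < r"
      by (simp add: dist_commute)
    then show "b \<gamma>0 y *\<^sub>R u \<gamma>0 y = glue b u y"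
      using glue_eq[of b y \<gamma>0 u] r(2)[OF y(1)] by metis
  qed
qed

text \<open>Every \<open>F \<gamma>\<close> vanishes on a sequence of coordinates of its own.  Near \<open>F \<gamma>\<close> the map adds a vector on such coordinates after
  they have been made zero by thresholding, so its values cannot lie in \<open>F \<gamma>\<close>.\<close>

lemma Z_set_discrete_union:
  fixes \<Omega> :: "'b::metric_space set" and F :: "'k \<Rightarrow> ('i sqsum \<times> 'b) set"
    and \<pi> :: "'k \<Rightarrow> nat \<Rightarrow> 'i"
  assumes C: "closedin (top_of_set (fin_sqsum K \<times> \<Omega>)) C" "C \<subseteq> (\<Union>\<gamma>. F \<gamma>)"
    and disc: "discrete_family (fin_sqsum K \<times> \<Omega>) F"
    and pi: "\<And>\<gamma>. inj (\<pi> \<gamma>)" "\<And>\<gamma>. range (\<pi> \<gamma>) \<subseteq> K"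
    and zero: "\<And>\<gamma> p n. p \<in> F \<gamma> \<Longrightarrow> coord (fst p) (\<pi> \<gamma> n) = (0::real)"
  shows "Z_set (top_of_set (fin_sqsum K \<times> \<Omega>)) C"
  unfolding Z_set_def
proof (intro conjI allI impI C)
  let ?X = "fin_sqsum K \<times> \<Omega>"
  fix \<U> assume "open_cover (top_of_set ?X) \<U>"
  then obtain e0 where e0: "contraction_on ?X e0" "\<And>x. x \<in> ?X \<Longrightarrow> 0 < e0 x \<and> e0 x \<le> 1"
    "\<And>x y. x \<in> ?X \<Longrightarrow> y \<in> ?X \<Longrightarrow> dist x y < e0 x \<Longrightarrow> \<exists>U\<in>\<U>. x \<in> U \<and> y \<in> U"
    by (rule open_cover_radius) blast
  then have e0': "0 < e0 x" if "x \<in> ?X" for x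
    using that by blast
  obtain e b where e: "contraction_on ?X e" "\<And>x. x \<in> ?X \<Longrightarrow> 0 < e x \<and> e x \<le> 1 \<and> e x \<le> e0 x"
    and b: "\<And>\<gamma>. continuous_on ?X (b \<gamma>)"
    "\<And>x \<gamma>. x \<in> ?X \<Longrightarrow> 0 \<le> b \<gamma> x \<and> b \<gamma> x \<le> e x / 2"
    "\<And>x. x \<in> ?X \<Longrightarrow> \<exists>r>0. \<exists>\<gamma>\<^sub>0. \<forall>y\<in>?X. dist x y < r \<longrightarrow> (\<forall>\<gamma>. b \<gamma> y \<noteq> 0 \<longrightarrow> \<gamma> = \<gamma>\<^sub>0)"
    "\<And>x \<gamma> y. x \<in> ?X \<Longrightarrow> y \<in> F \<gamma> \<Longrightarrow> dist x y < e x \<Longrightarrow> 0 < b \<gamma> x"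
    using discrete_bumps[OF disc e0(1) e0'] by blast
  have "continuous_on ?X (\<lambda>x. e x / 2)"
    by (intro continuous_intros contraction_on_continuous[OF e(1)]) auto
  moreover have "0 < e x / 2" if "x \<in> ?X" for x
    using e(2)[OF that] by simp
  ultimately obtain T where T: "continuous_on ?X T" "\<And>p. p \<in> ?X \<Longrightarrow> 0 < T p"
    "\<And>p. p \<in> ?X \<Longrightarrow> norm (threshold (T p) (fst p) - fst p) < e p / 2"
    using threshold_time[of ?X "\<lambda>x. e x / 2"] by blast
  define u where "u \<gamma> p = free_unit (\<pi> \<gamma>) (T p) (fst p)" for \<gamma> p
  define f where "f p = (threshold (T p) (fst p) + glue b u p, snd p)" for p
  have cu: "continuous_on ?X (u \<gamma>)" for \<gamma>
    unfolding u_def by (intro continuous_intros pi T)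
  have contf: "continuous_on ?X f"
    unfolding f_def
    by (intro continuous_intros continuous_on_glue b cu T) (use T(2) in \<open>auto intro: less_imp_le\<close>)
  have single: "\<exists>\<gamma>. glue b u p = b \<gamma> p *\<^sub>R u \<gamma> p \<and> (\<forall>\<delta>. b \<delta> p \<noteq> 0 \<longrightarrow> \<delta> = \<gamma>)" if p: "p \<in> ?X" for p
  proof -
    obtain r \<gamma> where "r > 0" "\<And>y \<delta>. y \<in> ?X \<Longrightarrow> dist p y < r \<Longrightarrow> b \<delta> y \<noteq> 0 \<Longrightarrow> \<delta> = \<gamma>"
      using b(3)[OF p] by blast
    then have "b \<delta> p \<noteq> 0 \<Longrightarrow> \<delta> = \<gamma>" for \<delta>
      using p by simp
    then show ?thesis
      using glue_eq[of b p \<gamma> u] by blast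
  qed
  have f_in: "f p \<in> ?X" if p: "p \<in> ?X" for p
  proof -
    obtain \<gamma> where "glue b u p = b \<gamma> p *\<^sub>R u \<gamma> p"
      using single[OF p] by blast
    then show ?thesis
      using p T(2)[OF p] pi unfolding f_def u_def
      by (auto intro!: fin_sqsum_add fin_sqsum_scaleR fin_sqsum_threshold fin_sqsum_free_unit)
  qed
  have near: "dist p (f p) < e p" if p: "p \<in> ?X" for p
  proof -
    obtain \<gamma> where \<gamma>: "glue b u p = b \<gamma> p *\<^sub>R u \<gamma> p"
      using single[OF p] by blast
    have "dist p (f p) = norm (threshold (T p) (fst p) - fst p + b \<gamma> p *\<^sub>R u \<gamma> p)"
      by (subst dist_commute) (simp add: dist_prod_def f_def dist_norm algebra_simps \<gamma>)
    also have "\<dots> \<le> norm (threshold (T p) (fst p) - fst p) + norm (b \<gamma> p *\<^sub>R u \<gamma> p)"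
      by (rule norm_triangle_ineq)
    also have "\<dots> < e p / 2 + e p / 2"
      using T(2,3)[OF p] b(2)[OF p, of \<gamma>] pi by (simp add: norm_free_unit u_def)
    finally show ?thesis by simp
  qed
  have "f p \<notin> F \<gamma>" if p: "p \<in> ?X" for p \<gamma>
  proof
    assume fp: "f p \<in> F \<gamma>"
    then have pos: "0 < b \<gamma> p"
      using b(4)[OF p _ near[OF p]] by blast
    then have eq: "glue b u p = b \<gamma> p *\<^sub>R u \<gamma> p"
      using single[OF p] by (metis less_irrefl)
    have "norm (u \<gamma> p) = 1"
      using pi T(2)[OF p] by (simp add: u_def norm_free_unit)
    then have "u \<gamma> p \<noteq> 0"
      by auto
    then obtain i where i: "coord (u \<gamma> p) i \<noteq> 0"
      by (metis coord_zero sqsum_eqI)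
    then have "i \<in> supp (free_sum (\<pi> \<gamma>) (T p) (fst p))"
      using supp_free_unit[of "\<pi> \<gamma>" "T p" "fst p"] pi T(2)[OF p] by (auto simp: supp_def u_def)
    then have i': "i \<in> range (\<pi> \<gamma>)" "coord (threshold (T p) (fst p)) i = 0"
      using free_sum_threshold[of "\<pi> \<gamma>" "T p" i "fst p"] pi(1) T(2)[OF p] by auto
    then have "coord (fst (f p)) i = b \<gamma> p * coord (u \<gamma> p) i"
      by (simp add: f_def eq)
    then show False
      using zero[OF fp] i' i pos by auto
  qed
  then have "f ` topspace (top_of_set ?X) \<inter> C = {}"
    using C(2) by auto
  moreover have "cover_close (top_of_set ?X) \<U> f id"
    unfolding cover_close_def
  proof (intro ballI)
    fix p assume "p \<in> topspace (top_of_set ?X)"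
    then have p: "p \<in> ?X" by simp
    have "dist p (f p) < e0 p"
      using near[OF p] e(2)[OF p] by simp
    then show "\<exists>U\<in>\<U>. f p \<in> U \<and> id p \<in> U"
      using e0(3)[OF p f_in[OF p]] by auto
  qed
  ultimately show "\<exists>f. continuous_map (top_of_set ?X) (top_of_set ?X) f \<and>
      cover_close (top_of_set ?X) \<U> f id \<and> f ` topspace (top_of_set ?X) \<inter> C = {}"
    using contf f_in by (intro exI[of _ f]) auto
qed

section \<open>Density and supports\<close>

lemma infinite_Field_if_natLeq:
  assumes "Card_order r" "natLeq \<le>o r"
  shows "infinite (Field r)"
proof -
  have "natLeq \<le>o |Field r|"
    using assms card_of_Field_ordIso ordIso_symmetric ordLeq_ordIso_trans by blast
  then show ?thesis
    using infinite_iff_natLeq_ordLeq by blast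
qed

lemma finite_ordLess_infinite_set: "finite A \<Longrightarrow> infinite B \<Longrightarrow> |A| <o |B|"
  unfolding finite_iff_ordLess_natLeq[of A]
  using infinite_iff_natLeq_ordLeq[of B] by (auto intro: ordLess_ordLeq_trans)

lemma countable_ordLeq:
  assumes "countable A" "natLeq \<le>o r"
  shows "|A| \<le>o r"
proof -
  have "|A| \<le>o |UNIV :: nat set|"
    using assms(1) unfolding countable_def by (metis card_of_ordLeq subset_UNIV)
  then have "|A| \<le>o natLeq"
    using card_of_nat ordLeq_ordIso_trans by blast
  then show ?thesis
    using assms(2) ordLeq_transitive by blast
qed

lemma density_le_homeomorphic:
  assumes "X homeomorphic_space Y" "density_le X r"
  shows "density_le Y r"
proof -
  obtain h where h: "homeomorphic_map X Y h"
    using assms(1) homeomorphic_space by blast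
  obtain D where D: "D \<subseteq> topspace X" "X closure_of D = topspace X" "|D| \<le>o r"
    using assms(2) by (auto simp: density_le_def)
  have "Y closure_of (h ` D) = topspace Y"
    using homeomorphic_map_closure_of[OF h D(1)] D(2) homeomorphic_imp_surjective_map[OF h] by simp
  moreover have "|h ` D| \<le>o r"
    using card_of_image D(3) ordLeq_transitive by blast
  moreover have "h ` D \<subseteq> topspace Y"
    using D(1) homeomorphic_imp_surjective_map[OF h] by blast
  ultimately show ?thesis
    unfolding density_le_def by blast
qed

text \<open>A dense set \<open>D\<close> of the space yields one of the subspace: choose a point of the subspace within \<open>1/n\<close> of each
  point of \<open>D\<close> that has one.\<close>

lemma density_le_subspace:
  assumes "metrizable_space X" "density_le X r" "Card_order r" "natLeq \<le>o r"
  shows "density_le (subtopology X S) r"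
proof -
  obtain M d where Md: "Metric_space M d" "X = Metric_space.mtopology M d"
    using assms(1) by (auto simp: metrizable_space_def)
  interpret Metric_space M d by (rule Md(1))
  obtain D where D: "D \<subseteq> M" "mtopology closure_of D = M" "|D| \<le>o r"
    using assms(2) by (auto simp: density_le_def Md(2))
  define near where "near x n p \<longleftrightarrow> p \<in> S \<inter> M \<and> d x p < inverse (Suc n)" for x n p
  define E where "E = (\<lambda>(x, n). SOME p. near x n p) ` {(x, n). x \<in> D \<and> (\<exists>p. near x n p)}"
  have E: "E \<subseteq> S \<inter> M"
  proof
    fix y assume "y \<in> E"
    then obtain x n where "y = (SOME p. near x n p)" "\<exists>p. near x n p"
      by (auto simp: E_def)
    then have "near x n y"
      by (metis someI_ex)
    then show "y \<in> S \<inter> M"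
      by (simp add: near_def)
  qed
  have "|E| \<le>o |{(x, n). x \<in> D \<and> (\<exists>p. near x n p)}|"
    unfolding E_def by (rule card_of_image)
  also have "|{(x, n). x \<in> D \<and> (\<exists>p. near x n p)}| \<le>o |D \<times> (UNIV :: nat set)|"
    by (rule card_of_mono1) auto
  also have "|D \<times> (UNIV :: nat set)| \<le>o r"
    using infinite_Field_if_natLeq[OF assms(3,4)] D(3) assms(3) countable_ordLeq[OF _ assms(4), of "UNIV :: nat set"]
    by (intro card_of_Times_ordLeq_infinite_Field) auto
  finally have cE: "|E| \<le>o r" .
  have "S \<inter> M \<subseteq> mtopology closure_of E"
  proof
    fix y assume y: "y \<in> S \<inter> M"
    have "\<exists>z\<in>E. z \<in> mball y e" if e: "e > 0" for e
    proof -
      obtain n where n: "inverse (Suc n) < e / 2"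
        using reals_Archimedean[of "e/2"] e by auto
      have "y \<in> mtopology closure_of D"
        using D(2) y by simp
      then have "\<exists>x\<in>D. x \<in> mball y (inverse (real (Suc n)))"
        unfolding metric_closure_of mem_Collect_eq by (auto simp del: of_nat_Suc in_mball)
      then obtain x where x: "x \<in> D" "d y x < inverse (Suc n)"
        by auto
      then have "near x n y"
        using y by (simp add: near_def commute)
      then have near: "near x n (SOME p. near x n p)"
        by (rule someI)
      then have "(SOME p. near x n p) \<in> E"
        using x(1) unfolding E_def by (intro image_eqI[of _ _ "(x, n)"]) auto
      moreover have "d y (SOME p. near x n p) < e"
        using near x n triangle[of y x "SOME p. near x n p"] y D(1) by (auto simp: near_def)
      ultimately show ?thesis
        using near y by (intro bexI) (auto simp: near_def)
    qed
    then show "y \<in> mtopology closure_of E"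
      using y by (auto simp: metric_closure_of)
  qed
  then have "subtopology X S closure_of E = topspace (subtopology X S)"
    using E by (auto simp: closure_of_subtopology Md(2) Int_absorb1 dest: in_closure_of[THEN iffD1])
  then show ?thesis
    using E cE by (auto simp: density_le_def Md(2))
qed

lemma density_le_times_interval:
  assumes "density_le X r" "Card_order r" "natLeq \<le>o r"
  shows "density_le (prod_topology X (top_of_set {0..1::real})) r"
proof -
  obtain D where D: "D \<subseteq> topspace X" "X closure_of D = topspace X" "|D| \<le>o r"
    using assms(1) by (auto simp: density_le_def)
  obtain Q :: "real set" where Q: "countable Q" "Q \<subseteq> {0..1}" "{0..1} \<subseteq> closure Q"
    using separable[of "{0..1::real}"] by blast
  have "top_of_set {0..1::real} closure_of Q = {0..1}"
    using Q by (auto simp: closure_of_subtopology Int_absorb1)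
  then have "prod_topology X (top_of_set {0..1::real}) closure_of (D \<times> Q) = topspace X \<times> {0..1}"
    by (simp add: closure_of_Times D)
  moreover have "|D \<times> Q| \<le>o r"
    using infinite_Field_if_natLeq[OF assms(2,3)] D(3) assms(2) countable_ordLeq[OF Q(1) assms(3)]
    by (intro card_of_Times_ordLeq_infinite_Field) auto
  ultimately show ?thesis
    unfolding density_le_def using D(1) Q(2) by (intro exI[of _ "D \<times> Q"]) auto
qed

text \<open>The values at a dense set have a common support of size at most \<open>r\<close>, and families supported there
  form a closed set.\<close>

lemma small_support:
  fixes f :: "'a \<Rightarrow> 'i sqsum"
  assumes "continuous_map A euclidean f" "density_le A r" "Card_order r" "natLeq \<le>o r"
    and fin: "\<And>a. a \<in> topspace A \<Longrightarrow> finite (supp (f a))"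
  shows "|\<Union>a\<in>topspace A. supp (f a)| \<le>o r"
proof -
  obtain D where D: "D \<subseteq> topspace A" "A closure_of D = topspace A" "|D| \<le>o r"
    using assms(2) by (auto simp: density_le_def)
  define J where "J = (\<Union>a\<in>D. supp (f a))"
  have "f ` topspace A \<subseteq> closure (f ` D)"
    using continuous_map_image_closure_subset[OF assms(1), of D] D(2) by simp
  also have "\<dots> \<subseteq> {x. supp x \<subseteq> J}"
    by (rule closure_minimal) (auto simp: J_def closed_supp_subset)
  finally have sub: "(\<Union>a\<in>topspace A. supp (f a)) \<subseteq> J"
    by blast
  have inf: "infinite (Field r)" and iso: "r =o |Field r|" "|Field r| =o r"
    using infinite_Field_if_natLeq[OF assms(3,4)] card_of_Field_ordIso[OF assms(3)] ordIso_symmetric by blast+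
  have "|J| \<le>o |Field r|"
    unfolding J_def
  proof (rule card_of_UNION_ordLeq_infinite[OF inf])
    show "|D| \<le>o |Field r|"
      using D(3) iso(1) by (rule ordLeq_ordIso_trans)
    show "\<forall>a\<in>D. |supp (f a)| \<le>o |Field r|"
      using fin D(1) inf by (auto intro!: ordLess_imp_ordLeq finite_ordLess_infinite_set)
  qed
  then have "|J| \<le>o r"
    using iso(2) by (rule ordLeq_ordIso_trans)
  then show ?thesis
    using card_of_mono1[OF sub] ordLeq_transitive by blast
qed

section \<open>Fresh coordinates\<close>

lemma infinite_Diff_small:
  assumes "Card_order \<kappa>" "\<kappa>' <o \<kappa>" "natLeq \<le>o \<kappa>'" "|J| \<le>o \<kappa>'"
  shows "infinite (Field \<kappa> - J)"
proof
  assume fin: "finite (Field \<kappa> - J)"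
  have le: "natLeq \<le>o \<kappa>"
    using assms(2,3) ordLeq_ordLess_trans ordLess_imp_ordLeq by blast
  have inf: "infinite (Field \<kappa>)"
    using infinite_Field_if_natLeq[OF assms(1) le] .
  have "|J| <o \<kappa>"
    using assms(2,4) ordLeq_ordLess_trans by blast
  moreover have "|Field \<kappa> - J| <o \<kappa>"
    using finite_ordLess_infinite_set[OF fin inf] card_of_Field_ordIso[OF assms(1)] ordLess_ordIso_trans by blast
  ultimately have "|J \<union> (Field \<kappa> - J)| <o \<kappa>"
    using card_of_Un_ordLess_infinite_Field[OF inf assms(1)] by blast
  moreover have "|Field \<kappa>| \<le>o |J \<union> (Field \<kappa> - J)|"
    by (rule card_of_mono1) auto
  ultimately have "|Field \<kappa>| <o \<kappa>"
    using ordLeq_ordLess_trans by blast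
  then show False
    using card_of_Field_ordIso[OF assms(1)] not_ordLess_ordIso by blast
qed

text \<open>Transfinite recursion along \<open>\<kappa>\<close>: at stage \<open>\<gamma>\<close> the indices to be avoided are those in
  the sets \<open>J \<delta>\<close> for \<open>\<delta> \<le> \<gamma>\<close> and the values chosen before, which are fewer than \<open>\<kappa>\<close> since
  \<open>\<gamma>\<close> has fewer than \<open>\<kappa>\<close> predecessors and \<open>\<kappa>' < \<kappa>\<close>.\<close>

lemma fresh_coordinates:
  fixes \<kappa> :: "'k rel" and \<kappa>' :: "'j rel"
  assumes \<kappa>: "Card_order \<kappa>" and \<kappa>': "Card_order \<kappa>'" "\<kappa>' <o \<kappa>" "natLeq \<le>o \<kappa>'"
    and J: "\<And>\<gamma>. |J \<gamma>| \<le>o \<kappa>'"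
  obtains \<theta> where "\<And>\<gamma>. \<gamma> \<in> Field \<kappa> \<Longrightarrow> \<theta> \<gamma> \<in> Field \<kappa> \<and> \<theta> \<gamma> \<notin> J \<gamma>"
    "\<And>\<gamma> \<delta>. \<gamma> \<in> Field \<kappa> \<Longrightarrow> \<delta> \<in> underS \<kappa> \<gamma> \<Longrightarrow> \<theta> \<gamma> \<notin> J \<delta> \<and> \<theta> \<gamma> \<noteq> \<theta> \<delta>"
proof -
  have wo: "Well_order \<kappa>"
    using \<kappa> by (simp add: card_order_on_well_order_on)
  have inf: "infinite (Field \<kappa>)" and inf': "infinite (Field \<kappa>')"
    using infinite_Field_if_natLeq \<kappa> \<kappa>' ordLeq_ordLess_trans ordLess_imp_ordLeq by blast+
  define P where "P f \<gamma> r \<longleftrightarrow> (\<gamma> \<in> Field \<kappa> \<longrightarrow>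
      r \<in> Field \<kappa> \<and> r \<notin> J \<gamma> \<and> (\<forall>\<delta>\<in>underS \<kappa> \<gamma>. r \<notin> J \<delta> \<and> r \<noteq> f \<delta>))" for f \<gamma> and r :: 'k
  have "\<exists>f. \<forall>\<gamma>. P f \<gamma> (f \<gamma>)"
  proof (rule dependent_wf_choice[of "\<kappa> - Id"])
    show "wf (\<kappa> - Id)"
      using wo by (simp add: well_order_on_def)
  next
    fix f g :: "'k \<Rightarrow> 'k" and x r
    assume "\<And>z. (z, x) \<in> \<kappa> - Id \<Longrightarrow> f z = g z"
    then have "\<And>z. z \<in> underS \<kappa> x \<Longrightarrow> f z = g z"
      by (auto simp: underS_def)
    then show "P f x r = P g x r"
      unfolding P_def by auto
  next
    fix \<gamma> and f :: "'k \<Rightarrow> 'k"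
    show "\<exists>r. P f \<gamma> r"
    proof (cases "\<gamma> \<in> Field \<kappa>")
      case True
      let ?U = "underS \<kappa> \<gamma>"
      let ?M = "?U <+> Field \<kappa>'"
      have U: "|?U| <o \<kappa>"
        by (rule card_of_underS[OF \<kappa> True])
      have "|Field \<kappa>'| <o \<kappa>"
        using card_of_Field_ordIso[OF \<kappa>'(1)] \<kappa>'(2) ordIso_ordLess_trans by blast
      then have M: "|?M| <o \<kappa>"
        using card_of_Plus_ordLess_infinite_Field[OF inf \<kappa> U] by blast
      have infM: "infinite ?M"
        using inf' by (simp add: finite_Plus_iff)
      have UM: "|?U| \<le>o |?M|"
        by (rule card_of_Plus1)
      have "\<kappa>' \<le>o |?M|"
        using card_of_Field_ordIso[OF \<kappa>'(1)] card_of_Plus2[of "Field \<kappa>'" ?U]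
          ordIso_ordLeq_trans ordIso_symmetric by blast
      then have JM: "|J \<delta>| \<le>o |?M|" for \<delta>
        using J ordLeq_transitive by blast
      have 1: "|\<Union>\<delta>\<in>?U. J \<delta>| \<le>o |?M|"
        using card_of_UNION_ordLeq_infinite[OF infM UM] JM by blast
      have 2: "|f ` ?U| \<le>o |?M|"
        using card_of_image UM ordLeq_transitive by blast
      have "infinite (Field |?M| )"
        using infM by (simp only: Field_card_of) simp
      note fM = this card_of_Card_order
      have "|J \<gamma> \<union> (\<Union>\<delta>\<in>?U. J \<delta>) \<union> f ` ?U| \<le>o |?M|"
        by (intro card_of_Un_ordLeq_infinite_Field fM 1 2 JM)
      then have "|J \<gamma> \<union> (\<Union>\<delta>\<in>?U. J \<delta>) \<union> f ` ?U| <o |Field \<kappa>|"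
        using M card_of_Field_ordIso[OF \<kappa>] ordIso_symmetric ordLeq_ordLess_trans ordLess_ordIso_trans by blast
      then have "\<not> Field \<kappa> \<subseteq> J \<gamma> \<union> (\<Union>\<delta>\<in>?U. J \<delta>) \<union> f ` ?U"
        using card_of_mono1 not_ordLess_ordLeq by blast
      then show ?thesis
        unfolding P_def by blast
    qed (simp add: P_def)
  qed
  then show thesis
    using that unfolding P_def by blast
qed

lemma underS_total:
  assumes "Card_order \<kappa>" "\<gamma> \<in> Field \<kappa>" "\<delta> \<in> Field \<kappa>" "\<gamma> \<noteq> \<delta>"
  shows "\<gamma> \<in> underS \<kappa> \<delta> \<or> \<delta> \<in> underS \<kappa> \<gamma>"
proof -
  have "total_on (Field \<kappa>) \<kappa>"
    using assms(1) card_order_on_well_order_on[of "Field \<kappa>" \<kappa>]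
    by (simp add: well_order_on_def linear_order_on_def)
  then show ?thesis
    using assms(2-4) unfolding total_on_def underS_def by blast
qed

section \<open>A normed model of the Hilbert space\<close>

text \<open>The copy of \<open>\<ell>\<^sub>2(\<kappa>)\<close> inside the normed space.\<close>

definition hilb :: "'k rel \<Rightarrow> 'k sqsum set" where
  "hilb \<kappa> = {x. supp x \<subseteq> Field \<kappa>}"

lemma homeomorphic_map_ell2:
  "homeomorphic_map (ell2 \<kappa>) (top_of_set (hilb \<kappa>)) of_coords"
proof -
  let ?K = "Field \<kappa>"
  have sub: "ell2_space ?K \<subseteq> ell2_space UNIV"
  proof
    fix x assume x: "x \<in> ell2_space ?K"
    then have "(\<lambda>i. (x i)\<^sup>2) summable_on UNIV \<longleftrightarrow> (\<lambda>i. (x i)\<^sup>2) summable_on ?K"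
      by (intro summable_on_cong_neutral) (auto simp: ell2_space_def)
    then show "x \<in> ell2_space UNIV"
      using x by (simp add: ell2_space_def)
  qed
  interpret M2: Metric_space "hilb \<kappa>" dist
    by unfold_locales (auto simp: dist_commute dist_triangle)
  interpret S: Submetric UNIV dist "hilb \<kappa>"
    by unfold_locales (auto simp: dist_commute dist_triangle)
  interpret Metric_space12 "ell2_space ?K" "ell2_dist ?K" "hilb \<kappa>" dist
    unfolding Metric_space12_def using Metric_space_ell2 M2.Metric_space_axioms by blast
  have "of_coords ` ell2_space ?K = hilb \<kappa>"
  proof
    show "of_coords ` ell2_space ?K \<subseteq> hilb \<kappa>"
    proof
      fix y assume "y \<in> of_coords ` ell2_space ?K"
      then obtain x where x: "x \<in> ell2_space ?K" "y = of_coords x"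
        by blast
      then have "coord y = x"
        using sub by (auto simp: of_coords_inverse)
      then show "y \<in> hilb \<kappa>"
        using x(1) by (auto simp: hilb_def supp_def ell2_space_def)
    qed
    show "hilb \<kappa> \<subseteq> of_coords ` ell2_space ?K"
    proof
      fix y assume "y \<in> hilb \<kappa>"
      then have "coord y \<in> ell2_space ?K"
        using coord_sq_summable[of y ?K] by (auto simp: ell2_space_def hilb_def supp_def)
      then show "y \<in> of_coords ` ell2_space ?K"
        by (metis coord_inverse image_eqI)
    qed
  qed
  moreover have "dist (of_coords x) (of_coords y) = ell2_dist ?K x y"
    if xy: "x \<in> ell2_space ?K" "y \<in> ell2_space ?K" for x y
  proof -
    have "dist (of_coords x) (of_coords y) = ell2_dist UNIV x y"
      using xy[THEN subsetD[OF sub]] by (simp add: dist_eq_ell2_dist of_coords_inverse)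
    also have "(\<Sum>\<^sub>\<infinity>i. (x i - y i)\<^sup>2) = (\<Sum>\<^sub>\<infinity>i\<in>?K. (x i - y i)\<^sup>2)"
      using xy by (intro infsum_cong_neutral) (auto simp: ell2_space_def)
    then have "ell2_dist UNIV x y = ell2_dist ?K x y"
      by (simp add: ell2_dist_def)
    finally show ?thesis .
  qed
  ultimately have "homeomorphic_map (Metric_space.mtopology (ell2_space ?K) (ell2_dist ?K)) M2.mtopology of_coords"
    by (rule isometry_imp_homeomorphic_map)
  moreover have "M2.mtopology = top_of_set (hilb \<kappa>)"
    using S.mtopology_submetric by simp
  ultimately show ?thesis
    by (simp add: ell2_def)
qed

lemma of_coords_ell2f: "of_coords ` ell2f \<kappa> = fin_sqsum (Field \<kappa>)"
proof
  have fin: "f \<in> ell2_space UNIV" if "f \<in> ell2f \<kappa>" for f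
  proof -
    have "{i. f i \<noteq> 0} = {i \<in> Field \<kappa>. f i \<noteq> 0}"
      using that by (auto simp: ell2f_def ell2_space_def)
    then have "finite {i. f i \<noteq> 0}"
      using that by (simp add: ell2f_def)
    then show ?thesis
      using sq_summable_finite_support by (simp add: in_ell2_space_UNIV)
  qed
  show "of_coords ` ell2f \<kappa> \<subseteq> fin_sqsum (Field \<kappa>)"
  proof
    fix y assume "y \<in> of_coords ` ell2f \<kappa>"
    then obtain x where x: "x \<in> ell2f \<kappa>" "y = of_coords x"
      by blast
    then have "coord y = x"
      using fin by (auto simp: of_coords_inverse)
    moreover have "{i. x i \<noteq> 0} = {i \<in> Field \<kappa>. x i \<noteq> 0}"
      using x by (auto simp: ell2f_def ell2_space_def)
    ultimately show "y \<in> fin_sqsum (Field \<kappa>)"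
      using x(1) by (auto simp: fin_sqsum_def supp_def ell2f_def)
  qed
  show "fin_sqsum (Field \<kappa>) \<subseteq> of_coords ` ell2f \<kappa>"
  proof
    fix y assume y: "y \<in> fin_sqsum (Field \<kappa>)"
    have "coord y \<in> ell2f \<kappa>"
      using y coord_sq_summable[of y "Field \<kappa>"]
      by (auto simp: ell2f_def ell2_space_def fin_sqsum_def supp_def intro: finite_subset[rotated])
    then show "y \<in> of_coords ` ell2f \<kappa>"
      by (metis coord_inverse image_eqI)
  qed
qed

section \<open>Classes of spaces\<close>

lemma in_class_homeomorphic:
  "X homeomorphic_space Y \<Longrightarrow> in_class Y D \<Longrightarrow> in_class X D"
  unfolding in_class_def using homeomorphic_space_trans by blast

lemma in_class_member: "A \<in> D \<Longrightarrow> in_class A D"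
  unfolding in_class_def using homeomorphic_space_refl by blast

text \<open>The properties of \<open>\<CC>(\<kappa>')\<close> that the construction relies on.  The product lives on another type, hence
  the use of \<open>in_class\<close>.\<close>

locale stable_class =
  fixes D :: "'u topology set"
  assumes metrizable: "A \<in> D \<Longrightarrow> metrizable_space A"
    and closed: "A \<in> D \<Longrightarrow> closedin A F \<Longrightarrow> in_class (subtopology A F) D"
    and times_interval: "A \<in> D \<Longrightarrow> in_class (prod_topology A (top_of_set {0..1::real})) D"
begin

lemma in_class_closed:
  assumes "in_class X D" "closedin X F"
  shows "in_class (subtopology X F) D"
proof -
  obtain A h where A: "A \<in> D" and h: "homeomorphic_map X A h"
    using assms(1) by (auto simp: in_class_def homeomorphic_space)
  have F: "F \<subseteq> topspace X"
    using assms(2) closedin_subset by blast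
  then have "closedin A (h ` F)"
    using homeomorphic_map_closedness[OF h] assms(2) by blast
  then have "in_class (subtopology A (h ` F)) D"
    using closed A by blast
  moreover have "homeomorphic_map (subtopology X F) (subtopology A (h ` F)) h"
    using F homeomorphic_imp_surjective_map[OF h]
    by (intro homeomorphic_map_subtopologies[OF h]) (auto simp: Int_absorb1)
  then have "subtopology X F homeomorphic_space subtopology A (h ` F)"
    using homeomorphic_map_imp_homeomorphic_space by blast
  ultimately show ?thesis
    using in_class_homeomorphic by blast
qed

lemma in_class_times_interval:
  assumes "in_class X D"
  shows "in_class (prod_topology X (top_of_set {0..1::real})) D"
proof -
  obtain A where A: "A \<in> D" "X homeomorphic_space A"
    using assms(1) by (auto simp: in_class_def)
  then have "prod_topology X (top_of_set {0..1::real}) homeomorphic_space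
             prod_topology A (top_of_set {0..1::real})"
    by (intro homeomorphic_space_prod_topology homeomorphic_space_refl)
  then show ?thesis
    using in_class_homeomorphic times_interval[OF A(1)] by blast
qed

definition cube :: "'i set \<Rightarrow> real \<Rightarrow> 'i sqsum set" where
  "cube S m = {x. supp x \<subseteq> S \<and> (\<forall>i. \<bar>coord x i\<bar> \<le> m)}"

text \<open>A cube with one more coordinate is the product of the smaller cube with an interval.\<close>

lemma in_class_cube_times:
  fixes Y :: "'b::topological_space set" and S :: "'i set"
  assumes Y: "in_class (top_of_set Y) D" and S: "finite S" and m: "m > 0"
  shows "in_class (top_of_set (cube S m \<times> Y)) D"
  using S
proof (induction S rule: finite_induct)
  case empty
  have cube: "cube {} m = {0 :: 'i sqsum}"
    using m by (auto simp: cube_def supp_def intro: sqsum_eqI)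
  have "homeomorphic_maps (top_of_set (cube {} m \<times> Y)) (top_of_set Y) snd (\<lambda>y. (0 :: 'i sqsum, y))"
    unfolding homeomorphic_maps_def
    by (auto simp: cube intro!: continuous_intros)
  then show ?case
    using Y in_class_homeomorphic unfolding homeomorphic_space_def by blast
next
  case (insert i S)
  define f where "f p = ((fst p - coord (fst p) i *\<^sub>R basis_vec i, snd p), (coord (fst p) i / m + 1) / 2)"
    for p :: "'i sqsum \<times> 'b"
  define g where "g q = (fst (fst q) + (m * (2 * snd q - 1)) *\<^sub>R basis_vec i, snd (fst q))"
    for q :: "('i sqsum \<times> 'b) \<times> real"
  have bnd: "0 \<le> (c / m + 1) / 2 \<and> (c / m + 1) / 2 \<le> 1" if "\<bar>c\<bar> \<le> m" for c
    using that m by (auto simp: field_simps)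
  have bnd': "\<bar>m * (2 * s - 1)\<bar> \<le> m" if "0 \<le> s" "s \<le> 1" for s
    using that m by (auto simp: abs_mult mult_le_cancel_left1)
  have f_in: "f p \<in> (cube S m \<times> Y) \<times> {0..1}" if "p \<in> cube (insert i S) m \<times> Y" for p
    using that bnd[of "coord (fst p) i"] m by (auto simp: f_def cube_def supp_def)
  have g_in: "g q \<in> cube (insert i S) m \<times> Y" if "q \<in> (cube S m \<times> Y) \<times> {0..1}" for q
  proof -
    have "coord (fst (fst q)) i = 0"
      using that insert.hyps by (auto simp: cube_def supp_def)
    then show ?thesis
      using that bnd'[of "snd q"] by (auto simp: g_def cube_def supp_def)
  qed
  have fg: "f (g q) = q" if "q \<in> (cube S m \<times> Y) \<times> {0..1}" for q
  proof -
    have "coord (fst (fst q)) i = 0"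
      using that insert.hyps by (auto simp: cube_def supp_def)
    then show ?thesis
      using m by (auto simp: f_def g_def prod_eq_iff intro!: sqsum_eqI)
  qed
  have gf: "g (f p) = p" for p
    using m by (auto simp: f_def g_def prod_eq_iff field_simps intro!: sqsum_eqI)
  have "continuous_on (cube (insert i S) m \<times> Y) f"
    unfolding f_def using m by (intro continuous_intros) auto
  moreover have "continuous_on ((cube S m \<times> Y) \<times> {0..1}) g"
    unfolding g_def by (intro continuous_intros)
  ultimately have "homeomorphic_maps (top_of_set (cube (insert i S) m \<times> Y))
      (top_of_set ((cube S m \<times> Y) \<times> {0..1})) f g"
    unfolding homeomorphic_maps_def using f_in g_in fg gf by auto
  then have "top_of_set (cube (insert i S) m \<times> Y) homeomorphic_space
      prod_topology (top_of_set (cube S m \<times> Y)) (top_of_set {0..1::real})"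
    unfolding prod_topology_subtopology_eu homeomorphic_space_def by blast
  then show ?case
    using in_class_homeomorphic in_class_times_interval[OF insert.IH] by blast
qed

end

section \<open>Topological sums\<close>

lemma homeomorphic_sum_topology:
  assumes open_piece: "\<And>\<gamma>. \<gamma> \<in> I \<Longrightarrow> openin X {x \<in> topspace X. \<iota> x = \<gamma>}"
    and range: "\<And>x. x \<in> topspace X \<Longrightarrow> \<iota> x \<in> I"
    and h: "\<And>\<gamma>. \<gamma> \<in> I \<Longrightarrow> homeomorphic_map (subtopology X {x \<in> topspace X. \<iota> x = \<gamma>}) (A \<gamma>) (h \<gamma>)"
  shows "X homeomorphic_space sum_topology A I"
proof -
  define P where "P \<gamma> = {x \<in> topspace X. \<iota> x = \<gamma>}" for \<gamma>
  define \<phi> where "\<phi> x = (\<iota> x, h (\<iota> x) x)" for x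
  have P: "topspace (subtopology X (P \<gamma>)) = P \<gamma>" for \<gamma>
    by (auto simp: P_def)
  have h': "continuous_map (subtopology X (P \<gamma>)) (A \<gamma>) (h \<gamma>)" "inj_on (h \<gamma>) (P \<gamma>)"
    "h \<gamma> ` P \<gamma> = topspace (A \<gamma>)" "open_map (subtopology X (P \<gamma>)) (A \<gamma>) (h \<gamma>)" if "\<gamma> \<in> I" for \<gamma>
    using h[OF that] P[of \<gamma>] by (auto simp: homeomorphic_eq_everything_map P_def[symmetric])
  have "homeomorphic_map X (sum_topology A I) \<phi>"
  proof (rule bijective_open_imp_homeomorphic_map)
    show "\<phi> ` topspace X = topspace (sum_topology A I)"
    proof (intro set_eqI iffI)
      fix z assume "z \<in> \<phi> ` topspace X"
      then obtain x where x: "x \<in> topspace X" "z = \<phi> x" by blast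
      then have "h (\<iota> x) x \<in> topspace (A (\<iota> x))"
        using h'(3)[OF range[OF x(1)]] by (auto simp: P_def)
      then show "z \<in> topspace (sum_topology A I)"
        using x range by (simp add: \<phi>_def)
    next
      fix z assume "z \<in> topspace (sum_topology A I)"
      then obtain \<gamma> y where z: "z = (\<gamma>, y)" "\<gamma> \<in> I" "y \<in> topspace (A \<gamma>)" by auto
      then obtain x where "x \<in> P \<gamma>" "y = h \<gamma> x"
        using h'(3)[OF z(2)] by blast
      then show "z \<in> \<phi> ` topspace X"
        using z by (auto simp: \<phi>_def P_def intro!: image_eqI[of _ _ x])
    qed
    show "inj_on \<phi> (topspace X)"
    proof (rule inj_onI)
      fix x y assume xy: "x \<in> topspace X" "y \<in> topspace X" "\<phi> x = \<phi> y"
      then have "\<iota> x = \<iota> y" "h (\<iota> x) x = h (\<iota> x) y"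
        by (auto simp: \<phi>_def)
      then show "x = y"
        using h'(2)[OF range[OF xy(1)]] xy by (auto simp: P_def inj_on_def)
    qed
    show "continuous_map X (sum_topology A I) \<phi>"
      unfolding continuous_map_alt
    proof (intro conjI allI impI)
      show "\<phi> \<in> topspace X \<rightarrow> topspace (sum_topology A I)"
        using \<open>\<phi> ` topspace X = topspace (sum_topology A I)\<close> by blast
      fix U assume U: "openin (sum_topology A I) U"
      have "\<phi> -` U \<inter> topspace X = (\<Union>\<gamma>\<in>I. {x \<in> P \<gamma>. h \<gamma> x \<in> {y. (\<gamma>, y) \<in> U}})"
        using range by (auto simp: P_def \<phi>_def)
      moreover have "openin X {x \<in> P \<gamma>. h \<gamma> x \<in> {y. (\<gamma>, y) \<in> U}}" if g: "\<gamma> \<in> I" for \<gamma>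
      proof -
        have "openin (A \<gamma>) {y. (\<gamma>, y) \<in> U}"
          using U g by (simp add: openin_sum_topology)
        then have "openin (subtopology X (P \<gamma>)) {x \<in> topspace (subtopology X (P \<gamma>)). h \<gamma> x \<in> {y. (\<gamma>, y) \<in> U}}"
          using h'(1)[OF g] openin_continuous_map_preimage by blast
        then show ?thesis
          unfolding P using open_piece[OF g] openin_trans_full unfolding P_def by blast
      qed
      ultimately show "openin X (\<phi> -` U \<inter> topspace X)"
        by auto
    qed
    show "open_map X (sum_topology A I) \<phi>"
      unfolding open_map_def
    proof (intro allI impI)
      fix U assume U: "openin X U"
      have Usub: "U \<subseteq> topspace X"
        using U openin_subset by blast
      have eq: "{y. (\<gamma>, y) \<in> \<phi> ` U} = h \<gamma> ` (U \<inter> P \<gamma>)" for \<gamma>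
        using Usub by (auto simp: \<phi>_def P_def)
      have "openin (A \<gamma>) {y. (\<gamma>, y) \<in> \<phi> ` U}" if g: "\<gamma> \<in> I" for \<gamma>
        unfolding eq using h'(4)[OF g] U by (simp add: open_map_def openin_subtopology_Int)
      moreover have "\<phi> ` U \<subseteq> Sigma I (topspace \<circ> A)"
        using \<open>\<phi> ` topspace X = topspace (sum_topology A I)\<close> Usub by auto
      ultimately show "openin (sum_topology A I) (\<phi> ` U)"
        by (simp add: openin_sum_topology)
    qed
  qed
  then show ?thesis
    using homeomorphic_map_imp_homeomorphic_space by blast
qed

lemma in_class_sum_class:
  fixes \<kappa> :: "'k rel" and \<iota> :: "'a \<Rightarrow> 'k" and D :: "'u topology set"
  assumes open_piece: "\<And>\<gamma>. \<gamma> \<in> Field \<kappa> \<Longrightarrow> openin X {x \<in> topspace X. \<iota> x = \<gamma>}"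
    and range: "\<And>x. x \<in> topspace X \<Longrightarrow> \<iota> x \<in> Field \<kappa>"
    and D: "\<And>\<gamma>. \<gamma> \<in> Field \<kappa> \<Longrightarrow> in_class (subtopology X {x \<in> topspace X. \<iota> x = \<gamma>}) D"
  shows "in_class X (sum_class \<kappa> D)"
proof -
  have "\<forall>\<gamma>\<in>Field \<kappa>. \<exists>A h. A \<in> D \<and> homeomorphic_map (subtopology X {x \<in> topspace X. \<iota> x = \<gamma>}) A h"
    using D unfolding in_class_def homeomorphic_space by blast
  then obtain A h where A: "\<And>\<gamma>. \<gamma> \<in> Field \<kappa> \<Longrightarrow> A \<gamma> \<in> D"
    "\<And>\<gamma>. \<gamma> \<in> Field \<kappa> \<Longrightarrow> homeomorphic_map (subtopology X {x \<in> topspace X. \<iota> x = \<gamma>}) (A \<gamma>) (h \<gamma>)"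
    by metis
  have "X homeomorphic_space sum_topology A (Field \<kappa>)"
    using homeomorphic_sum_topology[OF open_piece range A(2)] .
  moreover have "sum_topology A (Field \<kappa>) \<in> sum_class \<kappa> D"
    unfolding sum_class_def using A(1) homeomorphic_space_refl by blast
  ultimately show ?thesis
    unfolding in_class_def by blast
qed

text \<open>By induction, the subsets with \<open>n\<close> elements are at most \<open>|A|\<close> many.\<close>

lemma card_finite_subsets:
  fixes A :: "'a set"
  assumes inf: "infinite A"
  shows "|{S. finite S \<and> S \<subseteq> A}| \<le>o |A|"
proof -
  define B where "B n = {S. finite S \<and> S \<subseteq> A \<and> card S = n}" for n
  have "|B n| \<le>o |A|" for n
  proof (induction n)
    case 0
    have "B 0 = {{}}"
      by (auto simp: B_def)
    moreover have "A \<noteq> {}"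
      using inf by auto
    ultimately show ?case
      using card_of_singl_ordLeq[of A "{}"] by simp
  next
    case (Suc n)
    have "B (Suc n) \<subseteq> (\<lambda>(a, S). insert a S) ` (A \<times> B n)"
    proof
      fix S assume S: "S \<in> B (Suc n)"
      then have "card S = Suc n"
        by (simp add: B_def)
      then obtain a T where T: "S = insert a T" "a \<notin> T" "card T = n"
        unfolding card_Suc_eq by blast
      then have "(a, T) \<in> A \<times> B n"
        using S by (simp add: B_def)
      then show "S \<in> (\<lambda>(a, S). insert a S) ` (A \<times> B n)"
        unfolding T(1) by (rule rev_image_eqI) simp
    qed
    then have 1: "|B (Suc n)| \<le>o |A \<times> B n|"
      by (rule ordLeq_transitive[OF card_of_mono1 card_of_image])
    have "infinite (Field |A| )"
      using inf by (simp only: Field_card_of) simp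
    then have "|A \<times> B n| \<le>o |A|"
      by (intro card_of_Times_ordLeq_infinite_Field Suc card_of_Card_order card_of_mono1 subset_refl)
    with 1 show ?case
      by (rule ordLeq_transitive)
  qed
  moreover have "|UNIV :: nat set| \<le>o |A|"
    using inf by (simp only: infinite_iff_card_of_nat)
  ultimately have "|\<Union>n\<in>UNIV. B n| \<le>o |A|"
    by (intro card_of_UNION_ordLeq_infinite[OF inf]) simp_all
  moreover have "{S. finite S \<and> S \<subseteq> A} = (\<Union>n\<in>UNIV. B n)"
    by (auto simp: B_def)
  ultimately show ?thesis
    by simp
qed

text \<open>These sets exhaust the finitely supported families as \<open>m\<close> grows, and each of them splits into
  clopen pieces according to the support.\<close>

definition bounded_away :: "'i set \<Rightarrow> real \<Rightarrow> 'i sqsum set" where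
  "bounded_away K m = {x \<in> fin_sqsum K. \<forall>i. coord x i = 0 \<or> (1 / m \<le> \<bar>coord x i\<bar> \<and> \<bar>coord x i\<bar> \<le> m)}"

lemma supp_eq_if_close:
  assumes "x \<in> bounded_away K m" "y \<in> bounded_away K m" "dist x y < 1 / m"
  shows "supp x = supp y"
proof -
  have "coord y i \<noteq> 0" if "x \<in> bounded_away K m" "dist x y < 1 / m" "coord x i \<noteq> 0" for x y i
  proof -
    have "1 / m \<le> \<bar>coord x i\<bar>"
      using that by (auto simp: bounded_away_def)
    then show ?thesis
      using that abs_coord_diff_le_dist[of x i y] by auto
  qed
  then have "coord x i = 0 \<longleftrightarrow> coord y i = 0" for i
    using assms dist_commute[of x y] by metis
  then show ?thesis
    by (auto simp: supp_def)
qed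

lemma closed_bounded_away:
  "closed {x :: 'i sqsum. \<forall>i. coord x i = 0 \<or> (1 / m \<le> \<bar>coord x i\<bar> \<and> \<bar>coord x i\<bar> \<le> m)}"
  by (intro closed_Collect_all closed_Collect_disj closed_Collect_conj closed_Collect_eq closed_Collect_le continuous_intros)

text \<open>The pieces of \<open>bounded_away K m\<close> are indexed by finite supports, hence by an injection into \<open>\<kappa>\<close>.  The piece with
  support \<open>S\<close> is closed in a cube over \<open>S\<close>.\<close>

lemma (in stable_class) sigma_class_fin_sqsum_times:
  fixes \<kappa> :: "'k rel" and \<Omega> :: "'b::metric_space set"
  assumes inf: "infinite (Field \<kappa>)" and \<Omega>: "top_of_set \<Omega> \<in> sigma_class D"
  shows "top_of_set (fin_sqsum (Field \<kappa>) \<times> \<Omega>) \<in> sigma_class (sum_class \<kappa> D)"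
proof -
  let ?X = "fin_sqsum (Field \<kappa>) \<times> \<Omega>"
  obtain W :: "nat \<Rightarrow> 'b set" where W: "\<Omega> = (\<Union>n. W n)" "\<And>n. closedin (top_of_set \<Omega>) (W n)"
    "\<And>n. in_class (top_of_set (W n)) D"
  proof -
    obtain W :: "nat \<Rightarrow> 'b set" where W: "\<Omega> = (\<Union>n. W n)" "\<And>n. closedin (top_of_set \<Omega>) (W n)"
      "\<And>n. in_class (subtopology (top_of_set \<Omega>) (W n)) D"
      using \<Omega> unfolding sigma_class_def mem_Collect_eq topspace_euclidean_subtopology by blast
    have eq: "subtopology (top_of_set \<Omega>) (W n) = top_of_set (W n)" for n
    proof -
      have "\<Omega> \<inter> W n = W n"
        using W(1) by blast
      then show ?thesis
        by (simp only: subtopology_subtopology)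
    qed
    show thesis
      using that[OF W(1,2) W(3)[unfolded eq]] .
  qed
  have "\<exists>g. inj_on g {S. finite S \<and> S \<subseteq> Field \<kappa>} \<and> g ` {S. finite S \<and> S \<subseteq> Field \<kappa>} \<subseteq> Field \<kappa>"
    unfolding card_of_ordLeq by (rule card_finite_subsets[OF inf])
  then obtain g where g: "inj_on g {S. finite S \<and> S \<subseteq> Field \<kappa>}" "g ` {S. finite S \<and> S \<subseteq> Field \<kappa>} \<subseteq> Field \<kappa>"
    by blast
  define E where "E m n = bounded_away (Field \<kappa>) (Suc m) \<times> W n" for m n
  have cl: "closedin (top_of_set ?X) (E m n)" for m n
  proof -
    let ?G = "{x :: 'k sqsum. \<forall>i. coord x i = 0 \<or> (1 / Suc m \<le> \<bar>coord x i\<bar> \<and> \<bar>coord x i\<bar> \<le> Suc m)}"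
    have "bounded_away (Field \<kappa>) (Suc m) = fin_sqsum (Field \<kappa>) \<inter> ?G"
      by (auto simp: bounded_away_def)
    then have "closedin (top_of_set (fin_sqsum (Field \<kappa>))) (bounded_away (Field \<kappa>) (Suc m))"
      by (simp only:) (rule closedin_closed_Int[OF closed_bounded_away])
    then have "closedin (prod_topology (top_of_set (fin_sqsum (Field \<kappa>))) (top_of_set \<Omega>)) (E m n)"
      unfolding E_def closedin_prod_Times_iff using W(2) by blast
    then show ?thesis by simp
  qed
  have cls: "in_class (top_of_set (E m n)) (sum_class \<kappa> D)" for m n
  proof (rule in_class_sum_class[of _ _ "\<lambda>p. g (supp (fst p))"])
    fix p assume "p \<in> topspace (top_of_set (E m n))"
    then show "g (supp (fst p)) \<in> Field \<kappa>"
      using g(2) by (auto simp: E_def bounded_away_def fin_sqsum_def)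
  next
    fix \<gamma>
    let ?P = "{p \<in> topspace (top_of_set (E m n)). g (supp (fst p)) = \<gamma>}"
    have op: "openin (top_of_set (E m n)) {p \<in> E m n. Q (supp (fst p))}" for Q
      unfolding openin_euclidean_subtopology_iff
    proof (intro conjI ballI)
      fix p assume p: "p \<in> {p \<in> E m n. Q (supp (fst p))}"
      show "\<exists>e>0. \<forall>q\<in>E m n. dist q p < e \<longrightarrow> q \<in> {p \<in> E m n. Q (supp (fst p))}"
      proof (intro exI[of _ "1 / Suc m"] conjI ballI impI)
        fix q assume q: "q \<in> E m n" "dist q p < 1 / Suc m"
        have "supp (fst q) = supp (fst p)"
          using supp_eq_if_close[of "fst q" "Field \<kappa>" "Suc m" "fst p"] q p
            dist_fst_le[of q p] by (auto simp: E_def)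
        then show "q \<in> {p \<in> E m n. Q (supp (fst p))}"
          using p q(1) by simp
      qed auto
    qed auto
    then show "openin (top_of_set (E m n)) ?P"
      using op[of "\<lambda>S. g S = \<gamma>"] by simp
    show "in_class (subtopology (top_of_set (E m n)) ?P) D"
    proof (cases "?P = {}")
      case True
      have "in_class (subtopology (top_of_set (W n)) {}) D"
        by (rule in_class_closed[OF W(3)]) simp
      moreover have "subtopology (top_of_set (E m n)) {} homeomorphic_space subtopology (top_of_set (W n)) {}"
        by (simp add: homeomorphic_empty_space_eq)
      ultimately show ?thesis
        unfolding True using in_class_homeomorphic by blast
    next
      case False
      then obtain q where q: "q \<in> ?P" by blast
      define S where "S = supp (fst q)"
      have S: "finite S" "S \<subseteq> Field \<kappa>"
        using q by (auto simp: S_def E_def bounded_away_def fin_sqsum_def)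
      define C where "C = {x :: 'k sqsum. supp x \<subseteq> S \<and>
          (\<forall>i\<in>S. 1 / Suc m \<le> \<bar>coord x i\<bar> \<and> \<bar>coord x i\<bar> \<le> Suc m)}"
      have suppC: "supp x = S" if "x \<in> C" for x
      proof -
        have "0 < 1 / real (Suc m)" by simp
        then have "coord x i \<noteq> 0" if "i \<in> S" for i
          using \<open>x \<in> C\<close> that unfolding C_def by fastforce
        then show ?thesis
          using that by (auto simp: C_def supp_def)
      qed
      have P: "?P = C \<times> W n"
      proof (intro set_eqI iffI)
        fix p assume p: "p \<in> ?P"
        then have pE: "fst p \<in> bounded_away (Field \<kappa>) (Suc m)" "snd p \<in> W n"
          by (auto simp: E_def)
        have "g (supp (fst p)) = g S"
          using p q by (simp add: S_def)
        moreover have "supp (fst p) \<in> {S. finite S \<and> S \<subseteq> Field \<kappa>}"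
          using pE by (auto simp: bounded_away_def fin_sqsum_def)
        ultimately have "supp (fst p) = S"
          using g(1) S by (intro inj_onD[OF g(1)]) auto
        then have "fst p \<in> C"
          using pE(1) unfolding C_def bounded_away_def supp_def by auto
        then show "p \<in> C \<times> W n"
          using pE(2) by (simp add: mem_Times_iff)
      next
        fix p assume p: "p \<in> C \<times> W n"
        then have "supp (fst p) = S"
          using suppC by auto
        moreover have "fst p \<in> bounded_away (Field \<kappa>) (Suc m)"
        proof -
          have pC: "fst p \<in> C"
            using p by auto
          have "fst p \<in> fin_sqsum (Field \<kappa>)"
            using suppC[OF pC] S by (simp add: fin_sqsum_def)
          moreover have "1 / Suc m \<le> \<bar>coord (fst p) i\<bar> \<and> \<bar>coord (fst p) i\<bar> \<le> Suc m"
            if "coord (fst p) i \<noteq> 0" for i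
            using pC that unfolding C_def by (auto simp: supp_def)
          ultimately show ?thesis
            unfolding bounded_away_def by blast
        qed
        ultimately show "p \<in> ?P"
          using p q by (auto simp: E_def S_def)
      qed
      have "C = {x. supp x \<subseteq> S} \<inter> (\<Inter>i\<in>S. {x. 1 / Suc m \<le> \<bar>coord x i\<bar> \<and> \<bar>coord x i\<bar> \<le> Suc m})"
        by (auto simp: C_def)
      also have "closed \<dots>"
        by (intro closed_Int closed_supp_subset closed_INT ballI closed_Collect_conj closed_Collect_le continuous_intros)
      finally have "closed C" .
      moreover have sub: "C \<subseteq> cube S (Suc m)"
      proof
        fix x assume x: "x \<in> C"
        have "\<bar>coord x i\<bar> \<le> Suc m" for i
        proof (cases "i \<in> S")
          case False
          then have "coord x i = 0"
            using x by (auto simp: C_def supp_def)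
          then show ?thesis by simp
        qed (use x in \<open>simp add: C_def\<close>)
        then show "x \<in> cube S (Suc m)"
          using x by (simp add: cube_def C_def)
      qed
      ultimately have "closedin (top_of_set (cube S (Suc m))) C"
        by (simp add: closed_subset)
      then have "closedin (prod_topology (top_of_set (cube S (Suc m))) (top_of_set (W n))) (C \<times> W n)"
        unfolding closedin_prod_Times_iff by simp
      then have "closedin (top_of_set (cube S (Suc m) \<times> W n)) (C \<times> W n)"
        by simp
      then have "in_class (subtopology (top_of_set (cube S (Suc m) \<times> W n)) (C \<times> W n)) D"
        by (rule in_class_closed[OF in_class_cube_times[OF W(3) S(1)], rotated]) simp
      moreover have "(cube S (Suc m) \<times> W n) \<inter> (C \<times> W n) = C \<times> W n"
        using sub by blast
      moreover have "E m n \<inter> (C \<times> W n) = C \<times> W n"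
        using P by auto
      ultimately show ?thesis
        unfolding P subtopology_subtopology by simp
    qed
  qed
  have cover: "topspace (top_of_set ?X) = (\<Union>k. E (fst (prod_decode k)) (snd (prod_decode k)))"
  proof (intro set_eqI iffI)
    fix p assume "p \<in> topspace (top_of_set ?X)"
    then have p: "fst p \<in> fin_sqsum (Field \<kappa>)" "snd p \<in> \<Omega>"
      by auto
    obtain n where n: "snd p \<in> W n"
      using p(2) W(1) by blast
    define V where "V = (\<lambda>i. \<bar>coord (fst p) i\<bar> + 1 / \<bar>coord (fst p) i\<bar>) ` supp (fst p)"
    have "finite V"
      using p(1) by (simp add: V_def fin_sqsum_def)
    then obtain B where B: "\<And>v. v \<in> V \<Longrightarrow> v \<le> B"
      using bdd_above_finite unfolding bdd_above_def by blast
    obtain m :: nat where m: "B < m"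
      using reals_Archimedean2 by blast
    have "1 / Suc m \<le> \<bar>coord (fst p) i\<bar> \<and> \<bar>coord (fst p) i\<bar> \<le> Suc m"
      if i: "coord (fst p) i \<noteq> 0" for i
    proof -
      define c where "c = \<bar>coord (fst p) i\<bar>"
      have c: "0 < c" "0 < 1 / c"
        using i by (simp_all add: c_def)
      have "c + 1 / c \<in> V"
        using i unfolding V_def c_def supp_def by blast
      then have "c + 1 / c \<le> B"
        by (rule B)
      then have "c \<le> Suc m" "1 / c \<le> Suc m"
        using c m by linarith+
      then show ?thesis
        unfolding c_def[symmetric] using c(1) by (simp add: divide_le_eq mult.commute)
    qed
    then have "fst p \<in> bounded_away (Field \<kappa>) (Suc m)"
      using p(1) unfolding bounded_away_def by blast
    then have "p \<in> E m n"
      using n by (simp add: E_def mem_Times_iff)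
    then show "p \<in> (\<Union>k. E (fst (prod_decode k)) (snd (prod_decode k)))"
      by (intro UN_I[of "prod_encode (m, n)"]) auto
  next
    fix p assume "p \<in> (\<Union>k. E (fst (prod_decode k)) (snd (prod_decode k)))"
    then show "p \<in> topspace (top_of_set ?X)"
      using W(1) by (auto simp: E_def bounded_away_def)
  qed
  have "subtopology (top_of_set ?X) (E m n) = top_of_set (E m n)" for m n
    using closedin_subset[OF cl[of m n]] by (simp add: subtopology_subtopology Int_absorb1)
  then have "\<forall>k. closedin (top_of_set ?X) (E (fst (prod_decode k)) (snd (prod_decode k))) \<and>
      in_class (subtopology (top_of_set ?X) (E (fst (prod_decode k)) (snd (prod_decode k)))) (sum_class \<kappa> D)"
    using cl cls by simp
  with cover have "\<exists>A :: nat \<Rightarrow> ('k sqsum \<times> 'b) set. topspace (top_of_set ?X) = (\<Union>n. A n) \<and>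
      (\<forall>n. closedin (top_of_set ?X) (A n) \<and> in_class (subtopology (top_of_set ?X) (A n)) (sum_class \<kappa> D))"
    by (intro exI conjI)
  moreover have "metrizable_space (top_of_set ?X)"
    by (intro metrizable_space_subtopology metrizable_space_euclidean)
  ultimately show ?thesis
    unfolding sigma_class_def mem_Collect_eq by (intro conjI)
qed

section \<open>Embeddings\<close>

lemma continuous_map_top_of_set_Pair:
  "continuous_map A (top_of_set S) f \<Longrightarrow> continuous_map A (top_of_set T) g \<Longrightarrow>
   continuous_map A (top_of_set (S \<times> T)) (\<lambda>a. (f a, g a))"
  using continuous_map_pairedI[of A "top_of_set S" f "top_of_set T" g] by simp

lemma continuous_map_compose_on:
  assumes "continuous_map A (top_of_set S) f" "continuous_on S \<phi>" "\<And>x. x \<in> S \<Longrightarrow> \<phi> x \<in> T"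
  shows "continuous_map A (top_of_set T) (\<lambda>a. \<phi> (f a))"
proof -
  have "continuous_map (top_of_set S) (top_of_set T) \<phi>"
    using assms(2,3) by auto
  then show ?thesis
    using continuous_map_compose[OF assms(1)] unfolding o_def by blast
qed

lemma Z_embedding_iff:
  "Z_embedding A X f \<longleftrightarrow>
     continuous_map A X f \<and> closed_map A X f \<and> inj_on f (topspace A) \<and> Z_set X (f ` topspace A)"
proof
  assume Z: "Z_embedding A X f"
  then have emb: "embedding_map A X f" and cl: "closedin X (f ` topspace A)"
    by (auto simp: Z_embedding_def Z_set_def)
  then have h: "homeomorphic_map A (subtopology X (f ` topspace A)) f"
    by (simp add: embedding_map_def)
  then have "continuous_map A X f" "inj_on f (topspace A)"
    by (auto simp: homeomorphic_eq_everything_map continuous_map_in_subtopology)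
  then show "continuous_map A X f \<and> closed_map A X f \<and> inj_on f (topspace A) \<and> Z_set X (f ` topspace A)"
    using embedding_imp_closed_map[OF emb cl] Z by (simp add: Z_embedding_def)
qed (simp add: Z_embedding_def injective_closed_imp_embedding_map)

lemma Z_set_subset:
  assumes "Z_set X A" "closedin X B" "B \<subseteq> A"
  shows "Z_set X B"
  unfolding Z_set_def
proof (intro conjI allI impI assms(2))
  fix \<U> assume "open_cover X \<U>"
  then obtain f where "continuous_map X X f" "cover_close X \<U> f id" "f ` topspace X \<inter> A = {}"
    using assms(1) unfolding Z_set_def by blast
  then show "\<exists>f. continuous_map X X f \<and> cover_close X \<U> f id \<and> f ` topspace X \<inter> B = {}"
    using assms(3) by (intro exI[of _ f]) blast
qed

lemma Z_set_empty: "Z_set X {}"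
  unfolding Z_set_def
proof (intro conjI allI impI)
  fix \<U> assume "open_cover X \<U>"
  then have "cover_close X \<U> id id"
    unfolding open_cover_def cover_close_def by auto
  then show "\<exists>f. continuous_map X X f \<and> cover_close X \<U> f id \<and> f ` topspace X \<inter> {} = {}"
    by (intro exI[of _ id]) simp
qed simp

text \<open>The limit of the values is a value because the image is closed, and the inverse map on the image is continuous.\<close>

lemma closed_embedding_limit:
  fixes S :: "'b::metric_space set"
  assumes h: "continuous_map A (top_of_set S) h" "closed_map A (top_of_set S) h" "inj_on h (topspace A)"
    and a: "\<And>n :: nat. a n \<in> topspace A" and lim: "(\<lambda>n. h (a n)) \<longlonglongrightarrow> y" and y: "y \<in> S"
  shows "\<exists>a0\<in>topspace A. h a0 = y \<and> limitin A a a0 sequentially"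
proof -
  let ?I = "h ` topspace A"
  have "closedin (top_of_set S) ?I"
    using h(2) by (simp add: closed_map_def)
  then obtain C where C: "closed C" "?I = S \<inter> C"
    by (auto simp: closedin_closed)
  have "\<And>n. h (a n) \<in> C"
    using a C(2) by auto
  then have "y \<in> C"
    using closed_sequentially[OF C(1) _ lim] by blast
  then have yI: "y \<in> ?I"
    using C(2) y by simp
  have "embedding_map A (top_of_set S) h"
    using h by (rule injective_closed_imp_embedding_map)
  then obtain k where k: "homeomorphic_maps A (subtopology (top_of_set S) ?I) h k"
    unfolding embedding_map_def homeomorphic_map_maps by blast
  have I: "S \<inter> ?I = ?I"
    using C by blast
  have "limitin (subtopology (top_of_set S) ?I) (\<lambda>n. h (a n)) y sequentially"
    using lim yI a by (simp add: subtopology_subtopology I limitin_subtopology)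
  moreover have "continuous_map (subtopology (top_of_set S) ?I) A k"
    using k by (simp add: homeomorphic_maps_def)
  ultimately have "limitin A (k \<circ> (\<lambda>n. h (a n))) (k y) sequentially"
    by (rule continuous_map_limit[rotated])
  moreover have kh: "k (h x) = x" if "x \<in> topspace A" for x
    using k that by (simp add: homeomorphic_maps_def)
  ultimately have "limitin A a (k y) sequentially"
    using a by (simp add: o_def)
  then show ?thesis
    using yI kh by auto
qed

lemma strongly_universal_in_class:
  assumes su: "strongly_universal D X" and A: "in_class A D"
    and f: "continuous_map A X f" and B: "closedin A B"
    and fB: "Z_embedding (subtopology A B) X f" and \<U>: "open_cover X \<U>"
  shows "\<exists>g. Z_embedding A X g \<and> cover_close A \<U> g f \<and> (\<forall>x\<in>B. g x = f x)"
proof -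
  obtain A' \<phi> \<psi> where A': "A' \<in> D" and hom: "homeomorphic_maps A A' \<phi> \<psi>"
    using A unfolding in_class_def homeomorphic_space_def by blast
  then have h: "homeomorphic_map A A' \<phi>" "homeomorphic_map A' A \<psi>"
    using homeomorphic_maps_map by blast+
  have inv: "\<And>x. x \<in> topspace A \<Longrightarrow> \<phi> x \<in> topspace A' \<and> \<psi> (\<phi> x) = x"
     "\<And>y. y \<in> topspace A' \<Longrightarrow> \<psi> y \<in> topspace A \<and> \<phi> (\<psi> y) = y"
    using hom by (auto simp: homeomorphic_maps_def continuous_map_def)
  have cont: "continuous_map A A' \<phi>" "continuous_map A' A \<psi>"
    using hom by (auto simp: homeomorphic_maps_def)
  have Bsub: "B \<subseteq> topspace A"
    using B closedin_subset by blast
  have B': "closedin A' (\<phi> ` B)"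
    using homeomorphic_map_closedness[OF h(1) Bsub] B by blast
  have \<psi>B: "\<psi> ` \<phi> ` B = B"
    using inv(1) Bsub by (force simp: image_iff)
  have B'sub: "\<phi> ` B \<subseteq> topspace A'"
    using inv(1) Bsub by auto
  have hB: "homeomorphic_map (subtopology A' (\<phi> ` B)) (subtopology A B) \<psi>"
    using B'sub Bsub \<psi>B by (intro homeomorphic_map_subtopologies[OF h(2)]) (simp add: Int_absorb1)
  have "embedding_map (subtopology A' (\<phi> ` B)) X (f \<circ> \<psi>)"
  proof (rule embedding_map_compose)
    show "embedding_map (subtopology A B) X f"
      using fB by (simp add: Z_embedding_def)
    show "embedding_map (subtopology A' (\<phi> ` B)) (subtopology A B) \<psi>"
      using hB homeomorphic_imp_surjective_map[OF hB]
      unfolding embedding_map_def by (metis subtopology_topspace)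
  qed
  moreover have "(f \<circ> \<psi>) ` topspace (subtopology A' (\<phi> ` B)) = f ` topspace (subtopology A B)"
    using homeomorphic_imp_surjective_map[OF hB] by (metis image_comp)
  ultimately have Z: "Z_embedding (subtopology A' (\<phi> ` B)) X (f \<circ> \<psi>)"
    using fB by (simp add: Z_embedding_def)
  obtain g where g: "Z_embedding A' X g" "cover_close A' \<U> g (f \<circ> \<psi>)" "\<forall>x\<in>\<phi> ` B. g x = (f \<circ> \<psi>) x"
    using su[unfolded strongly_universal_def, rule_format, OF A', of "f \<circ> \<psi>" "\<phi> ` B" \<U>]
      continuous_map_compose[OF cont(2) f] B' Z \<U> by blast
  have "embedding_map A A' \<phi>"
    using h(1) homeomorphic_imp_surjective_map[OF h(1)]
    unfolding embedding_map_def by (metis subtopology_topspace)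
  then have "embedding_map A X (g \<circ> \<phi>)"
    using g(1) embedding_map_compose unfolding Z_embedding_def by blast
  moreover have "(g \<circ> \<phi>) ` topspace A = g ` topspace A'"
    using homeomorphic_imp_surjective_map[OF h(1)] by (metis image_comp)
  ultimately have "Z_embedding A X (g \<circ> \<phi>)"
    using g(1) by (simp add: Z_embedding_def)
  moreover have "cover_close A \<U> (g \<circ> \<phi>) f"
    using g(2) inv(1) unfolding cover_close_def by (metis comp_apply)
  moreover have "\<forall>x\<in>B. (g \<circ> \<phi>) x = f x"
    using g(3) inv(1) Bsub by auto
  ultimately show ?thesis
    by blast
qed

lemma uniform_cover:
  fixes S :: "'b::metric_space set"
  assumes "e > 0"
  defines "\<U> \<equiv> (\<lambda>x. S \<inter> ball x (e/2)) ` S"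
  shows "open_cover (top_of_set S) \<U>"
    "cover_close A \<U> g f \<Longrightarrow> a \<in> topspace A \<Longrightarrow> dist (g a) (f a) < e"
proof -
  show "open_cover (top_of_set S) \<U>"
    using assms(1) unfolding open_cover_def \<U>_def by (auto intro!: openin_open_Int bexI)
  assume "cover_close A \<U> g f" "a \<in> topspace A"
  then obtain x where "dist x (g a) < e/2" "dist x (f a) < e/2"
    unfolding cover_close_def \<U>_def by fastforce
  then show "dist (g a) (f a) < e"
    by (rule dist_triangle_half_r)
qed

text \<open>The segment from \<open>g\<close> to \<open>f\<close> runs in the convex set \<open>V\<close>; the homotopy of \<open>V\<close> into \<open>\<Omega>\<close>
  pushes its interior into \<open>\<Omega>\<close>, for a time that vanishes at both ends, where the values lie in \<open>\<Omega>\<close> already.\<close>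

lemma homotopy_in_dense:
  fixes V \<Omega> :: "'b::real_normed_vector set"
  assumes V: "convex V" and dense: "homotopy_dense (top_of_set V) \<Omega>"
    and f: "continuous_map A (top_of_set \<Omega>) f" and g: "continuous_map A (top_of_set \<Omega>) g"
    and c: "\<And>a. a \<in> topspace A \<Longrightarrow> dist (g a) (f a) \<le> c" and e: "e > 0"
  obtains F where "continuous_map (prod_topology A (top_of_set {0..1})) (top_of_set \<Omega>) F"
    "\<And>a. a \<in> topspace A \<Longrightarrow> F (a, 0::real) = g a" "\<And>a. a \<in> topspace A \<Longrightarrow> F (a, 1) = f a"
    "\<And>a u. a \<in> topspace A \<Longrightarrow> 0 \<le> u \<Longrightarrow> u \<le> 1 \<Longrightarrow> dist (F (a, u)) (f a) < c + e"
proof -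
  obtain h where h: "continuous_on (V \<times> {0..1}) h" "h ` (V \<times> {0..1::real}) \<subseteq> V"
      "\<And>x. x \<in> V \<Longrightarrow> h (x, 0) = x" "h ` (V \<times> {0<..1}) \<subseteq> \<Omega>"
    and \<Omega>V: "\<Omega> \<subseteq> V"
    using dense unfolding homotopy_dense_def by auto
  have "continuous_on (V \<times> {0..1}) (\<lambda>p. (\<lambda>x t. h (x, t)) (fst p) (snd p))"
    using h(1) by simp
  moreover have "continuous_on V (\<lambda>_. e)"
    by (rule continuous_on_const)
  ultimately obtain T where T: "continuous_on V T" "\<And>x. x \<in> V \<Longrightarrow> 0 < T x \<and> T x \<le> 1"
    "\<And>x t. x \<in> V \<Longrightarrow> 0 \<le> t \<Longrightarrow> t \<le> T x \<Longrightarrow> dist (h (x, t)) x < e"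
    using controlled_homotopy_time[of V "\<lambda>x t. h (x, t)" "\<lambda>_. e"] h(3) e by blast
  define seg where "seg p = (1 - snd p) *\<^sub>R fst (fst p) + snd p *\<^sub>R snd (fst p)" for p :: "('b \<times> 'b) \<times> real"
  define \<phi> where "\<phi> p = h (seg p, snd p * (1 - snd p) * T (seg p))" for p
  let ?S = "(\<Omega> \<times> \<Omega>) \<times> {0..1::real}"
  have seg: "seg p \<in> V" if p: "p \<in> ?S" for p
  proof -
    have "fst (fst p) \<in> V" "snd (fst p) \<in> V" "0 \<le> 1 - snd p" "0 \<le> snd p"
      using p \<Omega>V by auto
    then show ?thesis
      unfolding seg_def by (intro convexD[OF V]) auto
  qed
  have cseg: "continuous_on ?S seg"
    unfolding seg_def by (intro continuous_intros)
  have time: "0 \<le> snd p * (1 - snd p) * T (seg p)" "snd p * (1 - snd p) * T (seg p) \<le> T (seg p)"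
    "snd p * (1 - snd p) * T (seg p) \<le> 1" if p: "p \<in> ?S" for p
  proof -
    have p': "0 \<le> snd p" "snd p \<le> 1"
      using p by auto
    then have "snd p * (1 - snd p) \<le> 1" "0 \<le> snd p * (1 - snd p)"
      by (simp_all add: mult_le_one)
    then show "0 \<le> snd p * (1 - snd p) * T (seg p)" "snd p * (1 - snd p) * T (seg p) \<le> T (seg p)"
      using T(2)[OF seg[OF p]] by (simp_all add: mult_left_le_one_le)
    then show "snd p * (1 - snd p) * T (seg p) \<le> 1"
      using T(2)[OF seg[OF p]] by linarith
  qed
  have c\<phi>: "continuous_on ?S \<phi>"
    unfolding \<phi>_def
  proof (rule continuous_on_compose2[OF h(1)])
    show "continuous_on ?S (\<lambda>p. (seg p, snd p * (1 - snd p) * T (seg p)))"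
      using seg by (intro continuous_intros cseg continuous_on_compose2[OF T(1) cseg]) auto
    show "(\<lambda>p. (seg p, snd p * (1 - snd p) * T (seg p))) ` ?S \<subseteq> V \<times> {0..1}"
      using seg time by auto
  qed
  have \<phi>in: "\<phi> p \<in> \<Omega>" if p: "p \<in> ?S" for p
  proof (cases "snd p = 0 \<or> snd p = 1")
    case True
    then have "\<phi> p = seg p"
      using h(3)[OF seg[OF p]] by (auto simp: \<phi>_def)
    moreover have "seg p = fst (fst p) \<or> seg p = snd (fst p)"
      using True by (auto simp: seg_def)
    ultimately show ?thesis
      using p by auto
  next
    case False
    then have "0 < snd p * (1 - snd p)"
      using p by (auto simp: zero_less_mult_iff)
    then have "0 < snd p * (1 - snd p) * T (seg p)"
      using T(2)[OF seg[OF p]] by simp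
    then have "(seg p, snd p * (1 - snd p) * T (seg p)) \<in> V \<times> {0<..1}"
      using time[OF p] seg[OF p] by simp
    then show ?thesis
      using h(4) unfolding \<phi>_def by blast
  qed
  have \<phi>dist: "dist (\<phi> p) (snd (fst p)) < dist (fst (fst p)) (snd (fst p)) + e" if p: "p \<in> ?S" for p
  proof -
    have "dist (\<phi> p) (seg p) < e"
      unfolding \<phi>_def using T(3)[OF seg[OF p]] time[OF p] by blast
    moreover have "seg p - snd (fst p) = (1 - snd p) *\<^sub>R (fst (fst p) - snd (fst p))"
      by (simp add: seg_def algebra_simps)
    then have "dist (seg p) (snd (fst p)) = (1 - snd p) * dist (fst (fst p)) (snd (fst p))"
      using p by (auto simp: dist_norm)
    then have "dist (seg p) (snd (fst p)) \<le> dist (fst (fst p)) (snd (fst p))"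
      using p by (auto intro!: mult_left_le_one_le)
    ultimately show ?thesis
      using dist_triangle[of "\<phi> p" "snd (fst p)" "seg p"] by linarith
  qed
  define F where "F q = \<phi> ((g (fst q), f (fst q)), snd q)" for q
  let ?A = "prod_topology A (top_of_set {0..1::real})"
  have in\<Omega>: "f a \<in> \<Omega>" "g a \<in> \<Omega>" if "a \<in> topspace A" for a
    using f g that by (auto simp: continuous_map_def)
  have "continuous_map ?A (top_of_set ?S) (\<lambda>q. ((g (fst q), f (fst q)), snd q))"
    using continuous_map_compose[OF continuous_map_fst f] continuous_map_compose[OF continuous_map_fst g]
    by (intro continuous_map_top_of_set_Pair continuous_map_snd) (simp_all add: o_def)
  then have "continuous_map ?A (top_of_set \<Omega>) F"
    unfolding F_def by (rule continuous_map_compose_on) (use c\<phi> \<phi>in in auto)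
  moreover have "F (a, 0) = g a" "F (a, 1) = f a" if a: "a \<in> topspace A" for a
    using in\<Omega>[OF a] \<Omega>V h(3) by (auto simp: F_def \<phi>_def seg_def)
  moreover have "dist (F (a, u)) (f a) < c + e" if "a \<in> topspace A" "0 \<le> u" "u \<le> 1" for a u
    using \<phi>dist[of "((g a, f a), u)"] in\<Omega>[OF that(1)] c[OF that(1)] that by (auto simp: F_def)
  ultimately show thesis
    using that by blast
qed

lemma Z_embedding_end:
  assumes "Z_embedding (prod_topology A (top_of_set {0..1::real})) X E" "s \<in> {0..1}"
  shows "Z_embedding A X (\<lambda>a. E (a, s))"
proof -
  let ?AI = "prod_topology A (top_of_set {0..1::real})"
  have E: "continuous_map ?AI X E" "closed_map ?AI X E" "inj_on E (topspace ?AI)" "Z_set X (E ` topspace ?AI)"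
    using assms(1) unfolding Z_embedding_iff by auto
  have c: "continuous_map A ?AI (\<lambda>a. (a, s))"
    using assms(2) by (intro continuous_map_pairedI) auto
  have cl: "closed_map A X (\<lambda>a. E (a, s))"
    unfolding closed_map_def
  proof (intro allI impI)
    fix C assume "closedin A C"
    then have "closedin ?AI (C \<times> {s})"
      using assms(2) by (simp add: closedin_prod_Times_iff)
    then have "closedin X (E ` (C \<times> {s}))"
      using E(2) by (simp add: closed_map_def)
    moreover have "E ` (C \<times> {s}) = (\<lambda>a. E (a, s)) ` C"
      by auto
    ultimately show "closedin X ((\<lambda>a. E (a, s)) ` C)"
      by simp
  qed
  have "(\<lambda>a. E (a, s)) ` topspace A \<subseteq> E ` topspace ?AI"
    using assms(2) by auto
  moreover have "closedin X ((\<lambda>a. E (a, s)) ` topspace A)"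
    using cl by (simp add: closed_map_def)
  ultimately have "Z_set X ((\<lambda>a. E (a, s)) ` topspace A)"
    by (intro Z_set_subset[OF E(4)])
  moreover have "continuous_map A X (\<lambda>a. E (a, s))"
    using continuous_map_compose[OF c E(1)] unfolding o_def .
  moreover have "inj_on (\<lambda>a. E (a, s)) (topspace A)"
  proof (rule inj_onI)
    fix a b assume "a \<in> topspace A" "b \<in> topspace A" "E (a, s) = E (b, s)"
    then have "(a, s) = (b, s)"
      using assms(2) by (intro inj_onD[OF E(3)]) auto
    then show "a = b" by simp
  qed
  ultimately show ?thesis
    using cl unfolding Z_embedding_iff by (intro conjI)
qed

text \<open>Strong universality is applied to \<open>A \<times> [0,1]\<close> with the closed subset \<open>A \<times> {0}\<close>, and to a homotopy in
  \<open>\<Omega>\<close> from the embedding \<open>g\<close> to \<open>f\<close>.  The result again ends with a Z-embedding, now as close to \<open>f\<close> as desired, so the step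
  can be repeated.\<close>

lemma (in stable_class) embedding_segment:
  fixes V \<Omega> :: "'b::real_normed_vector set"
  assumes V: "convex V" and dense: "homotopy_dense (top_of_set V) \<Omega>"
    and su: "strongly_universal D (top_of_set \<Omega>)" and A: "in_class A D"
    and f: "continuous_map A (top_of_set \<Omega>) f" and g: "Z_embedding A (top_of_set \<Omega>) g"
    and c: "\<And>a. a \<in> topspace A \<Longrightarrow> dist (g a) (f a) \<le> c" and e: "e > 0"
  shows "\<exists>E. Z_embedding (prod_topology A (top_of_set {0..1::real})) (top_of_set \<Omega>) E \<and>
    (\<forall>a\<in>topspace A. E (a, 0) = g a \<and> dist (E (a, 1)) (f a) \<le> e \<and>
       (\<forall>u\<in>{0..1}. dist (E (a, u)) (f a) \<le> c + e))"
proof -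
  let ?AI = "prod_topology A (top_of_set {0..1::real})"
  have gc: "continuous_map A (top_of_set \<Omega>) g" "closed_map A (top_of_set \<Omega>) g" "inj_on g (topspace A)"
    "Z_set (top_of_set \<Omega>) (g ` topspace A)"
    using g unfolding Z_embedding_iff by auto
  obtain F where F: "continuous_map ?AI (top_of_set \<Omega>) F"
    "\<And>a. a \<in> topspace A \<Longrightarrow> F (a, 0) = g a" "\<And>a. a \<in> topspace A \<Longrightarrow> F (a, 1) = f a"
    "\<And>a u. a \<in> topspace A \<Longrightarrow> 0 \<le> u \<Longrightarrow> u \<le> 1 \<Longrightarrow> dist (F (a, u)) (f a) < c + e / 2"
    using homotopy_in_dense[OF V dense f gc(1) c, of "e / 2"] e by auto
  define B where "B = topspace A \<times> {0::real}"
  have B: "closedin ?AI B"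
    unfolding B_def by (simp add: closedin_prod_Times_iff)
  have FB: "Z_embedding (subtopology ?AI B) (top_of_set \<Omega>) F"
    unfolding Z_embedding_iff
  proof (intro conjI)
    have top: "topspace (subtopology ?AI B) = B"
      using closedin_subset[OF B] by auto
    show "continuous_map (subtopology ?AI B) (top_of_set \<Omega>) F"
      using F(1) by (rule continuous_map_from_subtopology)
    show "inj_on F (topspace (subtopology ?AI B))"
      unfolding top using gc(3) F(2) by (auto simp: B_def inj_on_def)
    have img: "F ` C = g ` fst ` C" if "C \<subseteq> B" for C
      using that F(2) by (force simp: B_def image_iff)
    have "fst ` B = topspace A"
      by (auto simp: B_def)
    then show "Z_set (top_of_set \<Omega>) (F ` topspace (subtopology ?AI B))"
      unfolding top using img[of B] gc(4) by simp
    show "closed_map (subtopology ?AI B) (top_of_set \<Omega>) F"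
      unfolding closed_map_def
    proof (intro allI impI)
      fix C assume "closedin (subtopology ?AI B) C"
      then have C: "closedin ?AI C" "C \<subseteq> B"
        using B by (auto simp: closedin_closed_subtopology)
      then have CC: "C = fst ` C \<times> {0}"
        by (force simp: B_def)
      have "continuous_map A ?AI (\<lambda>a. (a, 0))"
        by (intro continuous_map_pairedI) auto
      then have "closedin A {a \<in> topspace A. (a, 0) \<in> C}"
        using C(1) closedin_continuous_map_preimage by blast
      moreover have "{a \<in> topspace A. (a, 0) \<in> C} = fst ` C"
        using C(2) by (force simp: B_def)
      ultimately have "closedin A (fst ` C)"
        by simp
      then show "closedin (top_of_set \<Omega>) (F ` C)"
        using gc(2) img[OF C(2)] by (simp add: closed_map_def)
    qed
  qed
  define \<U> where "\<U> = (\<lambda>x. \<Omega> \<inter> ball x (e/2/2)) ` \<Omega>"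
  have oc: "open_cover (top_of_set \<Omega>) \<U>"
    unfolding \<U>_def using e by (intro uniform_cover) simp
  obtain E where E: "Z_embedding ?AI (top_of_set \<Omega>) E" "cover_close ?AI \<U> E F" "\<forall>x\<in>B. E x = F x"
    using strongly_universal_in_class[OF su in_class_times_interval[OF A] F(1) B FB oc] by blast
  have near: "dist (E p) (F p) < e / 2" if "p \<in> topspace ?AI" for p
    by (rule uniform_cover(2)[OF _ E(2)[unfolded \<U>_def] that]) (use e in simp)
  show ?thesis
  proof (intro exI[of _ E] conjI ballI E(1))
    fix a assume a: "a \<in> topspace A"
    show "E (a, 0) = g a"
      using E(3) F(2) a by (simp add: B_def)
    show "dist (E (a, 1)) (f a) \<le> e"
      using near[of "(a, 1)"] a F(3) e by simp
    fix u :: real assume u: "u \<in> {0..1}"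
    have "dist (E (a, u)) (F (a, u)) < e / 2" "dist (F (a, u)) (f a) < c + e / 2"
      using near[of "(a, u)"] F(4)[of a u] a u by auto
    then show "dist (E (a, u)) (f a) \<le> c + e"
      using dist_triangle[of "E (a, u)" "f a" "F (a, u)"] by linarith
  qed
qed

section \<open>Fans of embeddings\<close>

lemma bounded_nat_seq_const_subseq:
  fixes n :: "nat \<Rightarrow> nat"
  assumes "\<And>k. n k \<le> N"
  obtains r :: "nat \<Rightarrow> nat" and m where "strict_mono r" "\<And>k. n (r k) = m"
proof -
  have "finite (range n)"
    by (rule finite_subset[where B = "{..N}"]) (use assms in auto)
  then have "\<exists>k0\<in>UNIV. infinite {k \<in> UNIV. n k = n k0}"
    by (intro pigeonhole_infinite infinite_UNIV_nat)
  then obtain k0 where inf: "infinite {k \<in> UNIV. n k = n k0}"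
    by (elim bexE)
  then obtain r :: "nat \<Rightarrow> nat" where r: "strict_mono r" "\<And>k. r k \<in> {k \<in> UNIV. n k = n k0}"
    using infinite_enumerate[OF inf] by blast
  have "n (r k) = n k0" for k
    using r(2)[of k] by (simp only: mem_Collect_eq)
  then show thesis
    by (rule that[OF r(1)])
qed

lemma (in stable_class) embedding_path:
  fixes V \<Omega> :: "'b::real_normed_vector set"
  assumes V: "convex V" and dense: "homotopy_dense (top_of_set V) \<Omega>"
    and su: "strongly_universal D (top_of_set \<Omega>)" and A: "in_class A D"
    and f: "continuous_map A (top_of_set \<Omega>) f"
  shows "\<exists>E. \<forall>n :: nat. Z_embedding (prod_topology A (top_of_set {0..1::real})) (top_of_set \<Omega>) (E n) \<and>
    (\<forall>a\<in>topspace A. \<forall>u\<in>{0..1}. dist (E n (a, u)) (f a) \<le> 1 / (n + 2)) \<and>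
    (\<forall>a\<in>topspace A. E n (a, 1) = E (Suc n) (a, 0))"
proof -
  let ?AI = "prod_topology A (top_of_set {0..1::real})"
  \<comment> \<open>The end of a segment satisfies half of the bound for the next segment; the other half is left for the motion along it.\<close>
  define P where "P n E \<longleftrightarrow> Z_embedding ?AI (top_of_set \<Omega>) E \<and>
      (\<forall>a\<in>topspace A. \<forall>u\<in>{0..1}. dist (E (a, u)) (f a) \<le> 1 / (real n + 2)) \<and>
      (\<forall>a\<in>topspace A. dist (E (a, 1)) (f a) \<le> 1 / (2 * (real n + 3)))" for n E
  define Q where "Q n E E' \<longleftrightarrow> (\<forall>a\<in>topspace A. E (a, 1) = E' (a, 0))"
    for n :: nat and E E' :: "'a \<times> real \<Rightarrow> 'b"
  have step: "\<exists>E. P n E \<and> (\<forall>a\<in>topspace A. E (a, 0) = g a)"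
    if g: "Z_embedding A (top_of_set \<Omega>) g" "\<And>a. a \<in> topspace A \<Longrightarrow> dist (g a) (f a) \<le> 1 / (2 * (real n + 2))"
    for g n
  proof -
    have pos: "0 < 1 / (2 * (real n + 3))"
      by simp
    obtain E where E: "Z_embedding ?AI (top_of_set \<Omega>) E"
      "\<And>a. a \<in> topspace A \<Longrightarrow> E (a, 0) = g a \<and> dist (E (a, 1)) (f a) \<le> 1 / (2 * (real n + 3)) \<and>
         (\<forall>u\<in>{0..1}. dist (E (a, u)) (f a) \<le> 1 / (2 * (real n + 2)) + 1 / (2 * (real n + 3)))"
      using embedding_segment[OF V dense su A f g pos] by blast
    have "1 / (2 * (real n + 3)) \<le> 1 / (2 * (real n + 2))"
      by (intro divide_left_mono) auto
    moreover have "1 / (2 * (real n + 2)) + 1 / (2 * (real n + 2)) = 1 / (real n + 2)"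
      by (simp add: field_simps)
    ultimately have "1 / (2 * (real n + 2)) + 1 / (2 * (real n + 3)) \<le> 1 / (real n + 2)"
      by (metis add_left_mono)
    then have "\<forall>a\<in>topspace A. \<forall>u\<in>{0..1}. dist (E (a, u)) (f a) \<le> 1 / (real n + 2)"
      using E(2) order_trans by blast
    then show ?thesis
      using E unfolding P_def by blast
  qed
  have "\<exists>E. \<forall>n. P n (E n) \<and> Q n (E n) (E (Suc n))"
  proof (rule dependent_nat_choice)
    define \<U> where "\<U> = (\<lambda>x. \<Omega> \<inter> ball x ((1/4)/2)) ` \<Omega>"
    have oc: "open_cover (top_of_set \<Omega>) \<U>"
      unfolding \<U>_def by (intro uniform_cover) simp
    have "closed_map (subtopology A {}) (top_of_set \<Omega>) f"
      by (simp add: closed_map_def closedin_subtopology)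
    then have "Z_embedding (subtopology A {}) (top_of_set \<Omega>) f"
      unfolding Z_embedding_iff using continuous_map_from_subtopology[OF f]
      by (intro conjI) (auto simp: Z_set_empty)
    then obtain g where g: "Z_embedding A (top_of_set \<Omega>) g" "cover_close A \<U> g f"
      using strongly_universal_in_class[OF su A f closedin_empty _ oc] by blast
    have "dist (g a) (f a) \<le> 1 / (2 * (real 0 + 2))" if "a \<in> topspace A" for a
      using uniform_cover(2)[OF _ g(2)[unfolded \<U>_def] that] by simp
    then show "\<exists>E. P 0 E"
      using step[OF g(1)] by blast
  next
    fix E n assume E: "P n E"
    then have "Z_embedding A (top_of_set \<Omega>) (\<lambda>a. E (a, 1))"
      unfolding P_def by (intro Z_embedding_end) auto
    moreover have "dist (E (a, 1)) (f a) \<le> 1 / (2 * (real (Suc n) + 2))" if "a \<in> topspace A" for a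
      using E that unfolding P_def by (simp add: add.commute)
    ultimately obtain E' where "P (Suc n) E'" "\<forall>a\<in>topspace A. E' (a, 0) = E (a, 1)"
      using step by blast
    then show "\<exists>E'. P (Suc n) E' \<and> Q n E E'"
      unfolding Q_def by auto
  qed
  then obtain E where "\<forall>n. P n (E n) \<and> Q n (E n) (E (Suc n))"
    by blast
  then show ?thesis
    unfolding P_def Q_def by (intro exI[of _ E]) (simp add: add.commute)
qed

text \<open>The segments \<open>E n\<close> are traversed one after the other, \<open>E n\<close> during the time interval \<open>[n, n + 1]\<close>.\<close>

definition concat_segments :: "(nat \<Rightarrow> 'a \<times> real \<Rightarrow> 'b) \<Rightarrow> 'a \<times> real \<Rightarrow> 'b" where
  "concat_segments E p = E (nat \<lfloor>snd p\<rfloor>) (fst p, snd p - nat \<lfloor>snd p\<rfloor>)"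

lemma concat_segments_eq:
  assumes "\<forall>a\<in>topspace A. \<forall>n. E n (a, 1) = E (Suc n) (a, 0)"
    and "a \<in> topspace A" "real n \<le> r" "r \<le> real n + 1"
  shows "concat_segments E (a, r) = E n (a, r - n)"
proof (cases "r = real n + 1")
  case True
  then have "nat \<lfloor>r\<rfloor> = Suc n"
    by simp
  then show ?thesis
    using assms(1,2) True by (simp add: concat_segments_def)
next
  case False
  then have "\<lfloor>r\<rfloor> = int n"
    using assms(3,4) by (intro floor_unique) auto
  then show ?thesis
    by (simp add: concat_segments_def)
qed

lemma continuous_map_concat_segments:
  fixes E :: "nat \<Rightarrow> 'a \<times> real \<Rightarrow> 'b"
  assumes E: "\<And>n. continuous_map (prod_topology A (top_of_set {0..1})) X (E n)"
    and match: "\<forall>a\<in>topspace A. \<forall>n. E n (a, 1) = E (Suc n) (a, 0)"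
  shows "continuous_map (prod_topology A (top_of_set {0..})) X (concat_segments E)"
proof -
  let ?Y = "prod_topology A (top_of_set {0::real..})"
  define T where "T n = topspace A \<times> {real n..real n + 1}" for n :: nat
  define F where "F n p = E n (fst p, snd p - real n)" for n p
  show ?thesis
  proof (rule pasting_lemma_locally_finite[where I = UNIV and T = T and f = F])
    fix p assume p: "p \<in> topspace ?Y"
    let ?V = "topspace A \<times> {0..<snd p + 1}"
    have "{0..<snd p + 1} = {0..} \<inter> {..<snd p + 1}"
      by auto
    then have "openin (top_of_set {0..}) {0..<snd p + 1}"
      by (metis openin_open_Int open_lessThan)
    then have "openin ?Y ?V"
      by (simp add: openin_prod_Times_iff)
    moreover have "finite {i \<in> UNIV. T i \<inter> ?V \<noteq> {}}"
    proof (rule finite_subset)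
      show "{i \<in> UNIV. T i \<inter> ?V \<noteq> {}} \<subseteq> {.. nat \<lceil>snd p + 1\<rceil>}"
        by (auto simp: T_def) linarith
    qed simp
    ultimately show "\<exists>V. openin ?Y V \<and> p \<in> V \<and> finite {i \<in> UNIV. T i \<inter> V \<noteq> {}}"
      using p by (intro exI[of _ ?V]) (auto simp: mem_Times_iff)
  next
    fix n :: nat
    have "closedin (top_of_set {0..}) {real n..real n + 1}"
      by (intro closed_subset) auto
    then show "closedin ?Y (T n)"
      by (simp add: T_def closedin_prod_Times_iff)
    have "continuous_map (subtopology ?Y (T n)) (prod_topology A (top_of_set {0..1})) (\<lambda>p. (fst p, snd p - real n))"
    proof (intro continuous_map_pairedI)
      show "continuous_map (subtopology ?Y (T n)) A fst"
        by (intro continuous_map_from_subtopology continuous_map_fst)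
      have "continuous_map (subtopology ?Y (T n)) (top_of_set {0..}) snd"
        by (intro continuous_map_from_subtopology continuous_map_snd)
      then have "continuous_map (subtopology ?Y (T n)) (top_of_set {real n..real n + 1}) snd"
        by (auto simp: continuous_map_in_subtopology T_def)
      then show "continuous_map (subtopology ?Y (T n)) (top_of_set {0..1}) (\<lambda>p. snd p - real n)"
        by (rule continuous_map_compose_on) (auto intro!: continuous_intros)
    qed
    then have "continuous_map (subtopology ?Y (T n)) X (E n \<circ> (\<lambda>p. (fst p, snd p - real n)))"
      using E by (rule continuous_map_compose)
    moreover have "E n \<circ> (\<lambda>p. (fst p, snd p - real n)) = F n"
      by (auto simp: F_def)
    ultimately show "continuous_map (subtopology ?Y (T n)) X (F n)"
      by (simp only:)
  next
    fix i j :: nat and p assume "p \<in> topspace ?Y \<inter> T i \<inter> T j"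
    then have p: "fst p \<in> topspace A" "real i \<le> snd p" "snd p \<le> real i + 1" "real j \<le> snd p" "snd p \<le> real j + 1"
      by (auto simp: T_def)
    show "F i p = F j p"
      using concat_segments_eq[OF match p(1,2,3)] concat_segments_eq[OF match p(1,4,5)] by (simp add: F_def)
  next
    fix p assume "p \<in> topspace ?Y"
    then have p: "fst p \<in> topspace A" "0 \<le> snd p"
      by auto
    have "p \<in> T (nat \<lfloor>snd p\<rfloor>)"
      using p by (auto simp: T_def mem_Times_iff)
    moreover have "concat_segments E p = F (nat \<lfloor>snd p\<rfloor>) p"
      by (simp add: concat_segments_def F_def)
    ultimately show "\<exists>j. j \<in> UNIV \<and> p \<in> T j \<and> concat_segments E p = F j p"
      by blast
  qed
qed

text \<open>The concatenated segments, traversed backwards at the parameter \<open>1 / s - 1\<close>, so that the value at \<open>s = 0\<close> is the limit \<open>f\<close>.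
  Injectivity and properness refer to known times, since segments with different numbers may meet; the
  application records the time in another coordinate.\<close>

lemma (in stable_class) embedding_fan:
  fixes V \<Omega> :: "'b::real_normed_vector set"
  assumes V: "convex V" and dense: "homotopy_dense (top_of_set V) \<Omega>"
    and su: "strongly_universal D (top_of_set \<Omega>)" and A: "in_class A D"
    and f: "continuous_map A (top_of_set \<Omega>) f"
  obtains G where "continuous_map (prod_topology A (top_of_set {0..1::real})) (top_of_set \<Omega>) G"
    "\<And>a. a \<in> topspace A \<Longrightarrow> G (a, 0) = f a"
    "\<And>a s. a \<in> topspace A \<Longrightarrow> 0 \<le> s \<Longrightarrow> s \<le> 1 \<Longrightarrow> dist (G (a, s)) (f a) \<le> s"
    "\<And>a b s. a \<in> topspace A \<Longrightarrow> b \<in> topspace A \<Longrightarrow> 0 < s \<Longrightarrow> s \<le> 1 \<Longrightarrow> G (a, s) = G (b, s) \<Longrightarrow> a = b"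
    "\<And>a s s0 y. (\<And>n::nat. a n \<in> topspace A) \<Longrightarrow> (\<And>n. 0 < s n \<and> s n \<le> 1) \<Longrightarrow> s \<longlonglongrightarrow> s0 \<Longrightarrow> 0 < s0 \<Longrightarrow>
        (\<lambda>n. G (a n, s n)) \<longlonglongrightarrow> y \<Longrightarrow> y \<in> \<Omega> \<Longrightarrow>
        \<exists>r a0. strict_mono (r :: nat \<Rightarrow> nat) \<and> limitin A (a \<circ> r) a0 sequentially"
proof -
  let ?AI = "prod_topology A (top_of_set {0..1::real})"
  obtain E where E: "\<And>n. Z_embedding ?AI (top_of_set \<Omega>) (E n)"
    "\<And>n a u. a \<in> topspace A \<Longrightarrow> u \<in> {0..1} \<Longrightarrow> dist (E n (a, u)) (f a) \<le> 1 / (real n + 2)"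
    and match: "\<forall>a\<in>topspace A. \<forall>n. E n (a, 1) = E (Suc n) (a, 0)"
  proof -
    obtain E where "\<forall>n :: nat. Z_embedding ?AI (top_of_set \<Omega>) (E n) \<and>
      (\<forall>a\<in>topspace A. \<forall>u\<in>{0..1}. dist (E n (a, u)) (f a) \<le> 1 / (n + 2)) \<and>
      (\<forall>a\<in>topspace A. E n (a, 1) = E (Suc n) (a, 0))"
      using embedding_path[OF V dense su A f] by blast
    then show thesis
      by (intro that[of E]) (auto simp: add.commute)
  qed
  have Ec: "continuous_map ?AI (top_of_set \<Omega>) (E n)" "closed_map ?AI (top_of_set \<Omega>) (E n)"
    "inj_on (E n) (topspace ?AI)" for n
    using E(1)[of n] unfolding Z_embedding_iff by auto
  have cR: "continuous_map (prod_topology A (top_of_set {0..})) (top_of_set \<Omega>) (concat_segments E)"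
    using Ec(1) match by (rule continuous_map_concat_segments)
  define G where "G p = (if snd p = 0 then f (fst p) else concat_segments E (fst p, 1 / snd p - 1))" for p
  have fl: "0 \<le> r - nat \<lfloor>r\<rfloor> \<and> r - nat \<lfloor>r\<rfloor> \<le> 1" if "0 \<le> r" for r :: real
    using that by linarith
  have Rdist: "dist (concat_segments E (a, r)) (f a) \<le> 1 / (r + 1)" if a: "a \<in> topspace A" and r: "0 \<le> r" for a r
  proof -
    have "dist (concat_segments E (a, r)) (f a) \<le> 1 / (real (nat \<lfloor>r\<rfloor>) + 2)"
      unfolding concat_segments_def fst_conv snd_conv using fl[OF r]
      by (intro E(2)[OF a]) (simp only: atLeastAtMost_iff)
    also have "\<dots> \<le> 1 / (r + 1)"
    proof (rule frac_le)
      show "r + 1 \<le> real (nat \<lfloor>r\<rfloor>) + 2"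
        by linarith
    qed (use r in auto)
    finally show ?thesis .
  qed
  have f\<Omega>: "f a \<in> \<Omega>" if "a \<in> topspace A" for a
    using f that by (auto simp: continuous_map_def)
  have R\<Omega>: "concat_segments E (a, r) \<in> \<Omega>" if "a \<in> topspace A" "0 \<le> r" for a r
    using cR that by (auto simp: continuous_map_def)
  have r0: "0 \<le> 1 / s - 1" if "0 < s" "s \<le> 1" for s :: real
    using that by simp
  have Gdist: "dist (G (a, s)) (f a) \<le> s" if "a \<in> topspace A" "0 \<le> s" "s \<le> 1" for a s
    using Rdist[OF that(1) r0[of s]] that by (cases "s = 0") (auto simp: G_def)
  have G\<Omega>: "G p \<in> \<Omega>" if "p \<in> topspace ?AI" for p
    using that f\<Omega> R\<Omega>[OF _ r0] by (auto simp: G_def)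
  have contG: "continuous_map ?AI (top_of_set \<Omega>) G"
    unfolding continuous_map_in_subtopology
  proof (intro conjI)
    show "G \<in> topspace ?AI \<rightarrow> \<Omega>"
      using G\<Omega> by blast
    have "continuous_map ?AI Met_TC.mtopology G"
      unfolding Met_TC.continuous_map_to_metric
    proof (intro ballI allI impI)
      fix p and e :: real assume p: "p \<in> topspace ?AI" and e: "e > 0"
      obtain a s where as: "p = (a, s)" "a \<in> topspace A" "0 \<le> s" "s \<le> 1"
        using p by auto
      show "\<exists>U. openin ?AI U \<and> p \<in> U \<and> (\<forall>q\<in>U. G q \<in> Met_TC.mball (G p) e)"
      proof (cases "s = 0")
        case True
        define W where "W = {b \<in> topspace A. f b \<in> ball (f a) (e / 2)}"
        have "openin A W"
          unfolding W_def
          using f by (intro openin_continuous_map_preimage[of A euclidean]) (auto simp: continuous_map_in_subtopology)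
        moreover have "openin (top_of_set {0..1}) ({0..1} \<inter> {..<e / 2})"
          by (intro openin_open_Int) auto
        ultimately have "openin ?AI (W \<times> ({0..1} \<inter> {..<e / 2}))"
          by (simp add: openin_prod_Times_iff)
        moreover have "p \<in> W \<times> ({0..1} \<inter> {..<e / 2})"
          using as True e by (auto simp: W_def)
        moreover have "G q \<in> Met_TC.mball (G p) e" if "q \<in> W \<times> ({0..1} \<inter> {..<e / 2})" for q
        proof -
          have "dist (G q) (f (fst q)) < e / 2" "dist (f a) (f (fst q)) < e / 2"
            using that Gdist[of "fst q" "snd q"] by (auto simp: W_def)
          then have "dist (f a) (G q) < e"
            using dist_triangle2[of "f a" "G q" "f (fst q)"] by linarith
          then show ?thesis
            using as True by (simp add: G_def)
        qed
        ultimately show ?thesis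
          by blast
      next
        case False
        let ?B = "prod_topology A (top_of_set {0<..1::real})"
        have op: "openin ?AI (topspace A \<times> {0<..1})"
        proof -
          have "{0<..1::real} = {0..1} \<inter> {0<..}"
            by auto
          then have "openin (top_of_set {0..1}) {0<..1::real}"
            by (metis openin_open_Int open_greaterThan)
          then show ?thesis
            by (simp add: openin_prod_Times_iff)
        qed
        have "continuous_map ?B (prod_topology A (top_of_set {0..})) (\<lambda>p. (fst p, 1 / snd p - 1))"
        proof (intro continuous_map_pairedI continuous_map_fst)
          show "continuous_map ?B (top_of_set {0..}) (\<lambda>p. 1 / snd p - 1)"
            by (rule continuous_map_compose_on[OF continuous_map_snd]) (auto intro!: continuous_intros)
        qed
        then have "continuous_map ?B (top_of_set \<Omega>) (concat_segments E \<circ> (\<lambda>p. (fst p, 1 / snd p - 1)))"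
          using cR by (rule continuous_map_compose)
        then have "continuous_map ?B euclidean (concat_segments E \<circ> (\<lambda>p. (fst p, 1 / snd p - 1)))"
          by (simp add: continuous_map_in_subtopology)
        then have "continuous_map ?B euclidean G"
          by (rule continuous_map_eq) (auto simp: G_def)
        then have "openin ?B {q \<in> topspace ?B. G q \<in> ball (G p) e}"
          by (rule openin_continuous_map_preimage) auto
        moreover have "?B = subtopology ?AI (topspace A \<times> {0<..1})"
          by (simp add: prod_topology_subtopology subtopology_subtopology Int_absorb1 subset_iff)
        ultimately have "openin ?AI {q \<in> topspace ?B. G q \<in> ball (G p) e}"
          using op openin_trans_full by metis
        moreover have "p \<in> {q \<in> topspace ?B. G q \<in> ball (G p) e}"
          using as False e by auto
        ultimately show ?thesis
          by (intro exI[of _ "{q \<in> topspace ?B. G q \<in> ball (G p) e}"]) auto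
      qed
    qed
    then show "continuous_map ?AI euclidean G"
      by simp
  qed
  have inj: "a = b" if ab: "a \<in> topspace A" "b \<in> topspace A" "0 < s" "s \<le> 1" "G (a, s) = G (b, s)" for a b s
  proof -
    define r where "r = 1 / s - 1"
    have r: "0 \<le> r"
      using ab by (simp add: r_def)
    have "E (nat \<lfloor>r\<rfloor>) (a, r - nat \<lfloor>r\<rfloor>) = E (nat \<lfloor>r\<rfloor>) (b, r - nat \<lfloor>r\<rfloor>)"
      using ab by (simp add: G_def concat_segments_def r_def)
    then have "(a, r - nat \<lfloor>r\<rfloor>) = (b, r - nat \<lfloor>r\<rfloor>)"
      using ab fl[OF r] by (intro inj_onD[OF Ec(3)[of "nat \<lfloor>r\<rfloor>"]]) auto
    then show ?thesis
      by simp
  qed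
  have proper: "\<exists>r a0. strict_mono (r :: nat \<Rightarrow> nat) \<and> limitin A (a \<circ> r) a0 sequentially"
    if a: "\<And>n::nat. a n \<in> topspace A" and s: "\<And>n. 0 < s n \<and> s n \<le> 1" "s \<longlonglongrightarrow> s0" "0 < s0"
      and lim: "(\<lambda>n. G (a n, s n)) \<longlonglongrightarrow> y" "y \<in> \<Omega>" for a s s0 y
  proof -
    define \<rho> where "\<rho> n = 1 / s n - 1" for n
    have \<rho>0: "0 \<le> \<rho> n" for n
      using s(1)[of n] by (simp add: \<rho>_def)
    have "\<rho> \<longlonglongrightarrow> 1 / s0 - 1"
      unfolding \<rho>_def using s(2,3) by (intro tendsto_intros) auto
    then have "Bseq \<rho>"
      by (intro convergent_imp_Bseq convergentI)
    then obtain K where K: "\<And>n. norm (\<rho> n) \<le> K"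
      unfolding Bseq_def by blast
    have "nat \<lfloor>\<rho> n\<rfloor> \<le> nat \<lfloor>K\<rfloor>" for n
      using K[of n] by (intro nat_mono floor_mono) simp
    then obtain r :: "nat \<Rightarrow> nat" and m where r: "strict_mono r" "\<And>n. nat \<lfloor>\<rho> (r n)\<rfloor> = m"
      by (rule bounded_nat_seq_const_subseq[where n = "\<lambda>n. nat \<lfloor>\<rho> n\<rfloor>"]) blast
    define b where "b n = (a (r n), \<rho> (r n) - m)" for n
    have "G (a (r n), s (r n)) = E m (b n)" for n
    proof -
      have "s (r n) \<noteq> 0"
        using s(1)[of "r n"] by simp
      then show ?thesis
        using r(2)[of n] by (simp add: G_def concat_segments_def b_def \<rho>_def)
    qed
    moreover have "(\<lambda>n. G (a (r n), s (r n))) \<longlonglongrightarrow> y"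
      using LIMSEQ_subseq_LIMSEQ[OF lim(1) r(1)] by (simp add: o_def)
    ultimately have "(\<lambda>n. E m (b n)) \<longlonglongrightarrow> y"
      by simp
    moreover have "b n \<in> topspace ?AI" for n
      using a fl[OF \<rho>0[of "r n"]] r(2)[of n] by (simp add: b_def)
    ultimately obtain p where "limitin ?AI b p sequentially"
      using closed_embedding_limit[OF Ec(1,2,3)] lim(2) by blast
    then have "limitin A (fst \<circ> b) (fst p) sequentially"
      by (simp add: limitin_pairwise)
    moreover have "fst \<circ> b = a \<circ> r"
      by (auto simp: b_def)
    ultimately show ?thesis
      using r(1) by auto
  qed
  show thesis
  proof (rule that[OF contG _ Gdist inj])
    show "\<exists>r a0. strict_mono (r :: nat \<Rightarrow> nat) \<and> limitin A (a \<circ> r) a0 sequentially"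
      if "\<And>n::nat. a n \<in> topspace A" "\<And>n. 0 < s n \<and> s n \<le> 1" "s \<longlonglongrightarrow> s0" "0 < s0"
        "(\<lambda>n. G (a n, s n)) \<longlonglongrightarrow> y" "y \<in> \<Omega>" for a s s0 y
      using proper that by blast
  qed (auto simp: G_def)
qed

section \<open>Maps on topological sums\<close>

text \<open>Points of different summands get distance \<open>1\<close>, and the metrics of the summands are capped by \<open>1\<close>.\<close>

lemma metrizable_space_sum_topology:
  assumes "\<And>i. i \<in> I \<Longrightarrow> metrizable_space (X i)"
  shows "metrizable_space (sum_topology X I)"
proof -
  have "\<exists>d. Metric_space (topspace (X i)) d \<and> X i = Metric_space.mtopology (topspace (X i)) d" if i: "i \<in> I" for i
  proof -
    obtain M d where "Metric_space M d" "X i = Metric_space.mtopology M d"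
      using assms[OF i] unfolding metrizable_space_def by blast
    moreover from this have "topspace (X i) = M"
      by (simp add: Metric_space.topspace_mtopology)
    ultimately show ?thesis
      by blast
  qed
  then obtain d where d: "\<And>i. i \<in> I \<Longrightarrow> Metric_space (topspace (X i)) (d i)"
    "\<And>i. i \<in> I \<Longrightarrow> X i = Metric_space.mtopology (topspace (X i)) (d i)"
    by metis
  define D where "D p q = (if fst p = fst q \<and> fst p \<in> I then min 1 (d (fst p) (snd p) (snd q)) else 1)" for p q
  let ?S = "Sigma I (topspace \<circ> X)"
  have nn: "0 \<le> d i x y" if "i \<in> I" for i x y
    using Metric_space.nonneg[OF d(1)[OF that]] .
  have Dnn: "0 \<le> D p q" for p q
    using nn by (auto simp: D_def)
  have MD: "Metric_space ?S D"
  proof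
    fix p q
    show "0 \<le> D p q"
      by (rule Dnn)
    show "D p q = D q p"
      using Metric_space.commute[OF d(1)] by (auto simp: D_def)
  next
    fix p q assume "p \<in> ?S" "q \<in> ?S"
    then have "fst p = fst q \<and> fst p \<in> I \<Longrightarrow> d (fst p) (snd p) (snd q) = 0 \<longleftrightarrow> snd p = snd q"
      by (intro Metric_space.zero[OF d(1)]) auto
    then show "D p q = 0 \<longleftrightarrow> p = q"
      using \<open>p \<in> ?S\<close> by (cases "fst p = fst q") (auto simp: D_def prod_eq_iff min_def)
  next
    fix p q r assume p: "p \<in> ?S" and q: "q \<in> ?S" and r: "r \<in> ?S"
    show "D p r \<le> D p q + D q r"
    proof (cases "fst p = fst q \<and> fst q = fst r")
      case True
      have I: "fst p \<in> I"
        using p by auto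
      have "d (fst p) (snd p) (snd r) \<le> d (fst p) (snd p) (snd q) + d (fst p) (snd q) (snd r)"
        using p q r True by (intro Metric_space.triangle[OF d(1)]) auto
      then show ?thesis
        using True I nn[of "fst p" "snd p" "snd q"] nn[of "fst p" "snd q" "snd r"] unfolding D_def
        by (simp add: min_def)
    next
      case False
      have "D p r \<le> 1" by (simp add: D_def)
      moreover have "D p q = 1 \<or> D q r = 1"
        using False by (auto simp: D_def)
      ultimately show ?thesis
        using Dnn[of p q] Dnn[of q r] by linarith
    qed
  qed
  interpret M: Metric_space ?S D by (rule MD)
  have "sum_topology X I = M.mtopology"
    unfolding topology_eq
  proof
    fix U
    have *: "openin (X i) {x. (i, x) \<in> U} \<longleftrightarrow>
        (\<forall>x. (i, x) \<in> U \<longrightarrow> (\<exists>r>0. M.mball (i, x) r \<subseteq> U))" if i: "i \<in> I" and U: "U \<subseteq> ?S" for i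
    proof -
      interpret Mi: Metric_space "topspace (X i)" "d i"
        by (rule d(1)[OF i])
      have ball: "M.mball (i, x) r \<subseteq> U \<longleftrightarrow> Mi.mball x r \<subseteq> {x. (i, x) \<in> U}" if "0 < r" "r \<le> 1" for x r
      proof -
        have "M.mball (i, x) r = {i} \<times> Mi.mball x r"
          using i that by (auto simp: D_def split: if_splits)
        then show ?thesis
          by auto
      qed
      have sub: "{x. (i, x) \<in> U} \<subseteq> topspace (X i)"
        using U by auto
      have small: "\<exists>s>0. s \<le> 1 \<and> s \<le> r" if "0 < r" for r :: real
        using that by (intro exI[of _ "min 1 r"]) auto
      have "openin (X i) {x. (i, x) \<in> U} \<longleftrightarrow> openin Mi.mtopology {x. (i, x) \<in> U}"
        using d(2)[OF i] by metis
      also have "\<dots> \<longleftrightarrow> (\<forall>x. (i, x) \<in> U \<longrightarrow> (\<exists>r>0. Mi.mball x r \<subseteq> {x. (i, x) \<in> U}))"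
        unfolding Mi.openin_mtopology using sub by simp
      also have "\<dots> \<longleftrightarrow> (\<forall>x. (i, x) \<in> U \<longrightarrow> (\<exists>r>0. M.mball (i, x) r \<subseteq> U))"
      proof (intro all_cong1 imp_cong refl iffI)
        fix x assume "\<exists>r>0. Mi.mball x r \<subseteq> {x. (i, x) \<in> U}"
        then obtain r where r: "r > 0" "Mi.mball x r \<subseteq> {x. (i, x) \<in> U}" by blast
        then obtain s where s: "s > 0" "s \<le> 1" "s \<le> r"
          using small by blast
        then have "Mi.mball x s \<subseteq> {x. (i, x) \<in> U}"
          using r(2) Mi.mball_subset_concentric[OF s(3)] by blast
        then show "\<exists>r>0. M.mball (i, x) r \<subseteq> U"
          using ball[OF s(1,2)] s(1) by blast
      next
        fix x assume "\<exists>r>0. M.mball (i, x) r \<subseteq> U"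
        then obtain r where r: "r > 0" "M.mball (i, x) r \<subseteq> U" by blast
        then obtain s where s: "s > 0" "s \<le> 1" "s \<le> r"
          using small by blast
        then have "M.mball (i, x) s \<subseteq> U"
          using r(2) M.mball_subset_concentric[OF s(3)] by blast
        then show "\<exists>r>0. Mi.mball x r \<subseteq> {x. (i, x) \<in> U}"
          using ball[OF s(1,2)] s(1) by blast
      qed
      finally show ?thesis .
    qed
    show "openin (sum_topology X I) U \<longleftrightarrow> openin M.mtopology U"
      unfolding openin_sum_topology M.openin_mtopology
    proof (intro conj_cong refl)
      assume U: "U \<subseteq> ?S"
      show "(\<forall>i\<in>I. openin (X i) {x. (i, x) \<in> U}) \<longleftrightarrow> (\<forall>x. x \<in> U \<longrightarrow> (\<exists>r>0. M.mball x r \<subseteq> U))"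
        using *[OF _ U] U by (fastforce simp: subset_iff)
    qed
  qed
  then show ?thesis
    unfolding metrizable_space_def using MD by blast
qed

lemma continuous_map_pieces:
  assumes "\<And>\<gamma>. openin A {a \<in> topspace A. \<iota> a = \<gamma>}"
    and "\<And>\<gamma>. continuous_map (subtopology A {a \<in> topspace A. \<iota> a = \<gamma>}) Y g"
  shows "continuous_map A Y g"
  by (rule pasting_lemma[where I = UNIV and T = "\<lambda>\<gamma>. {a \<in> topspace A. \<iota> a = \<gamma>}" and f = "\<lambda>_. g"])
    (use assms in auto)

lemma discrete_family_image:
  fixes X :: "'b::metric_space set"
  assumes h: "closed_map A (top_of_set X) h" "inj_on h (topspace A)"
    and op: "\<And>\<gamma>. openin A {a \<in> topspace A. \<iota> a = \<gamma>}"
  shows "discrete_family X (\<lambda>\<gamma>. h ` {a \<in> topspace A. \<iota> a = \<gamma>})"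
  unfolding discrete_family_def
proof
  fix x assume x: "x \<in> X"
  have away: "\<exists>r>0. \<forall>y\<in>h ` C. r \<le> dist x y" if C: "closedin A C" "x \<notin> h ` C" for C
  proof -
    have "closedin (top_of_set X) (h ` C)"
      using h(1) C(1) by (simp add: closed_map_def)
    then obtain T where T: "closed T" "h ` C = X \<inter> T"
      by (auto simp: closedin_closed)
    then have "open (- T)" "x \<in> - T"
      using C(2) x by (auto simp: open_Compl)
    then obtain r where r: "r > 0" "ball x r \<subseteq> - T"
      using open_contains_ball by blast
    have "r \<le> dist x y" if "y \<in> h ` C" for y
    proof (rule ccontr)
      assume "\<not> r \<le> dist x y"
      then have "y \<in> ball x r"
        by simp
      then have "y \<in> - T"
        using r(2) by blast
      then show False
        using T(2) that by blast
    qed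
    then show ?thesis
      using r(1) by blast
  qed
  obtain \<gamma>0 where \<gamma>0: "x \<notin> h ` {a \<in> topspace A. \<iota> a \<noteq> \<gamma>0}"
  proof (cases "x \<in> h ` topspace A")
    case True
    then obtain a where a: "a \<in> topspace A" "x = h a" by blast
    have "x \<notin> h ` {b \<in> topspace A. \<iota> b \<noteq> \<iota> a}"
      using a h(2) by (auto simp: inj_on_def)
    then show thesis by (rule that)
  next
    case False
    then have "x \<notin> h ` {b \<in> topspace A. \<iota> b \<noteq> undefined}"
      by blast
    then show thesis by (rule that)
  qed
  have "{a \<in> topspace A. \<iota> a \<noteq> \<gamma>0} = topspace A - {a \<in> topspace A. \<iota> a = \<gamma>0}"
    by auto
  then have "closedin A {a \<in> topspace A. \<iota> a \<noteq> \<gamma>0}"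
    using op[of \<gamma>0] by (simp add: closedin_diff)
  then obtain r where r: "r > 0" "\<forall>y\<in>h ` {a \<in> topspace A. \<iota> a \<noteq> \<gamma>0}. r \<le> dist x y"
    using away \<gamma>0 by blast
  have "\<gamma> = \<gamma>0" if "y \<in> h ` {a \<in> topspace A. \<iota> a = \<gamma>}" "dist x y < r" for \<gamma> y
  proof (rule ccontr)
    assume "\<gamma> \<noteq> \<gamma>0"
    then have "y \<in> h ` {a \<in> topspace A. \<iota> a \<noteq> \<gamma>0}"
      using that(1) by auto
    then show False
      using r(2) that(2) by fastforce
  qed
  then show "\<exists>r>0. \<exists>\<gamma>0. \<forall>\<gamma>. \<forall>y\<in>h ` {a \<in> topspace A. \<iota> a = \<gamma>}. dist x y < r \<longrightarrow> \<gamma> = \<gamma>0"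
    using r(1) by blast
qed

lemma closed_map_sequential:
  fixes X :: "'b::metric_space set"
  assumes g: "continuous_map A (top_of_set X) g"
    and proper: "\<And>a x. (\<And>n::nat. a n \<in> topspace A) \<Longrightarrow> (\<lambda>n. g (a n)) \<longlonglongrightarrow> x \<Longrightarrow> x \<in> X \<Longrightarrow>
       \<exists>r a0. strict_mono (r :: nat \<Rightarrow> nat) \<and> limitin A (a \<circ> r) a0 sequentially"
  shows "closed_map A (top_of_set X) g"
  unfolding closed_map_def
proof (intro allI impI)
  fix C assume C: "closedin A C"
  have Csub: "C \<subseteq> topspace A"
    using C closedin_subset by blast
  have "X \<inter> closure (g ` C) \<subseteq> g ` C"
  proof
    fix x assume x: "x \<in> X \<inter> closure (g ` C)"
    then obtain y where y: "\<forall>n. y n \<in> g ` C" "y \<longlonglongrightarrow> x"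
      unfolding closure_sequential Int_iff by blast
    have "\<exists>a. a \<in> C \<and> g a = y n" for n
    proof -
      obtain a where "y n = g a" "a \<in> C"
        using y(1) by (elim allE[of _ n] imageE)
      then show ?thesis
        by (intro exI[of _ a]) simp
    qed
    then have "\<forall>n. \<exists>a. a \<in> C \<and> g a = y n" ..
    then obtain a where "\<forall>n. a n \<in> C \<and> g (a n) = y n"
      by (rule choice[THEN exE])
    then have a: "\<And>n. a n \<in> C" "\<And>n. g (a n) = y n"
      by auto
    have lim: "(\<lambda>n. g (a n)) \<longlonglongrightarrow> x"
      using y(2) by (simp only: a(2))
    obtain r a0 where r: "strict_mono (r :: nat \<Rightarrow> nat)" "limitin A (a \<circ> r) a0 sequentially"
    proof -
      have "a n \<in> topspace A" for n
        using a(1)[of n] Csub by (rule subsetD[rotated])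
      moreover have "x \<in> X"
        using x by (rule IntD1)
      ultimately have "\<exists>r a0. strict_mono (r :: nat \<Rightarrow> nat) \<and> limitin A (a \<circ> r) a0 sequentially"
        using lim by (intro proper)
      then show thesis
        by (elim exE conjE) (rule that)
    qed
    have a0: "a0 \<in> C"
      using a(1) by (intro limitin_closedin[OF r(2) C]) simp_all
    have "limitin (top_of_set X) (g \<circ> (a \<circ> r)) (g a0) sequentially"
      using g r(2) by (rule continuous_map_limit)
    then have 1: "(g \<circ> (a \<circ> r)) \<longlonglongrightarrow> g a0"
      by (simp add: limitin_subtopology)
    have 2: "(g \<circ> (a \<circ> r)) \<longlonglongrightarrow> x"
      using LIMSEQ_subseq_LIMSEQ[OF lim r(1)] unfolding o_def .
    have "x = g a0"
      by (rule LIMSEQ_unique[OF 2 1])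
    then show "x \<in> g ` C"
      using a0 by blast
  qed
  moreover have "g ` C \<subseteq> X \<inter> closure (g ` C)"
  proof (rule Int_greatest[OF _ closure_subset])
    have "g \<in> topspace A \<rightarrow> X"
      using g unfolding continuous_map_in_subtopology by (rule conjunct2)
    then show "g ` C \<subseteq> X"
      using Csub by blast
  qed
  ultimately have "X \<inter> closure (g ` C) = g ` C"
    by (rule subset_antisym)
  moreover have "closedin (top_of_set X) (X \<inter> closure (g ` C))"
    by (rule closedin_closed_Int[OF closed_closure])
  ultimately show "closedin (top_of_set X) (g ` C)"
    by (simp only:)
qed

text \<open>The function \<open>\<rho>\<close> is the distance to \<open>B\<close> with respect to the metric of the graph of \<open>f\<close>, capped at \<open>1\<close>.  If it is small at \<open>a\<close>, then some
  point of \<open>B\<close> is close to \<open>a\<close> and has a value close to \<open>f a\<close>; this is what makes the final map proper near \<open>B\<close>.\<close>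

lemma graph_distance:
  fixes f :: "'a \<Rightarrow> 'b::metric_space"
  assumes M: "Metric_space M d" and f: "continuous_map (Metric_space.mtopology M d) euclidean f"
    and B: "closedin (Metric_space.mtopology M d) B"
  obtains \<rho> where "continuous_map (Metric_space.mtopology M d) euclideanreal \<rho>"
    "\<And>a. a \<in> M \<Longrightarrow> 0 \<le> \<rho> a \<and> \<rho> a \<le> 1" "\<And>a. a \<in> M \<Longrightarrow> \<rho> a = 0 \<longleftrightarrow> a \<in> B"
    "\<And>a e. a \<in> M \<Longrightarrow> \<rho> a < e \<Longrightarrow> e \<le> 1 \<Longrightarrow> \<exists>b\<in>B. d a b < e \<and> dist (f a) (f b) < e"
proof -
  interpret Metric_space M d by (rule M)
  define D where "D a b = d a b + dist (f a) (f b)" for a b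
  define \<rho> where "\<rho> a = (if B = {} then 1 else min 1 (INF b\<in>B. D a b))" for a
  have BM: "B \<subseteq> M"
    using closedin_subset[OF B] by simp
  have Dnn: "0 \<le> D a b" for a b
    by (simp add: D_def)
  have bdd: "bdd_below (D a ` B)" for a
    using Dnn by (intro bdd_belowI[of _ 0]) auto
  have nn: "0 \<le> \<rho> a" for a
    using Dnn by (auto simp: \<rho>_def intro!: cINF_greatest)
  have wit: "\<exists>b\<in>B. d a b < e \<and> dist (f a) (f b) < e" if "\<rho> a < e" "e \<le> 1" for a e
  proof -
    have "B \<noteq> {}" "(INF b\<in>B. D a b) < e"
      using that by (auto simp: \<rho>_def split: if_splits)
    then obtain b where "b \<in> B" "D a b < e"
      using cINF_less_iff[OF _ bdd] by blast
    then show ?thesis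
      using nonneg[of a b] zero_le_dist[of "f a" "f b"] unfolding D_def by (intro bexI[of _ b]) linarith+
  qed
  have lip: "\<rho> a \<le> \<rho> a' + D a a'" if a: "a \<in> M" "a' \<in> M" for a a'
  proof (cases "B = {}")
    case False
    have "(INF b\<in>B. D a b) - D a a' \<le> (INF b\<in>B. D a' b)"
    proof (rule cINF_greatest[OF False])
      fix b assume b: "b \<in> B"
      have "(INF b\<in>B. D a b) \<le> D a b"
        by (rule cINF_lower[OF bdd b])
      also have "\<dots> \<le> D a a' + D a' b"
        using triangle[of a a' b] dist_triangle[of "f a" "f b" "f a'"] a b BM unfolding D_def by fastforce
      finally show "(INF b\<in>B. D a b) - D a a' \<le> D a' b"
        by simp
    qed
    then show ?thesis
      using False Dnn[of a a'] by (simp add: \<rho>_def min_def)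
  qed (simp add: \<rho>_def Dnn)
  have zero: "\<rho> a = 0 \<longleftrightarrow> a \<in> B" if a: "a \<in> M" for a
  proof
    assume "a \<in> B"
    moreover have "D a a = 0"
      using a by (simp add: D_def)
    ultimately have "(INF b\<in>B. D a b) \<le> 0"
      using cINF_lower[OF bdd] by metis
    then show "\<rho> a = 0"
      using nn[of a] \<open>a \<in> B\<close> by (auto simp: \<rho>_def min_def split: if_splits)
  next
    assume 0: "\<rho> a = 0"
    have "\<exists>b\<in>B. b \<in> mball a e" if e: "e > 0" for e
    proof -
      obtain b where "b \<in> B" "d a b < min e 1"
        using wit[of a "min e 1"] 0 e by auto
      then show ?thesis
        using a BM by (intro bexI[of _ b]) auto
    qed
    then have "a \<in> mtopology closure_of B"
      using a by (auto simp: metric_closure_of)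
    then show "a \<in> B"
      using B closure_of_closedin by fastforce
  qed
  have "continuous_map mtopology Met_TC.mtopology \<rho>"
    unfolding Met_TC.continuous_map_to_metric
  proof (intro ballI allI impI)
    fix a and e :: real assume "a \<in> topspace mtopology" and e: "e > 0"
    then have a: "a \<in> M" by simp
    let ?U = "mball a (e/2) \<inter> {b \<in> M. f b \<in> ball (f a) (e/2)}"
    have "openin mtopology {b \<in> topspace mtopology. f b \<in> ball (f a) (e/2)}"
      using f by (rule openin_continuous_map_preimage) auto
    then have "openin mtopology ?U"
      by (intro openin_Int openin_mball) simp
    moreover have "a \<in> ?U"
      using a e by auto
    moreover have "\<rho> b \<in> Met_TC.mball (\<rho> a) e" if b: "b \<in> ?U" for b
    proof -
      have "D a b < e" "D b a < e"
        using b by (auto simp: D_def commute dist_commute)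
      then have "\<bar>\<rho> a - \<rho> b\<bar> < e"
        using lip[of a b] lip[of b a] a b by auto
      then show ?thesis
        by (simp add: dist_real_def)
    qed
    ultimately show "\<exists>U. openin mtopology U \<and> a \<in> U \<and> (\<forall>b\<in>U. \<rho> b \<in> Met_TC.mball (\<rho> a) e)"
      by blast
  qed
  then have "continuous_map mtopology euclideanreal \<rho>"
    by simp
  moreover have "\<rho> a \<le> 1" for a
    by (simp add: \<rho>_def)
  ultimately show thesis
    using that nn zero wit by blast
qed

section \<open>Approximation by Z-embeddings\<close>

lemma continuous_map_to_euclidean_compose:
  assumes "continuous_map A (top_of_set S) f" "continuous_on S \<phi>"
  shows "continuous_map A euclidean (\<lambda>a. \<phi> (f a))"
proof -
  have "continuous_map (top_of_set S) euclidean \<phi>"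
    using assms(2) by simp
  then show ?thesis
    using continuous_map_compose[OF assms(1)] unfolding o_def by blast
qed

lemma tendsto_if_dist_tendsto_0:
  fixes x :: "'a::metric_space"
  assumes u: "u \<longlonglongrightarrow> x" and uv: "(\<lambda>n. dist (u n) (v n)) \<longlonglongrightarrow> 0"
  shows "v \<longlonglongrightarrow> x"
proof -
  have "(\<lambda>n. dist (u n) x) \<longlonglongrightarrow> 0"
    using u unfolding tendsto_dist_iff[of u] .
  then have up: "(\<lambda>n. dist (u n) (v n) + dist (u n) x) \<longlonglongrightarrow> 0"
    using tendsto_add[OF uv] by fastforce
  have "(\<lambda>n. dist (v n) x) \<longlonglongrightarrow> 0"
    by (rule real_tendsto_sandwich[OF _ _ tendsto_const up]) (auto simp: dist_triangle3)
  then show ?thesis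
    unfolding tendsto_dist_iff[of v] .
qed

lemma sum_class_pieces:
  fixes \<kappa> :: "'k rel" and D :: "'u topology set"
  assumes A: "A \<in> sum_class \<kappa> D" and met: "\<And>A. A \<in> D \<Longrightarrow> metrizable_space A"
  obtains \<iota> :: "'k \<times> 'u \<Rightarrow> 'k" where "metrizable_space A" "\<And>\<gamma>. openin A {a \<in> topspace A. \<iota> a = \<gamma>}"
    "\<And>a. a \<in> topspace A \<Longrightarrow> \<iota> a \<in> Field \<kappa>"
    "\<And>\<gamma>. \<gamma> \<in> Field \<kappa> \<Longrightarrow> in_class (subtopology A {a \<in> topspace A. \<iota> a = \<gamma>}) D"
proof -
  obtain A0 where A0: "\<And>\<gamma>. \<gamma> \<in> Field \<kappa> \<Longrightarrow> A0 \<gamma> \<in> D" "A homeomorphic_space sum_topology A0 (Field \<kappa>)"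
    using A unfolding sum_class_def by blast
  let ?S = "sum_topology A0 (Field \<kappa>)"
  obtain h where h: "homeomorphic_map A ?S h"
    using A0(2) unfolding homeomorphic_space by blast
  define \<iota> where "\<iota> a = fst (h a)" for a
  have hc: "continuous_map A ?S h" and hs: "h ` topspace A = topspace ?S"
    using h homeomorphic_imp_continuous_map homeomorphic_imp_surjective_map by blast+
  have h_in: "h a \<in> topspace ?S" if "a \<in> topspace A" for a
    using hs that by blast
  define Q where "Q \<gamma> = {p \<in> topspace ?S. fst p = \<gamma>}" for \<gamma>
  have "metrizable_space ?S"
    using metrizable_space_sum_topology[of "Field \<kappa>" A0] met A0(1) by blast
  then have 1: "metrizable_space A"
    using homeomorphic_metrizable_space[OF A0(2)] by blast
  have Qo: "openin ?S (Q \<gamma>)" for \<gamma>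
    unfolding openin_sum_topology
  proof (intro conjI ballI)
    show "Q \<gamma> \<subseteq> Sigma (Field \<kappa>) (topspace \<circ> A0)"
      by (auto simp: Q_def)
    fix i assume "i \<in> Field \<kappa>"
    then have "{x. (i, x) \<in> Q \<gamma>} = (if i = \<gamma> then topspace (A0 i) else {})"
      by (auto simp: Q_def)
    then show "openin (A0 i) {x. (i, x) \<in> Q \<gamma>}"
      by simp
  qed
  have PQ: "{a \<in> topspace A. \<iota> a = \<gamma>} = {a \<in> topspace A. h a \<in> Q \<gamma>}" for \<gamma>
    using h_in by (auto simp: \<iota>_def Q_def)
  have 2: "openin A {a \<in> topspace A. \<iota> a = \<gamma>}" for \<gamma>
    unfolding PQ using hc Qo by (rule openin_continuous_map_preimage)
  have 3: "\<iota> a \<in> Field \<kappa>" if "a \<in> topspace A" for a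
    using h_in[OF that] by (auto simp: \<iota>_def)
  have 4: "in_class (subtopology A {a \<in> topspace A. \<iota> a = \<gamma>}) D" if g: "\<gamma> \<in> Field \<kappa>" for \<gamma>
  proof -
    have "homeomorphic_map (subtopology A {a \<in> topspace A. \<iota> a = \<gamma>}) (subtopology ?S (Q \<gamma>)) h"
    proof (rule homeomorphic_map_subtopologies_alt[OF h])
      fix x assume "x \<in> topspace A" "h x \<in> topspace ?S"
      then show "h x \<in> Q \<gamma> \<longleftrightarrow> x \<in> {a \<in> topspace A. \<iota> a = \<gamma>}"
        unfolding PQ by simp
    qed
    then have "subtopology A {a \<in> topspace A. \<iota> a = \<gamma>} homeomorphic_space subtopology ?S (Q \<gamma>)"
      by (rule homeomorphic_map_imp_homeomorphic_space)
    moreover have "A0 \<gamma> homeomorphic_space subtopology ?S ((\<lambda>x. (\<gamma>, x)) ` topspace (A0 \<gamma>))"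
      by (rule embedding_map_imp_homeomorphic_space[OF embedding_map_component_injection[OF g]])
    moreover have "(\<lambda>x. (\<gamma>, x)) ` topspace (A0 \<gamma>) = Q \<gamma>"
      using g by (auto simp: Q_def)
    ultimately have "subtopology A {a \<in> topspace A. \<iota> a = \<gamma>} homeomorphic_space A0 \<gamma>"
      using homeomorphic_space_trans homeomorphic_space_sym by metis
    then show ?thesis
      using A0(1)[OF g] unfolding in_class_def by blast
  qed
  show thesis
    using that[OF 1 2 3 4] .
qed

text \<open>The statement is strong universality for the space \<open>A\<close> with the clopen pieces given by \<open>\<iota>\<close>.
  Properness of the map constructed in the proof is checked on a sequence whose images converge to \<open>x\<close>.  If \<open>s\<close> tends to \<open>0\<close>
  along it, then so does \<open>\<rho>\<close>, and the sequence is compared with one in \<open>B\<close>, where \<open>f\<close> is a closed embedding.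
  Otherwise the images in different pieces stay apart, the sequence remains in one piece, and the
  fan of that piece is proper at positive times.\<close>

lemma (in stable_class) Z_embedding_approximation:
  fixes \<kappa> :: "'k rel" and \<kappa>' :: "'j rel" and V \<Omega> :: "'b::real_normed_vector set" and A :: "'a topology"
    and \<iota> :: "'a \<Rightarrow> 'k" and f :: "'a \<Rightarrow> 'k sqsum \<times> 'b"
  assumes \<kappa>: "Card_order \<kappa>" "Card_order \<kappa>'" "natLeq \<le>o \<kappa>'" "\<kappa>' <o \<kappa>"
    and density: "\<And>A. A \<in> D \<Longrightarrow> density_le A \<kappa>'"
    and V: "convex V" and dense: "homotopy_dense (top_of_set V) \<Omega>"
    and su: "strongly_universal D (top_of_set \<Omega>)"
    and A: "metrizable_space A" and open_piece: "\<And>\<gamma>. openin A {a \<in> topspace A. \<iota> a = \<gamma>}"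
    and range: "\<And>a. a \<in> topspace A \<Longrightarrow> \<iota> a \<in> Field \<kappa>"
    and piece: "\<And>\<gamma>. \<gamma> \<in> Field \<kappa> \<Longrightarrow> in_class (subtopology A {a \<in> topspace A. \<iota> a = \<gamma>}) D"
    and f: "continuous_map A (top_of_set (fin_sqsum (Field \<kappa>) \<times> \<Omega>)) f" and B: "closedin A B"
    and fB: "Z_embedding (subtopology A B) (top_of_set (fin_sqsum (Field \<kappa>) \<times> \<Omega>)) f"
    and \<U>: "open_cover (top_of_set (fin_sqsum (Field \<kappa>) \<times> \<Omega>)) \<U>"
  shows "\<exists>g. Z_embedding A (top_of_set (fin_sqsum (Field \<kappa>) \<times> \<Omega>)) g \<and> cover_close A \<U> g f \<and> (\<forall>x\<in>B. g x = f x)"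
proof -
  let ?K = "Field \<kappa>"
  let ?X = "fin_sqsum ?K \<times> \<Omega>"
  obtain M d where Md: "Metric_space M d" "A = Metric_space.mtopology M d"
    using A unfolding metrizable_space_def by blast
  interpret Metric_space M d by (rule Md(1))
  have topA: "topspace A = M"
    by (simp add: Md(2))
  have BM: "B \<subseteq> M"
    using closedin_subset[OF B] topA by simp
  define P where "P \<gamma> = {a \<in> topspace A. \<iota> a = \<gamma>}" for \<gamma>
  have Ptop: "topspace (subtopology A (P \<gamma>)) = P \<gamma>" for \<gamma>
    by (auto simp: P_def)
  have PM: "a \<in> M" if "a \<in> P \<gamma>" for a \<gamma>
    using that by (simp add: P_def topA)
  have in_P: "a \<in> P (\<iota> a)" "\<iota> a \<in> ?K" if "a \<in> M" for a
    using that range by (simp_all add: P_def topA)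
  have P_empty: "P \<gamma> = {}" if "\<gamma> \<notin> ?K" for \<gamma>
    using that range by (auto simp: P_def)
  have fX: "f a \<in> ?X" if "a \<in> M" for a
  proof -
    have "f \<in> topspace A \<rightarrow> ?X"
      using f unfolding continuous_map_in_subtopology by (rule conjunct2)
    then show ?thesis
      using that topA by blast
  qed
  have fe: "continuous_map A euclidean f"
    using f unfolding continuous_map_in_subtopology by (rule conjunct1)
  have f1: "continuous_map A euclidean (\<lambda>a. fst (f a))"
    by (rule continuous_map_to_euclidean_compose[OF f]) (intro continuous_intros)
  have f2: "continuous_map A (top_of_set \<Omega>) (\<lambda>a. snd (f a))"
    by (rule continuous_map_compose_on[OF f]) (auto intro!: continuous_intros)
  have Btop: "topspace (subtopology A B) = B"
    using BM topA by auto
  have fB': "continuous_map (subtopology A B) (top_of_set ?X) f" "closed_map (subtopology A B) (top_of_set ?X) f"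
    "inj_on f (topspace (subtopology A B))"
    using fB unfolding Z_embedding_iff by blast+
  have injB: "inj_on f B"
    using fB'(3) unfolding Btop .

  obtain e0 where e0: "contraction_on ?X e0" "\<And>x. x \<in> ?X \<Longrightarrow> 0 < e0 x \<and> e0 x \<le> 1"
    "\<And>x y. x \<in> ?X \<Longrightarrow> y \<in> ?X \<Longrightarrow> dist x y < e0 x \<Longrightarrow> \<exists>U\<in>\<U>. x \<in> U \<and> y \<in> U"
    using \<U> by (rule open_cover_radius) blast
  have e0': "0 < e0 x" if "x \<in> ?X" for x
    using e0(2)[OF that] by simp
  \<comment> \<open>Bumps about the images of the pieces of \<open>B\<close>.\<close>
  define F where "F \<gamma> = f ` {a \<in> topspace (subtopology A B). \<iota> a = \<gamma>}" for \<gamma>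
  have F_in: "f a \<in> F \<gamma>" if "a \<in> B" "a \<in> P \<gamma>" for a \<gamma>
    using that unfolding F_def Btop P_def by blast
  have "openin (subtopology A B) {a \<in> topspace (subtopology A B). \<iota> a = \<gamma>}" for \<gamma>
  proof -
    have "{a \<in> topspace (subtopology A B). \<iota> a = \<gamma>} = {a \<in> topspace A. \<iota> a = \<gamma>} \<inter> B"
      by auto
    then show ?thesis
      using open_piece[of \<gamma>] by (simp only: openin_subtopology_Int)
  qed
  then have "discrete_family ?X F"
    unfolding F_def using discrete_family_image[OF fB'(2,3)] by blast
  then obtain e b where e: "contraction_on ?X e" "\<And>x. x \<in> ?X \<Longrightarrow> 0 < e x \<and> e x \<le> 1 \<and> e x \<le> e0 x"
    and b: "\<And>\<gamma>. continuous_on ?X (b \<gamma>)"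
    "\<And>x \<gamma>. x \<in> ?X \<Longrightarrow> 0 \<le> b \<gamma> x \<and> b \<gamma> x \<le> e x / 2"
    "\<And>x. x \<in> ?X \<Longrightarrow> \<exists>r>0. \<exists>\<gamma>\<^sub>0. \<forall>y\<in>?X. dist x y < r \<longrightarrow> (\<forall>\<gamma>. b \<gamma> y \<noteq> 0 \<longrightarrow> \<gamma> = \<gamma>\<^sub>0)"
    "\<And>x \<gamma> y. x \<in> ?X \<Longrightarrow> y \<in> F \<gamma> \<Longrightarrow> dist x y < e x \<Longrightarrow> 0 < b \<gamma> x"
    using discrete_bumps[OF _ e0(1) e0'] by blast
  have ce: "continuous_on ?X e"
    by (rule contraction_on_continuous[OF e(1)])

  \<comment> \<open>The control function \<open>s\<close>: it vanishes exactly on \<open>B\<close>, and \<open>3 * s\<close> stays below \<open>e\<close>.\<close>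
  obtain \<rho> where \<rho>: "continuous_map A euclideanreal \<rho>"
    "\<And>a. a \<in> M \<Longrightarrow> 0 \<le> \<rho> a \<and> \<rho> a \<le> 1" "\<And>a. a \<in> M \<Longrightarrow> \<rho> a = 0 \<longleftrightarrow> a \<in> B"
    "\<And>a e. a \<in> M \<Longrightarrow> \<rho> a < e \<Longrightarrow> e \<le> 1 \<Longrightarrow> \<exists>b\<in>B. d a b < e \<and> dist (f a) (f b) < e"
    using graph_distance[OF Md(1), folded Md(2), OF fe B] by blast
  define s where "s a = min (\<rho> a) (e (f a) / 4)" for a
  have cs: "continuous_map A euclideanreal s"
    unfolding s_def
    by (intro continuous_map_real_min \<rho>(1) continuous_map_to_euclidean_compose[OF f] continuous_intros ce) auto
  have s: "0 \<le> s a" "s a \<le> 1" "s a = 0 \<longleftrightarrow> a \<in> B" "3 * s a < e (f a)" if "a \<in> M" for a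
    using \<rho>(2,3)[OF that] e(2)[OF fX[OF that]] by (auto simp: s_def min_def)

  have density_P: "density_le (subtopology A (P \<gamma>)) \<kappa>'" if g: "\<gamma> \<in> ?K" for \<gamma>
  proof -
    obtain Y where "Y \<in> D" "subtopology A (P \<gamma>) homeomorphic_space Y"
      using piece[OF g] unfolding in_class_def P_def by blast
    then show ?thesis
      using density_le_homeomorphic density homeomorphic_space_sym by metis
  qed
  have small: "|\<Union>a\<in>P \<gamma>. supp (u a)| \<le>o \<kappa>'"
    if u: "continuous_map A euclidean u" "\<And>a. a \<in> M \<Longrightarrow> finite (supp (u a))" for \<gamma> and u :: "'a \<Rightarrow> 'k sqsum"
  proof (cases "\<gamma> \<in> ?K")
    case True
    then show ?thesis
      using small_support[OF continuous_map_from_subtopology[OF u(1)] density_P[OF True] \<kappa>(2,3)] u(2) PM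
      unfolding Ptop by blast
  next
    case False
    then show ?thesis
      unfolding P_empty[OF False] using countable_ordLeq[OF _ \<kappa>(3), of "{}"] by simp
  qed
  have fresh: "\<exists>\<pi> :: nat \<Rightarrow> 'k. inj \<pi> \<and> range \<pi> \<subseteq> ?K - J" if "|J| \<le>o \<kappa>'" for J
    using infinite_countable_subset[OF infinite_Diff_small[OF \<kappa>(1,4,3) that]] by blast

  \<comment> \<open>First component, stage one: the index \<open>\<theta>2 \<gamma> \<delta>\<close>, new for both pieces, is used where the bump about \<open>f (B \<inter> P \<delta>)\<close> is active.\<close>
  define J0 where "J0 \<gamma> = (\<Union>a\<in>P \<gamma>. supp (fst (f a)))" for \<gamma>
  have J0: "|J0 \<gamma>| \<le>o \<kappa>'" for \<gamma>
    unfolding J0_def by (rule small[OF f1]) (use fX in \<open>auto simp: fin_sqsum_def mem_Times_iff\<close>)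
  have "\<exists>i. i \<in> ?K - (J0 \<gamma> \<union> J0 \<delta>)" for \<gamma> \<delta>
  proof -
    have "|J0 \<gamma> \<union> J0 \<delta>| \<le>o \<kappa>'"
      by (intro card_of_Un_ordLeq_infinite_Field infinite_Field_if_natLeq J0 \<kappa>)
    then obtain \<pi> :: "nat \<Rightarrow> 'k" where "range \<pi> \<subseteq> ?K - (J0 \<gamma> \<union> J0 \<delta>)"
      using fresh by blast
    then show ?thesis by blast
  qed
  then obtain \<theta>2 where \<theta>2: "\<And>\<gamma> \<delta>. \<theta>2 \<gamma> \<delta> \<in> ?K - (J0 \<gamma> \<union> J0 \<delta>)"
    by metis
  define u where "u \<gamma> \<delta> x = (basis_vec (\<theta>2 \<gamma> \<delta>) :: 'k sqsum)" for \<gamma> \<delta> and x :: "'k sqsum \<times> 'b"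
  have cglue: "continuous_on ?X (glue b (u \<gamma>))" for \<gamma>
    by (rule continuous_on_glue[OF b(1) _ b(3)]) (auto simp: u_def)
  have single: "\<exists>\<delta>. (\<forall>\<gamma>. glue b (u \<gamma>) x = b \<delta> x *\<^sub>R basis_vec (\<theta>2 \<gamma> \<delta>)) \<and> (\<forall>\<delta>'. b \<delta>' x \<noteq> 0 \<longrightarrow> \<delta>' = \<delta>)"
    if x: "x \<in> ?X" for x
  proof -
    obtain r \<delta> where r: "r > 0" "\<forall>y\<in>?X. dist x y < r \<longrightarrow> (\<forall>\<gamma>. b \<gamma> y \<noteq> 0 \<longrightarrow> \<gamma> = \<delta>)"
      using b(3)[OF x] by blast
    have un: "\<delta>' = \<delta>" if "b \<delta>' x \<noteq> 0" for \<delta>'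
      using r x that by (simp only: dist_self)
    have "glue b (u \<gamma>) x = b \<delta> x *\<^sub>R basis_vec (\<theta>2 \<gamma> \<delta>)" for \<gamma>
      using glue_eq[of b x \<delta> "u \<gamma>", OF un] by (simp add: u_def)
    then show ?thesis
      using un by blast
  qed
  define p where "p a = fst (f a) + s a *\<^sub>R glue b (u (\<iota> a)) (f a)" for a
  have pf: "continuous_map A (top_of_set (?X \<times> UNIV)) (\<lambda>a. (f a, s a))"
    using f cs by (intro continuous_map_top_of_set_Pair) simp_all
  have cp: "continuous_map A euclidean p"
  proof (rule continuous_map_pieces[OF open_piece])
    fix \<gamma>
    let ?P = "{a \<in> topspace A. \<iota> a = \<gamma>}"
    have "continuous_on (?X \<times> UNIV) (\<lambda>q. fst (fst q) + snd q *\<^sub>R glue b (u \<gamma>) (fst q))"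
      by (intro continuous_intros continuous_on_compose2[OF cglue]) auto
    then have "continuous_map (subtopology A ?P) euclidean (\<lambda>a. fst (fst (f a, s a)) + snd (f a, s a) *\<^sub>R glue b (u \<gamma>) (fst (f a, s a)))"
      by (rule continuous_map_to_euclidean_compose[OF continuous_map_from_subtopology[OF pf]])
    then show "continuous_map (subtopology A ?P) euclidean p"
      by (rule continuous_map_eq) (auto simp: p_def)
  qed
  have p_fin: "p a \<in> fin_sqsum ?K" if a: "a \<in> M" for a
  proof -
    obtain \<delta> where "\<forall>\<gamma>. glue b (u \<gamma>) (f a) = b \<delta> (f a) *\<^sub>R basis_vec (\<theta>2 \<gamma> \<delta>)"
      using single[OF fX[OF a]] by blast
    moreover have "\<theta>2 (\<iota> a) \<delta> \<in> ?K"
      using \<theta>2 by blast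
    ultimately show ?thesis
      unfolding p_def using fX[OF a]
      by (auto intro!: fin_sqsum_add fin_sqsum_scaleR fin_sqsum_basis_vec)
  qed
  \<comment> \<open>Stage two: the index \<open>\<theta> \<gamma>\<close> is new for stage one on the piece \<open>\<gamma>\<close> and for all that earlier pieces use, and it records \<open>s\<close>.\<close>
  define J1 where "J1 \<gamma> = (\<Union>a\<in>P \<gamma>. supp (p a))" for \<gamma>
  have J1: "|J1 \<gamma>| \<le>o \<kappa>'" for \<gamma>
    unfolding J1_def by (rule small[OF cp]) (use p_fin in \<open>auto simp: fin_sqsum_def\<close>)
  obtain \<theta> where \<theta>: "\<And>\<gamma>. \<gamma> \<in> ?K \<Longrightarrow> \<theta> \<gamma> \<in> ?K \<and> \<theta> \<gamma> \<notin> J1 \<gamma>"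
    "\<And>\<gamma> \<delta>. \<gamma> \<in> ?K \<Longrightarrow> \<delta> \<in> underS \<kappa> \<gamma> \<Longrightarrow> \<theta> \<gamma> \<notin> J1 \<delta> \<and> \<theta> \<gamma> \<noteq> \<theta> \<delta>"
    by (rule fresh_coordinates[where J = J1, OF \<kappa>(1,2,4,3) J1]) blast
  define g1 where "g1 a = p a + s a *\<^sub>R basis_vec (\<theta> (\<iota> a))" for a
  have cg1: "continuous_map A euclidean g1"
  proof (rule continuous_map_pieces[OF open_piece])
    fix \<gamma>
    let ?P = "{a \<in> topspace A. \<iota> a = \<gamma>}"
    have "continuous_map A (top_of_set (UNIV \<times> UNIV)) (\<lambda>a. (p a, s a))"
      using cp cs by (intro continuous_map_top_of_set_Pair) simp_all
    then have "continuous_map (subtopology A ?P) euclidean (\<lambda>a. fst (p a, s a) + snd (p a, s a) *\<^sub>R basis_vec (\<theta> \<gamma>))"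
      by (intro continuous_map_to_euclidean_compose[where \<phi> = "\<lambda>q. fst q + snd q *\<^sub>R basis_vec (\<theta> \<gamma>)"]
          continuous_map_from_subtopology continuous_intros)
    then show "continuous_map (subtopology A ?P) euclidean g1"
      by (rule continuous_map_eq) (auto simp: g1_def)
  qed
  have g1_fin: "g1 a \<in> fin_sqsum ?K" if a: "a \<in> M" for a
    unfolding g1_def using p_fin[OF a] \<theta>(1)[OF in_P(2)[OF a]]
    by (intro fin_sqsum_add fin_sqsum_scaleR fin_sqsum_basis_vec) auto

  \<comment> \<open>Second component: the fan of each piece, evaluated at time \<open>s\<close>.\<close>
  define Fan where "Fan \<gamma> G \<longleftrightarrow>
      continuous_map (prod_topology (subtopology A (P \<gamma>)) (top_of_set {0..1::real})) (top_of_set \<Omega>) G \<and>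
      (\<forall>a\<in>P \<gamma>. G (a, 0) = snd (f a)) \<and>
      (\<forall>a\<in>P \<gamma>. \<forall>t. 0 \<le> t \<and> t \<le> 1 \<longrightarrow> dist (G (a, t)) (snd (f a)) \<le> t) \<and>
      (\<forall>a\<in>P \<gamma>. \<forall>b\<in>P \<gamma>. \<forall>t. 0 < t \<and> t \<le> 1 \<and> G (a, t) = G (b, t) \<longrightarrow> a = b) \<and>
      (\<forall>a t t0 y. (\<forall>n::nat. a n \<in> P \<gamma>) \<and> (\<forall>n. 0 < t n \<and> t n \<le> 1) \<and> t \<longlonglongrightarrow> t0 \<and> 0 < t0 \<and>
        (\<lambda>n. G (a n, t n)) \<longlonglongrightarrow> y \<and> y \<in> \<Omega> \<longrightarrow>
        (\<exists>r a0. strict_mono (r :: nat \<Rightarrow> nat) \<and> limitin (subtopology A (P \<gamma>)) (a \<circ> r) a0 sequentially))"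
    for \<gamma> and G :: "'a \<times> real \<Rightarrow> 'b"
  have "\<exists>G. Fan \<gamma> G" if g: "\<gamma> \<in> ?K" for \<gamma>
  proof (rule embedding_fan[OF V dense su piece[OF g, folded P_def] continuous_map_from_subtopology[OF f2], unfolded Ptop])
    fix G
    assume G: "continuous_map (prod_topology (subtopology A (P \<gamma>)) (top_of_set {0..1::real})) (top_of_set \<Omega>) G"
      "\<And>a. a \<in> P \<gamma> \<Longrightarrow> G (a, 0) = snd (f a)"
      "\<And>a t. a \<in> P \<gamma> \<Longrightarrow> 0 \<le> t \<Longrightarrow> t \<le> 1 \<Longrightarrow> dist (G (a, t)) (snd (f a)) \<le> t"
      "\<And>a b t. a \<in> P \<gamma> \<Longrightarrow> b \<in> P \<gamma> \<Longrightarrow> 0 < t \<Longrightarrow> t \<le> 1 \<Longrightarrow> G (a, t) = G (b, t) \<Longrightarrow> a = b"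
      "\<And>a t t0 y. (\<And>n::nat. a n \<in> P \<gamma>) \<Longrightarrow> (\<And>n. 0 < t n \<and> t n \<le> 1) \<Longrightarrow> t \<longlonglongrightarrow> t0 \<Longrightarrow> 0 < t0 \<Longrightarrow>
        (\<lambda>n. G (a n, t n)) \<longlonglongrightarrow> y \<Longrightarrow> y \<in> \<Omega> \<Longrightarrow>
        \<exists>r a0. strict_mono (r :: nat \<Rightarrow> nat) \<and> limitin (subtopology A (P \<gamma>)) (a \<circ> r) a0 sequentially"
    have "Fan \<gamma> G"
      unfolding Fan_def
    proof (intro conjI G(1) ballI allI impI)
      fix a t t0 y
      assume *: "(\<forall>n::nat. a n \<in> P \<gamma>) \<and> (\<forall>n. 0 < t n \<and> t n \<le> 1) \<and> t \<longlonglongrightarrow> t0 \<and> 0 < t0 \<and>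
        (\<lambda>n. G (a n, t n)) \<longlonglongrightarrow> y \<and> y \<in> \<Omega>"
      show "\<exists>r a0. strict_mono (r :: nat \<Rightarrow> nat) \<and> limitin (subtopology A (P \<gamma>)) (a \<circ> r) a0 sequentially"
        by (rule G(5)[of a t t0 y]) (use * in blast)+
    qed (use G(2,3,4) in blast)+
    then show "\<exists>G. Fan \<gamma> G"
      by (rule exI[where P = "Fan \<gamma>"])
  qed
  then obtain G where "\<And>\<gamma>. \<gamma> \<in> ?K \<Longrightarrow> Fan \<gamma> (G \<gamma>)"
    by metis
  note G = this[unfolded Fan_def]
  define g2 where "g2 a = G (\<iota> a) (a, s a)" for a
  have cg2: "continuous_map A (top_of_set \<Omega>) g2"
  proof (rule continuous_map_pieces[OF open_piece])
    fix \<gamma>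
    show "continuous_map (subtopology A {a \<in> topspace A. \<iota> a = \<gamma>}) (top_of_set \<Omega>) g2"
      unfolding P_def[symmetric]
    proof (cases "\<gamma> \<in> ?K")
      case True
      have "continuous_map (subtopology A (P \<gamma>)) (top_of_set {0..1}) s"
        unfolding continuous_map_in_subtopology
        using continuous_map_from_subtopology[OF cs] s(1,2) PM unfolding Ptop by auto
      then have "continuous_map (subtopology A (P \<gamma>)) (prod_topology (subtopology A (P \<gamma>)) (top_of_set {0..1})) (\<lambda>a. (a, s a))"
        by (intro continuous_map_pairedI) auto
      moreover have "continuous_map (prod_topology (subtopology A (P \<gamma>)) (top_of_set {0..1})) (top_of_set \<Omega>) (G \<gamma>)"
        using G[OF True] by (rule conjunct1)
      ultimately have "continuous_map (subtopology A (P \<gamma>)) (top_of_set \<Omega>) (G \<gamma> \<circ> (\<lambda>a. (a, s a)))"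
        by (rule continuous_map_compose)
      then show "continuous_map (subtopology A (P \<gamma>)) (top_of_set \<Omega>) g2"
        by (rule continuous_map_eq) (auto simp: P_def g2_def)
    next
      case False
      show "continuous_map (subtopology A (P \<gamma>)) (top_of_set \<Omega>) g2"
        unfolding P_empty[OF False] by simp
    qed
  qed
  define g where "g a = (g1 a, g2 a)" for a
  have cg: "continuous_map A (top_of_set ?X) g"
    unfolding g_def
  proof (rule continuous_map_top_of_set_Pair[OF _ cg2])
    show "continuous_map A (top_of_set (fin_sqsum ?K)) g1"
      using cg1 g1_fin by (auto simp: continuous_map_in_subtopology topA)
  qed
  have gX: "g a \<in> ?X" if "a \<in> M" for a
  proof -
    have "g \<in> topspace A \<rightarrow> ?X"
      using cg unfolding continuous_map_in_subtopology by (rule conjunct2)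
    then show ?thesis
      using that topA by blast
  qed
  have g_B: "g a = f a" if a: "a \<in> B" for a
  proof -
    have aM: "a \<in> M"
      using a BM by blast
    have "s a = 0"
      using s(3)[OF aM] a by simp
    moreover have "G (\<iota> a) (a, 0) = snd (f a)"
      using G[OF in_P(2)[OF aM]] in_P(1)[OF aM] by blast
    ultimately show ?thesis
      by (simp add: g_def g1_def g2_def p_def)
  qed
  have near: "dist (g a) (f a) \<le> 3 * s a" if a: "a \<in> M" for a
  proof -
    obtain \<delta> where \<delta>: "\<forall>\<gamma>. glue b (u \<gamma>) (f a) = b \<delta> (f a) *\<^sub>R basis_vec (\<theta>2 \<gamma> \<delta>)"
      using single[OF fX[OF a]] by blast
    have b1: "0 \<le> b \<delta> (f a)" "b \<delta> (f a) \<le> 1"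
      using b(2)[OF fX[OF a], of \<delta>] e(2)[OF fX[OF a]] by auto
    have "norm (g1 a - fst (f a)) = norm ((s a * b \<delta> (f a)) *\<^sub>R basis_vec (\<theta>2 (\<iota> a) \<delta>) + s a *\<^sub>R basis_vec (\<theta> (\<iota> a)))"
      using \<delta> by (simp add: g1_def p_def)
    also have "\<dots> \<le> norm ((s a * b \<delta> (f a)) *\<^sub>R basis_vec (\<theta>2 (\<iota> a) \<delta>)) + norm (s a *\<^sub>R basis_vec (\<theta> (\<iota> a)))"
      by (rule norm_triangle_ineq)
    also have "\<dots> \<le> s a + s a"
      using s(1)[OF a] b1 by (simp add: abs_mult mult_left_le)
    finally have 1: "dist (g1 a) (fst (f a)) \<le> 2 * s a"
      by (simp add: dist_norm)
    have 2: "dist (g2 a) (snd (f a)) \<le> s a"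
      unfolding g2_def using G[OF in_P(2)[OF a]] in_P(1)[OF a] s(1,2)[OF a] by blast
    have "dist (g a) (f a) \<le> dist (g1 a) (fst (f a)) + dist (g2 a) (snd (f a))"
      unfolding dist_prod_def g_def fst_conv snd_conv by (rule sqrt_sum_squares_le_sum) auto
    then show ?thesis
      using 1 2 by linarith
  qed
  have near_e: "dist (f a) (g a) < e (f a)" if a: "a \<in> M" for a
    using near[OF a] s(4)[OF a] by (simp add: dist_commute)
  have coord_own: "coord (g1 a) (\<theta> (\<iota> a)) = s a" if a: "a \<in> M" for a
  proof -
    have "\<theta> (\<iota> a) \<notin> supp (p a)"
      using \<theta>(1)[OF in_P(2)[OF a]] in_P(1)[OF a] unfolding J1_def by blast
    then show ?thesis
      by (simp add: g1_def supp_def)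
  qed
  have coord_other: "coord (g1 c) (\<theta> (\<iota> a)) = 0" if a: "a \<in> M" and c: "c \<in> M" and lt: "\<iota> c \<in> underS \<kappa> (\<iota> a)" for a c
  proof -
    have "\<theta> (\<iota> a) \<notin> supp (p c)" "\<theta> (\<iota> a) \<noteq> \<theta> (\<iota> c)"
      using \<theta>(2)[OF in_P(2)[OF a] lt] in_P(1)[OF c] unfolding J1_def by blast+
    then show ?thesis
      by (simp add: g1_def supp_def)
  qed
  have sep: "s a \<le> dist (g a) (g c)" if a: "a \<in> M" and c: "c \<in> M" and lt: "\<iota> c \<in> underS \<kappa> (\<iota> a)" for a c
  proof -
    have "\<bar>coord (g1 a) (\<theta> (\<iota> a)) - coord (g1 c) (\<theta> (\<iota> a))\<bar> \<le> dist (g1 a) (g1 c)"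
      by (rule abs_coord_diff_le_dist)
    also have "\<dots> \<le> dist (g a) (g c)"
      using dist_fst_le[of "g a" "g c"] by (simp add: g_def)
    finally show ?thesis
      using coord_own[OF a] coord_other[OF a c lt] by simp
  qed
  \<comment> \<open>If the images of two pieces met, the point \<open>a\<close> of the later one would lie in \<open>B\<close>, and the bump about \<open>f (B \<inter> P (\<iota> a))\<close> would make a coordinate of \<open>g c\<close> positive that is zero for \<open>f a\<close>.\<close>
  have inj_lt: False if a: "a \<in> M" and c: "c \<in> M" and lt: "\<iota> c \<in> underS \<kappa> (\<iota> a)" and eq: "g a = g c" for a c
  proof -
    have "s a = 0"
      using sep[OF a c lt] s(1)[OF a] eq by simp
    then have aB: "a \<in> B"
      using s(3)[OF a] by simp
    have ga: "g a = f a"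
      by (rule g_B[OF aB])
    have ne: "\<iota> c \<noteq> \<iota> a"
      using lt by (auto simp: underS_def)
    have cB: "c \<notin> B"
    proof
      assume "c \<in> B"
      then have "f a = f c"
        using g_B ga eq by simp
      then have "a = c"
        using injB aB \<open>c \<in> B\<close> by (auto dest: inj_onD)
      then show False
        using ne by simp
    qed
    then have sc: "0 < s c"
      using s(1,3)[OF c] by fastforce
    have "dist (f c) (f a) < e (f c)"
      using near_e[OF c] eq ga by simp
    then have bpos: "0 < b (\<iota> a) (f c)"
      using b(4)[OF fX[OF c] F_in[OF aB in_P(1)[OF a]]] by blast
    obtain \<delta> where \<delta>: "\<forall>\<gamma>. glue b (u \<gamma>) (f c) = b \<delta> (f c) *\<^sub>R basis_vec (\<theta>2 \<gamma> \<delta>)" "\<forall>\<delta>'. b \<delta>' (f c) \<noteq> 0 \<longrightarrow> \<delta>' = \<delta>"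
      using single[OF fX[OF c]] by blast
    then have \<delta>a: "\<delta> = \<iota> a"
      using bpos by (metis less_irrefl)
    let ?i = "\<theta>2 (\<iota> c) (\<iota> a)"
    have "?i \<notin> J0 (\<iota> c)" "?i \<notin> J0 (\<iota> a)"
      using \<theta>2 by blast+
    then have "coord (fst (f c)) ?i = 0" "coord (fst (f a)) ?i = 0"
      using in_P(1)[OF c] in_P(1)[OF a] unfolding J0_def supp_def by blast+
    moreover have "coord (g1 c) ?i = coord (fst (f c)) ?i + s c * b (\<iota> a) (f c) + s c * (if ?i = \<theta> (\<iota> c) then 1 else 0)"
      using \<delta>(1) \<delta>a by (simp add: g1_def p_def)
    moreover have "0 < s c * b (\<iota> a) (f c)"
      using sc bpos by simp
    moreover have "g1 c = fst (f a)"
      using eq ga by (simp add: g_def prod_eq_iff)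
    ultimately show False
      using sc by (auto split: if_splits)
  qed
  have inj: "inj_on g M"
  proof (rule inj_onI)
    fix a c assume a: "a \<in> M" and c: "c \<in> M" and eq: "g a = g c"
    show "a = c"
    proof (cases "\<iota> a = \<iota> c")
      case True
      have "s a = s c"
        using coord_own[OF a] coord_own[OF c] eq True by (simp add: g_def)
      show ?thesis
      proof (cases "s a = 0")
        case True
        then have "a \<in> B" "c \<in> B"
          using s(3)[OF a] s(3)[OF c] \<open>s a = s c\<close> by simp_all
        then show ?thesis
          using eq g_B injB by (auto dest: inj_onD)
      next
        case False
        then have "0 < s a"
          using s(1)[OF a] by simp
        moreover have "G (\<iota> a) (a, s a) = G (\<iota> a) (c, s a)"
          using eq True \<open>s a = s c\<close> by (simp add: g_def g2_def)
        moreover have "c \<in> P (\<iota> a)"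
          using in_P(1)[OF c] True by simp
        ultimately show ?thesis
          using G[OF in_P(2)[OF a]] in_P(1)[OF a] s(2)[OF a] by blast
      qed
    next
      case False
      then show ?thesis
        using underS_total[OF \<kappa>(1) in_P(2)[OF a] in_P(2)[OF c]] inj_lt[OF a c _ eq] inj_lt[OF c a _ eq[symmetric]] by blast
    qed
  qed
  have proper: "\<exists>r a0. strict_mono (r :: nat \<Rightarrow> nat) \<and> limitin A (a \<circ> r) a0 sequentially"
    if a: "\<And>n::nat. a n \<in> topspace A" and lim: "(\<lambda>n. g (a n)) \<longlonglongrightarrow> x" and x: "x \<in> ?X" for a x
  proof -
    have aM: "a n \<in> M" for n
      using a[of n] topA by simp
    have "\<exists>l\<in>{0..1}. \<exists>r. strict_mono (r :: nat \<Rightarrow> nat) \<and> ((\<lambda>n. s (a n)) \<circ> r) \<longlonglongrightarrow> l"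
    proof -
      have "\<forall>n. s (a n) \<in> {0..1}"
        using s(1,2)[OF aM] by simp
      then show ?thesis
        by (rule compact_Icc[unfolded compact_def, THEN spec, THEN mp])
    qed
    then obtain s0 r where r: "strict_mono (r :: nat \<Rightarrow> nat)" and s0: "(\<lambda>n. s (a (r n))) \<longlonglongrightarrow> s0" "0 \<le> s0"
      unfolding o_def by auto
    define c where "c n = a (r n)" for n
    have cM: "c n \<in> M" for n
      using aM by (simp add: c_def)
    have sc: "(\<lambda>n. s (c n)) \<longlonglongrightarrow> s0"
      using s0(1) by (simp add: c_def)
    have gc: "(\<lambda>n. g (c n)) \<longlonglongrightarrow> x"
      using LIMSEQ_subseq_LIMSEQ[OF lim r] by (simp add: o_def c_def)
    have "\<exists>N a0 r'. strict_mono (r' :: nat \<Rightarrow> nat) \<and> limitin A (\<lambda>n. c (r' n + N)) a0 sequentially"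
    proof (cases "s0 = 0")
      case True
      have s3: "(\<lambda>n. 3 * s (c n)) \<longlonglongrightarrow> 0"
        using tendsto_mult_right_zero[OF sc[unfolded True], of 3] by simp
      have gf0: "(\<lambda>n. dist (g (c n)) (f (c n))) \<longlonglongrightarrow> 0"
        by (rule real_tendsto_sandwich[OF _ _ tendsto_const s3]) (use near[OF cM] in auto)
      have fc: "(\<lambda>n. f (c n)) \<longlonglongrightarrow> x"
        by (rule tendsto_if_dist_tendsto_0[OF gc gf0])
      have ec: "(\<lambda>n. e (f (c n))) \<longlonglongrightarrow> e x"
        by (rule continuous_on_tendsto_compose[OF ce fc x]) (use fX cM in auto)
      have epos: "0 < e x"
        using e(2)[OF x] by simp
      have ev: "eventually (\<lambda>n. e x / 2 < e (f (c n)) \<and> s (c n) < e x / 8) sequentially"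
        using order_tendstoD(1)[OF ec, of "e x / 2"] order_tendstoD(2)[OF sc[unfolded True], of "e x / 8"] epos
        by (intro eventually_conj) simp_all
      then obtain N where N: "\<And>n. n \<ge> N \<Longrightarrow> e x / 2 < e (f (c n)) \<and> s (c n) < e x / 8"
        unfolding eventually_sequentially by blast
      define tol where "tol n = s (c (n + N)) + 1 / (real n + 2)" for n
      have "\<exists>b'\<in>B. d (c (n + N)) b' < tol n \<and> dist (f (c (n + N))) (f b') < tol n" for n
      proof (rule \<rho>(4)[OF cM])
        have lt: "e x / 2 < e (f (c (n + N)))" "s (c (n + N)) < e x / 8"
          using N[of "n + N"] by auto
        then have "s (c (n + N)) = \<rho> (c (n + N))"
          by (simp add: s_def min_def split: if_splits)
        then show "\<rho> (c (n + N)) < tol n"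
          by (simp add: tol_def)
        have "1 / (real n + 2) \<le> 1 / 2"
          by (intro divide_left_mono) auto
        moreover have "e x \<le> 1"
          using e(2)[OF x] by simp
        ultimately show "tol n \<le> 1"
          using lt(2) unfolding tol_def by linarith
      qed
      then obtain b' where b': "\<And>n. b' n \<in> B" "\<And>n. d (c (n + N)) (b' n) < tol n"
        "\<And>n. dist (f (c (n + N))) (f (b' n)) < tol n"
        by metis
      have "(\<lambda>n. 1 / (real n + 2)) \<longlonglongrightarrow> 0"
        using LIMSEQ_ignore_initial_segment[OF lim_1_over_n, of 2] by (simp add: add.commute)
      then have tol: "tol \<longlonglongrightarrow> 0"
        unfolding tol_def using tendsto_add[OF LIMSEQ_ignore_initial_segment[OF sc[unfolded True], of N], of _ 0] by simp
      have fb0: "(\<lambda>n. dist (f (c (n + N))) (f (b' n))) \<longlonglongrightarrow> 0"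
        by (rule real_tendsto_sandwich[OF _ _ tendsto_const tol]) (use b'(3)[THEN less_imp_le] in auto)
      have fb: "(\<lambda>n. f (b' n)) \<longlonglongrightarrow> x"
        by (rule tendsto_if_dist_tendsto_0[OF LIMSEQ_ignore_initial_segment[OF fc] fb0])
      have "b' n \<in> topspace (subtopology A B)" for n
        unfolding Btop by (rule b'(1))
      then obtain b0 where "limitin (subtopology A B) b' b0 sequentially"
        using closed_embedding_limit[OF fB' _ fb x] by blast
      then have "limitin mtopology b' b0 sequentially"
        unfolding limitin_subtopology Md(2) by blast
      then have b0: "b0 \<in> M" "(\<lambda>n. d (b' n) b0) \<longlonglongrightarrow> 0"
        unfolding limitin_metric_dist_null by blast+
      have up: "(\<lambda>n. tol n + d (b' n) b0) \<longlonglongrightarrow> 0"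
        using tendsto_add[OF tol b0(2)] by simp
      have "d (c (n + N)) b0 \<le> tol n + d (b' n) b0" for n
        using triangle[of "c (n + N)" "b' n" b0] b'(1,2)[of n] BM cM[of "n + N"] b0(1) by fastforce
      then have "(\<lambda>n. d (c (n + N)) b0) \<longlonglongrightarrow> 0"
        by (intro real_tendsto_sandwich[OF _ _ tendsto_const up]) auto
      then have "limitin A (\<lambda>n. c (id n + N)) b0 sequentially"
        unfolding Md(2) limitin_metric_dist_null using cM b0(1) by simp
      moreover have "strict_mono (id :: nat \<Rightarrow> nat)"
        by (simp add: strict_mono_def)
      ultimately show ?thesis
        by blast
    next
      case False
      then have s0p: "0 < s0"
        using s0(2) by simp
      have ev: "eventually (\<lambda>n. s0 / 2 < s (c n)) sequentially"
        using order_tendstoD(1)[OF sc, of "s0 / 2"] s0p by simp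
      then obtain N1 where N1: "\<And>n. n \<ge> N1 \<Longrightarrow> s0 / 2 < s (c n)"
        unfolding eventually_sequentially by blast
      have "Cauchy (\<lambda>n. g (c n))"
        using gc by (rule LIMSEQ_imp_Cauchy)
      then obtain N2 where N2: "\<And>m n. m \<ge> N2 \<Longrightarrow> n \<ge> N2 \<Longrightarrow> dist (g (c m)) (g (c n)) < s0 / 2"
        using s0p unfolding Cauchy_def by (meson half_gt_zero)
      define N where "N = max N1 N2"
      define \<gamma> where "\<gamma> = \<iota> (c N)"
      have \<gamma>K: "\<gamma> \<in> ?K"
        unfolding \<gamma>_def by (rule in_P(2)[OF cM])
      have big: "s0 / 2 < s (c (n + N))" for n
        by (rule N1) (simp add: N_def)
      have near2: "dist (g (c (m + N))) (g (c (n + N))) < s0 / 2" for m n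
        by (rule N2) (simp_all add: N_def)
      have not_lt: "\<iota> (c (n + N)) \<notin> underS \<kappa> (\<iota> (c (m + N)))" for m n
        using sep[OF cM cM, of "n + N" "m + N"] big[of m] near2[of m n] by fastforce
      have same: "\<iota> (c (n + N)) = \<gamma>" for n
        using underS_total[OF \<kappa>(1) in_P(2)[OF cM] in_P(2)[OF cM], of "n + N" "0 + N"] not_lt[of n 0] not_lt[of 0 n]
        unfolding \<gamma>_def by auto
      define a' where "a' n = c (n + N)" for n
      define t where "t n = s (a' n)" for n
      have a'P: "a' n \<in> P \<gamma>" for n
        using in_P(1)[OF cM, of "n + N"] same[of n] by (simp add: a'_def)
      have t: "0 < t n \<and> t n \<le> 1" for n
        using big[of n] s0p s(2)[OF cM, of "n + N"] unfolding t_def a'_def by linarith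
      have tl: "t \<longlonglongrightarrow> s0"
        unfolding t_def a'_def by (rule LIMSEQ_ignore_initial_segment[OF sc])
      have "(\<lambda>n. snd (g (a' n))) \<longlonglongrightarrow> snd x"
        unfolding a'_def by (intro tendsto_snd LIMSEQ_ignore_initial_segment[OF gc])
      moreover have "snd (g (a' n)) = G \<gamma> (a' n, t n)" for n
        using same[of n] by (simp add: g_def g2_def t_def a'_def)
      ultimately have Gl: "(\<lambda>n. G \<gamma> (a' n, t n)) \<longlonglongrightarrow> snd x"
        by simp
      have "snd x \<in> \<Omega>"
        using x by auto
      then have "\<exists>r a0. strict_mono (r :: nat \<Rightarrow> nat) \<and> limitin (subtopology A (P \<gamma>)) (a' \<circ> r) a0 sequentially"
        using G[OF \<gamma>K, THEN conjunct2, THEN conjunct2, THEN conjunct2, THEN conjunct2, rule_format, of a' t s0 "snd x"]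
          a'P t tl s0p Gl by blast
      then obtain r' a0 where r': "strict_mono (r' :: nat \<Rightarrow> nat)" "limitin (subtopology A (P \<gamma>)) (a' \<circ> r') a0 sequentially"
        by blast
      have "limitin A (a' \<circ> r') a0 sequentially"
        using r'(2) unfolding limitin_subtopology by blast
      then have "limitin A (\<lambda>n. c (r' n + N)) a0 sequentially"
        by (simp add: a'_def o_def)
      then show ?thesis
        using r'(1) by blast
    qed
    then obtain N a0 r' where r': "strict_mono (r' :: nat \<Rightarrow> nat)" "limitin A (\<lambda>n. c (r' n + N)) a0 sequentially"
      by blast
    have "strict_mono (\<lambda>n. r (r' n + N))"
      using r r'(1) by (simp add: strict_mono_def)
    moreover have "a \<circ> (\<lambda>n. r (r' n + N)) = (\<lambda>n. c (r' n + N))"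
      by (auto simp: c_def)
    ultimately show ?thesis
      using r'(2) by metis
  qed
  have cl: "closed_map A (top_of_set ?X) g"
    using cg proper by (rule closed_map_sequential)
  have "Z_set (top_of_set ?X) (g ` topspace A)"
  proof -
    define J2 where "J2 \<gamma> = (\<Union>a\<in>P \<gamma>. supp (g1 a))" for \<gamma>
    have J2: "|J2 \<gamma>| \<le>o \<kappa>'" for \<gamma>
      unfolding J2_def by (rule small[OF cg1]) (use g1_fin in \<open>auto simp: fin_sqsum_def\<close>)
    have "\<exists>\<pi> :: nat \<Rightarrow> 'k. inj \<pi> \<and> range \<pi> \<subseteq> ?K - J2 \<gamma>" for \<gamma>
      by (rule fresh[OF J2])
    then obtain \<pi> :: "'k \<Rightarrow> nat \<Rightarrow> 'k" where \<pi>: "\<And>\<gamma>. inj (\<pi> \<gamma>) \<and> range (\<pi> \<gamma>) \<subseteq> ?K - J2 \<gamma>"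
      by metis
    show ?thesis
    proof (rule Z_set_discrete_union[where F = "\<lambda>\<gamma>. g ` {a \<in> topspace A. \<iota> a = \<gamma>}" and \<pi> = \<pi>])
      show "closedin (top_of_set ?X) (g ` topspace A)"
        using cl by (simp add: closed_map_def)
      show "g ` topspace A \<subseteq> (\<Union>\<gamma>. g ` {a \<in> topspace A. \<iota> a = \<gamma>})"
        by blast
      show "discrete_family ?X (\<lambda>\<gamma>. g ` {a \<in> topspace A. \<iota> a = \<gamma>})"
        using discrete_family_image[OF cl _ open_piece] inj topA by simp
      show "inj (\<pi> \<gamma>)" "range (\<pi> \<gamma>) \<subseteq> ?K" for \<gamma>
        using \<pi>[of \<gamma>] by blast+
      fix \<gamma> q n assume "q \<in> g ` {a \<in> topspace A. \<iota> a = \<gamma>}"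
      then obtain a where "a \<in> P \<gamma>" "q = g a"
        unfolding P_def by blast
      moreover have "\<pi> \<gamma> n \<notin> J2 \<gamma>"
        using \<pi>[of \<gamma>] by blast
      ultimately show "coord (fst q) (\<pi> \<gamma> n) = 0"
        unfolding J2_def supp_def g_def by auto
    qed
  qed
  then have "Z_embedding A (top_of_set ?X) g"
    unfolding Z_embedding_iff using cg cl inj topA by simp
  moreover have "cover_close A \<U> g f"
    unfolding cover_close_def topA
  proof
    fix a assume a: "a \<in> M"
    have "dist (f a) (g a) < e0 (f a)"
      using near_e[OF a] e(2)[OF fX[OF a]] by linarith
    then show "\<exists>U\<in>\<U>. g a \<in> U \<and> f a \<in> U"
      using e0(3)[OF fX[OF a] gX[OF a]] by blast
  qed
  ultimately show ?thesis
    using g_B by blast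
qed

section \<open>Invariance under homeomorphisms\<close>

definition pullback_cover :: "'a topology \<Rightarrow> ('a \<Rightarrow> 'b) \<Rightarrow> 'b set set \<Rightarrow> 'a set set" where
  "pullback_cover X h \<U> = (\<lambda>U. {x \<in> topspace X. h x \<in> U}) ` \<U>"

lemma open_cover_pullback:
  assumes h: "continuous_map X Y h" and \<U>: "open_cover Y \<U>"
  shows "open_cover X (pullback_cover X h \<U>)"
  unfolding open_cover_def
proof (intro conjI ballI)
  fix V assume "V \<in> pullback_cover X h \<U>"
  then obtain U where U: "U \<in> \<U>" "V = {x \<in> topspace X. h x \<in> U}"
    unfolding pullback_cover_def by blast
  then have "openin Y U"
    using \<U> unfolding open_cover_def by blast
  then show "openin X V"
    unfolding U(2) by (rule openin_continuous_map_preimage[OF h])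
next
  have "\<exists>U\<in>\<U>. h x \<in> U" if "x \<in> topspace X" for x
  proof -
    have "h x \<in> topspace Y"
      using h that unfolding continuous_map_def by blast
    then show ?thesis
      using \<U> unfolding open_cover_def by blast
  qed
  then show "\<Union> (pullback_cover X h \<U>) = topspace X"
    unfolding pullback_cover_def by blast
qed

lemma homeomorphic_mapsD:
  assumes "homeomorphic_maps X Y h k"
  shows "continuous_map X Y h" "continuous_map Y X k"
    "x \<in> topspace X \<Longrightarrow> h x \<in> topspace Y" "x \<in> topspace X \<Longrightarrow> k (h x) = x"
    "y \<in> topspace Y \<Longrightarrow> k y \<in> topspace X" "y \<in> topspace Y \<Longrightarrow> h (k y) = y"
  using assms unfolding homeomorphic_maps_def continuous_map_def by blast+

lemma conjugate_map:
  assumes hom: "homeomorphic_maps X Y h k" and f: "continuous_map X X f"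
    and close: "cover_close X (pullback_cover X h \<U>) f id"
  shows "continuous_map Y Y (h \<circ> f \<circ> k)" "cover_close Y \<U> (h \<circ> f \<circ> k) id"
    "(h \<circ> f \<circ> k) ` topspace Y = h ` f ` topspace X"
proof -
  note H = homeomorphic_mapsD[OF hom]
  show "continuous_map Y Y (h \<circ> f \<circ> k)"
    using H(1,2) f by (intro continuous_map_compose)
  show "cover_close Y \<U> (h \<circ> f \<circ> k) id"
    unfolding cover_close_def
  proof
    fix y assume y: "y \<in> topspace Y"
    obtain U where U: "U \<in> \<U>" "h (f (k y)) \<in> U" "h (k y) \<in> U"
      using close H(5)[OF y] unfolding cover_close_def pullback_cover_def id_def by blast
    have "(h \<circ> f \<circ> k) y \<in> U \<and> id y \<in> U"
      using U(2,3) unfolding H(6)[OF y] by simp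
    then show "\<exists>U\<in>\<U>. (h \<circ> f \<circ> k) y \<in> U \<and> id y \<in> U"
      using U(1) by (rule rev_bexI[rotated])
  qed
  have "k ` topspace Y = topspace X"
  proof
    show "k ` topspace Y \<subseteq> topspace X"
      using H(5) by blast
    show "topspace X \<subseteq> k ` topspace Y"
    proof
      fix x assume "x \<in> topspace X"
      then show "x \<in> k ` topspace Y"
        using H(3,4)[of x] by (metis image_eqI)
    qed
  qed
  then show "(h \<circ> f \<circ> k) ` topspace Y = h ` f ` topspace X"
    by (simp only: image_comp[symmetric])
qed

lemma homeomorphic_closedin:
  assumes "homeomorphic_maps X Y h k" "closedin X A"
  shows "closedin Y (h ` A)"
  using assms homeomorphic_map_closedness[of X Y h A] closedin_subset[of X A] homeomorphic_map_maps by blast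

lemma homeomorphic_image_disjoint:
  assumes "homeomorphic_maps X Y h k" "B \<subseteq> topspace X" "A \<subseteq> topspace X" "B \<inter> A = {}"
  shows "h ` B \<inter> h ` A = {}"
proof -
  have "inj_on h (topspace X)"
    using homeomorphic_mapsD(4)[OF assms(1)] by (rule inj_on_inverseI)
  then show ?thesis
    using inj_on_image_Int[of h "topspace X" B A] assms(2-4) by simp
qed

lemma Z_set_homeomorphic:
  assumes hom: "homeomorphic_maps X Y h k" and A: "Z_set X A"
  shows "Z_set Y (h ` A)"
  unfolding Z_set_def
proof (intro conjI allI impI)
  have cl: "closedin X A"
    using A by (simp add: Z_set_def)
  then show "closedin Y (h ` A)"
    by (rule homeomorphic_closedin[OF hom])
  fix \<U> assume "open_cover Y \<U>"
  then have "open_cover X (pullback_cover X h \<U>)"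
    by (rule open_cover_pullback[OF homeomorphic_mapsD(1)[OF hom]])
  then obtain f where f: "continuous_map X X f" "cover_close X (pullback_cover X h \<U>) f id" "f ` topspace X \<inter> A = {}"
    using A unfolding Z_set_def by blast
  note c = conjugate_map[OF hom f(1,2)]
  have "(h \<circ> f \<circ> k) ` topspace Y \<inter> h ` A = {}"
    unfolding c(3) using f(1,3) closedin_subset[OF cl]
    by (intro homeomorphic_image_disjoint[OF hom] continuous_map_image_subset_topspace)
  then show "\<exists>f. continuous_map Y Y f \<and> cover_close Y \<U> f id \<and> f ` topspace Y \<inter> h ` A = {}"
    using c(1,2) by blast
qed

lemma strong_Z_set_homeomorphic:
  assumes hom: "homeomorphic_maps X Y h k" and A: "strong_Z_set X A"
  shows "strong_Z_set Y (h ` A)"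
  unfolding strong_Z_set_def
proof (intro conjI allI impI)
  have cl: "closedin X A"
    using A by (simp add: strong_Z_set_def)
  then show "closedin Y (h ` A)"
    by (rule homeomorphic_closedin[OF hom])
  fix \<U> assume "open_cover Y \<U>"
  then have "open_cover X (pullback_cover X h \<U>)"
    by (rule open_cover_pullback[OF homeomorphic_mapsD(1)[OF hom]])
  then obtain f where f: "continuous_map X X f" "cover_close X (pullback_cover X h \<U>) f id"
    "X closure_of (f ` topspace X) \<inter> A = {}"
    using A unfolding strong_Z_set_def by blast
  note c = conjugate_map[OF hom f(1,2)]
  have "f ` topspace X \<subseteq> topspace X"
    using f(1) by (rule continuous_map_image_subset_topspace)
  moreover have "homeomorphic_map X Y h"
    using hom homeomorphic_map_maps by blast
  ultimately have "Y closure_of (h ` f ` topspace X) = h ` (X closure_of (f ` topspace X))"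
    by (intro homeomorphic_map_closure_of)
  then have "Y closure_of ((h \<circ> f \<circ> k) ` topspace Y) \<inter> h ` A = {}"
    unfolding c(3) using f(3) closedin_subset[OF cl]
    by (simp add: homeomorphic_image_disjoint[OF hom] closure_of_subset_topspace)
  then show "\<exists>f. continuous_map Y Y f \<and> cover_close Y \<U> f id \<and> Y closure_of (f ` topspace Y) \<inter> h ` A = {}"
    using c(1,2) by blast
qed

lemma Z_embedding_homeomorphic:
  assumes hom: "homeomorphic_maps X Y h k" and f: "Z_embedding A X f"
  shows "Z_embedding A Y (h \<circ> f)"
proof -
  note H = homeomorphic_mapsD[OF hom]
  have F: "continuous_map A X f" "closed_map A X f" "inj_on f (topspace A)" "Z_set X (f ` topspace A)"
    using f unfolding Z_embedding_iff by blast+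
  have "closed_map X Y h"
    unfolding closed_map_def using homeomorphic_closedin[OF hom] by blast
  then have "closed_map A Y (h \<circ> f)"
    using F(2) by (intro closed_map_compose)
  moreover have "inj_on h (f ` topspace A)"
  proof (rule inj_on_inverseI)
    fix x assume "x \<in> f ` topspace A"
    then have "x \<in> topspace X"
      using F(1) unfolding continuous_map_def by blast
    then show "k (h x) = x"
      by (rule H(4))
  qed
  then have "inj_on (h \<circ> f) (topspace A)"
    using F(3) by (intro comp_inj_on)
  moreover have "Z_set Y ((h \<circ> f) ` topspace A)"
    using Z_set_homeomorphic[OF hom F(4)] by (simp only: image_comp)
  ultimately show ?thesis
    unfolding Z_embedding_iff using continuous_map_compose[OF F(1) H(1)] by blast
qed

lemma strongly_universal_homeomorphic:
  assumes hom: "homeomorphic_maps X Y h k" and X: "strongly_universal D X"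
  shows "strongly_universal D Y"
  unfolding strongly_universal_def
proof (intro ballI allI impI, elim conjE)
  note H = homeomorphic_mapsD[OF hom]
  fix A f B \<U>
  assume A: "A \<in> D" and f: "continuous_map A Y f" and B: "closedin A B"
    and fB: "Z_embedding (subtopology A B) Y f" and \<U>: "open_cover Y \<U>"
  have fY: "f a \<in> topspace Y" if "a \<in> topspace A" for a
    using f that unfolding continuous_map_def by blast
  have hom': "homeomorphic_maps Y X k h"
    using hom homeomorphic_maps_sym by blast
  have "Z_embedding (subtopology A B) X (k \<circ> f)"
    by (rule Z_embedding_homeomorphic[OF hom' fB])
  moreover have "continuous_map A X (k \<circ> f)"
    using f H(2) by (rule continuous_map_compose)
  moreover have "open_cover X (pullback_cover X h \<U>)"
    by (rule open_cover_pullback[OF H(1) \<U>])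
  ultimately obtain g where g: "Z_embedding A X g" "cover_close A (pullback_cover X h \<U>) g (k \<circ> f)"
    "\<forall>x\<in>B. g x = (k \<circ> f) x"
    using X A B unfolding strongly_universal_def by blast
  have "cover_close A \<U> (h \<circ> g) f"
    unfolding cover_close_def
  proof
    fix a assume a: "a \<in> topspace A"
    obtain U where U: "U \<in> \<U>" "h (g a) \<in> U" "h (k (f a)) \<in> U"
      using g(2) a unfolding cover_close_def pullback_cover_def o_def by blast
    have "(h \<circ> g) a \<in> U \<and> f a \<in> U"
      using U(2,3) unfolding H(6)[OF fY[OF a]] by simp
    then show "\<exists>U\<in>\<U>. (h \<circ> g) a \<in> U \<and> f a \<in> U"
      using U(1) by (rule rev_bexI[rotated])
  qed
  moreover have "\<forall>x\<in>B. (h \<circ> g) x = f x"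
  proof
    fix x assume x: "x \<in> B"
    then have "x \<in> topspace A"
      using closedin_subset[OF B] by blast
    then show "(h \<circ> g) x = f x"
      using g(3) x H(6)[OF fY] by simp
  qed
  ultimately show "\<exists>g. Z_embedding A Y g \<and> cover_close A \<U> g f \<and> (\<forall>x\<in>B. g x = f x)"
    using Z_embedding_homeomorphic[OF hom g(1)] by blast
qed

lemma sigma_class_homeomorphic:
  assumes hom: "homeomorphic_maps X Y h k" and X: "X \<in> sigma_class D"
  shows "Y \<in> sigma_class D"
proof -
  note H = homeomorphic_mapsD[OF hom]
  obtain A :: "nat \<Rightarrow> 'a set" where A: "topspace X = (\<Union>n. A n)"
    "\<And>n. closedin X (A n)" "\<And>n. in_class (subtopology X (A n)) D" and met: "metrizable_space X"
    using X unfolding sigma_class_def by blast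
  have "in_class (subtopology Y (h ` A n)) D" for n
  proof -
    have sub: "A n \<subseteq> topspace X"
      by (rule closedin_subset[OF A(2)])
    then have "h ` A n \<subseteq> topspace Y"
      using H(3) by blast
    then have "homeomorphic_maps (subtopology X (A n)) (subtopology Y (h ` A n)) h k"
      using sub by (intro homeomorphic_maps_subtopologies[OF hom]) (simp add: Int_absorb1)
    then have "subtopology Y (h ` A n) homeomorphic_space subtopology X (A n)"
      unfolding homeomorphic_space_def using homeomorphic_maps_sym by blast
    then show ?thesis
      using A(3) by (rule in_class_homeomorphic)
  qed
  moreover have "closedin Y (h ` A n)" for n
    by (rule homeomorphic_closedin[OF hom A(2)])
  moreover have "topspace Y = (\<Union>n. h ` A n)"
  proof -
    have "h ` topspace X = topspace Y"
      using hom homeomorphic_map_maps homeomorphic_imp_surjective_map by blast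
    then show ?thesis
      unfolding A(1) by blast
  qed
  moreover have "metrizable_space Y"
    using met hom homeomorphic_metrizable_space unfolding homeomorphic_space_def by blast
  ultimately show ?thesis
    unfolding sigma_class_def mem_Collect_eq
    by (intro conjI exI[of _ "\<lambda>n. h ` A n"] allI)
qed

lemma strong_Z_sigma_homeomorphic:
  assumes hom: "homeomorphic_maps X Y h k" and X: "strong_Z_sigma_in_itself X"
  shows "strong_Z_sigma_in_itself Y"
proof -
  obtain A :: "nat \<Rightarrow> 'a set" where A: "\<And>n. strong_Z_set X (A n)" "topspace X = (\<Union>n. A n)"
    using X unfolding strong_Z_sigma_in_itself_def by blast
  have "h ` topspace X = topspace Y"
    using hom homeomorphic_map_maps homeomorphic_imp_surjective_map by blast
  then have "topspace Y = (\<Union>n. h ` A n)"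
    unfolding A(2) by blast
  moreover have "strong_Z_set Y (h ` A n)" for n
    by (rule strong_Z_set_homeomorphic[OF hom A(1)])
  ultimately show ?thesis
    unfolding strong_Z_sigma_in_itself_def by (intro exI[of _ "\<lambda>n. h ` A n"] conjI allI)
qed

lemma homotopy_dense_homeomorphic:
  assumes hom: "homeomorphic_maps M N h k" and X: "homotopy_dense M X"
  shows "homotopy_dense N (h ` X)"
proof -
  note H = homeomorphic_mapsD[OF hom]
  let ?I = "top_of_set {0..1::real}"
  obtain F where F: "continuous_map (prod_topology M ?I) M F" "\<And>x. x \<in> topspace M \<Longrightarrow> F (x, 0) = x"
    "F ` (topspace M \<times> {0<..1}) \<subseteq> X" and XM: "X \<subseteq> topspace M"
    using X unfolding homotopy_dense_def by blast
  define F' where "F' = h \<circ> F \<circ> (\<lambda>p. (k (fst p), snd p))"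
  have "continuous_map (prod_topology N ?I) (prod_topology M ?I) (\<lambda>p. (k (fst p), snd p))"
    using continuous_map_compose[OF continuous_map_fst H(2)]
    by (intro continuous_map_pairedI continuous_map_snd) (simp add: o_def)
  then have "continuous_map (prod_topology N ?I) N F'"
    unfolding F'_def using F(1) H(1) by (intro continuous_map_compose)
  moreover have "\<forall>y\<in>topspace N. F' (y, 0) = y"
    using H(5,6) F(2) by (simp add: F'_def)
  moreover have "F' ` (topspace N \<times> {0<..1}) \<subseteq> h ` X"
  proof
    fix z assume "z \<in> F' ` (topspace N \<times> {0<..1})"
    then obtain y t where yt: "y \<in> topspace N" "t \<in> {0<..1}" "z = h (F (k y, t))"
      unfolding F'_def by auto
    then have "(k y, t) \<in> topspace M \<times> {0<..1}"
      using H(5) by simp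
    then have "F (k y, t) \<in> X"
      using F(3) by blast
    then show "z \<in> h ` X"
      using yt(3) by blast
  qed
  moreover have "h ` X \<subseteq> topspace N"
    using XM H(3) by blast
  ultimately show ?thesis
    unfolding homotopy_dense_def by blast
qed

lemma absorbing_set_homeomorphic:
  assumes hom: "homeomorphic_maps M N h k" and X: "absorbing_set D M X"
  shows "absorbing_set D N (h ` X)"
proof -
  note H = homeomorphic_mapsD[OF hom]
  have XM: "X \<subseteq> topspace M"
    using X unfolding absorbing_set_def by blast
  then have hX: "h ` X \<subseteq> topspace N"
    using H(3) by blast
  have sub: "homeomorphic_maps (subtopology M X) (subtopology N (h ` X)) h k"
    using XM hX by (intro homeomorphic_maps_subtopologies[OF hom]) (simp add: Int_absorb1)
  show ?thesis
    unfolding absorbing_set_def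
  proof (intro conjI hX)
    show "homotopy_dense N (h ` X)"
      using X homotopy_dense_homeomorphic[OF hom] unfolding absorbing_set_def by blast
    show "subtopology N (h ` X) \<in> sigma_class D"
      using X sigma_class_homeomorphic[OF sub] unfolding absorbing_set_def by blast
    show "strongly_universal D (subtopology N (h ` X))"
      using X strongly_universal_homeomorphic[OF sub] unfolding absorbing_set_def by blast
    show "strong_Z_sigma_in_itself (subtopology N (h ` X))"
      using X strong_Z_sigma_homeomorphic[OF sub] unfolding absorbing_set_def by blast
  qed
qed

section \<open>Absorbing sets in products of Hilbert spaces\<close>

lemma stable_class_density_class:
  assumes "Card_order \<kappa>'" "natLeq \<le>o \<kappa>'" and met: "\<forall>A\<in>\<CC>. metrizable_space A"
    and "closed_hereditary_class \<CC>" "I_stable_class \<CC>"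
  shows "stable_class (density_class \<CC> \<kappa>')"
proof
  fix A assume A: "A \<in> density_class \<CC> \<kappa>'"
  then have A': "A \<in> \<CC>" "density_le A \<kappa>'" "metrizable_space A"
    using met by (auto simp: density_class_def)
  show "metrizable_space A"
    by (rule A'(3))
  show "in_class (subtopology A F) (density_class \<CC> \<kappa>')" if "closedin A F" for F
  proof (rule in_class_member)
    have "subtopology A F \<in> \<CC>"
      using assms(4) A'(1) that unfolding closed_hereditary_class_def by blast
    then show "subtopology A F \<in> density_class \<CC> \<kappa>'"
      using density_le_subspace[OF A'(3,2) assms(1,2)] by (simp add: density_class_def)
  qed
  obtain Y where Y: "Y \<in> \<CC>" "prod_topology A (top_of_set {0..1::real}) homeomorphic_space Y"
    using assms(5) A'(1) unfolding I_stable_class_def in_class_def by blast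
  have "density_le Y \<kappa>'"
    by (rule density_le_homeomorphic[OF Y(2) density_le_times_interval[OF A'(2) assms(1,2)]])
  then show "in_class (prod_topology A (top_of_set {0..1::real})) (density_class \<CC> \<kappa>')"
    using Y unfolding in_class_def density_class_def by blast
qed

lemma hilb_threshold: "t \<ge> 0 \<Longrightarrow> x \<in> hilb \<kappa> \<Longrightarrow> threshold t x \<in> hilb \<kappa>"
  unfolding hilb_def mem_Collect_eq by (rule order_trans[OF supp_threshold])

lemma homotopy_dense_fin_sqsum_times:
  fixes V \<Omega> :: "'b::metric_space set"
  assumes "homotopy_dense (top_of_set V) \<Omega>"
  shows "homotopy_dense (top_of_set (hilb \<kappa> \<times> V)) (fin_sqsum (Field \<kappa>) \<times> \<Omega>)"
proof -
  obtain h where h: "continuous_on (V \<times> {0..1}) h" "h ` (V \<times> {0..1::real}) \<subseteq> V"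
      "\<And>x. x \<in> V \<Longrightarrow> h (x, 0) = x" "h ` (V \<times> {0<..1}) \<subseteq> \<Omega>" and \<Omega>V: "\<Omega> \<subseteq> V"
    using assms unfolding homotopy_dense_def by auto
  define F where "F p = (threshold (snd p) (fst (fst p)), h (snd (fst p), snd p))"
    for p :: "('a sqsum \<times> 'b) \<times> real"
  let ?S = "(hilb \<kappa> \<times> V) \<times> {0..1::real}"
  have c: "continuous_on ?S F"
    unfolding F_def
    by (intro continuous_on_Pair continuous_on_threshold continuous_on_compose2[OF h(1)] continuous_intros) auto
  have F_in: "F p \<in> hilb \<kappa> \<times> V" if p: "p \<in> ?S" for p
  proof -
    have "(snd (fst p), snd p) \<in> V \<times> {0..1}"
      using p by auto
    then have "h (snd (fst p), snd p) \<in> V"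
      using h(2) by blast
    moreover have "threshold (snd p) (fst (fst p)) \<in> hilb \<kappa>"
      using p by (intro hilb_threshold) auto
    ultimately show ?thesis
      by (simp add: F_def)
  qed
  have cm: "continuous_map (prod_topology (top_of_set (hilb \<kappa> \<times> V)) (top_of_set {0..1})) (top_of_set (hilb \<kappa> \<times> V)) F"
    unfolding prod_topology_subtopology_eu using c F_in by auto
  have F0: "F (x, 0) = x" if "x \<in> hilb \<kappa> \<times> V" for x
    using that h(3) by (auto simp: F_def)
  have F1: "F ` ((hilb \<kappa> \<times> V) \<times> {0<..1}) \<subseteq> fin_sqsum (Field \<kappa>) \<times> \<Omega>"
  proof
    fix z assume "z \<in> F ` ((hilb \<kappa> \<times> V) \<times> {0<..1})"
    then obtain x y t where p: "x \<in> hilb \<kappa>" "y \<in> V" "0 < t" "t \<le> 1" "z = (threshold t x, h (y, t))"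
      unfolding F_def by auto
    have "(y, t) \<in> V \<times> {0<..1}"
      using p by simp
    then have "h (y, t) \<in> \<Omega>"
      using h(4) by blast
    moreover have "supp (threshold t x) \<subseteq> Field \<kappa>"
      using hilb_threshold[of t x \<kappa>] p by (simp add: hilb_def)
    ultimately show "z \<in> fin_sqsum (Field \<kappa>) \<times> \<Omega>"
      using p finite_supp_threshold[of t x] by (simp add: fin_sqsum_def)
  qed
  have "fin_sqsum (Field \<kappa>) \<times> \<Omega> \<subseteq> hilb \<kappa> \<times> V"
    using \<Omega>V by (auto simp: fin_sqsum_def hilb_def)
  then show ?thesis
    unfolding homotopy_dense_def using cm F0 F1 by (auto intro!: exI[of _ F])
qed

lemma convex_hilb: "convex (hilb \<kappa>)"
  unfolding convex_def
proof (intro ballI allI impI)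
  fix x y :: "'a sqsum" and u v :: real
  assume "x \<in> hilb \<kappa>" "y \<in> hilb \<kappa>"
  then show "u *\<^sub>R x + v *\<^sub>R y \<in> hilb \<kappa>"
    using supp_add[of "u *\<^sub>R x" "v *\<^sub>R y"] supp_scaleR[of u x] supp_scaleR[of v y]
    unfolding hilb_def by blast
qed

theorem theorem1p2:
  fixes \<kappa>' :: "'j rel" and \<kappa> :: "'k rel"
    and \<CC> :: "'u topology set" and \<Omega> :: "('j \<Rightarrow> real) set"
  assumes "Card_order \<kappa>'" and "Card_order \<kappa>"
    and "natLeq \<le>o \<kappa>'" and "\<kappa>' <o \<kappa>"
    and "\<forall>A\<in>\<CC>. metrizable_space A"
    and "topological_class \<CC>" and "closed_hereditary_class \<CC>" and "I_stable_class \<CC>"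
    and "absorbing_set (density_class \<CC> \<kappa>') (ell2 \<kappa>') \<Omega>"
  shows "absorbing_set (sum_class \<kappa> (density_class \<CC> \<kappa>'))
           (prod_topology (ell2 \<kappa>) (ell2 \<kappa>')) (ell2f \<kappa> \<times> \<Omega>)"
proof -
  let ?D = "density_class \<CC> \<kappa>'"
  let ?K = "Field \<kappa>"
  obtain k where k: "homeomorphic_maps (ell2 \<kappa>) (top_of_set (hilb \<kappa>)) of_coords k"
    using homeomorphic_map_ell2 unfolding homeomorphic_map_maps by blast
  obtain k' where k': "homeomorphic_maps (ell2 \<kappa>') (top_of_set (hilb \<kappa>')) of_coords k'"
    using homeomorphic_map_ell2 unfolding homeomorphic_map_maps by blast
  define \<Omega>' where "\<Omega>' = of_coords ` \<Omega>"
  have abs: "absorbing_set ?D (top_of_set (hilb \<kappa>')) \<Omega>'"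
    unfolding \<Omega>'_def by (rule absorbing_set_homeomorphic[OF k' assms(9)])
  then have \<Omega>'V: "\<Omega>' \<subseteq> hilb \<kappa>'" and dense: "homotopy_dense (top_of_set (hilb \<kappa>')) \<Omega>'"
    and sub': "subtopology (top_of_set (hilb \<kappa>')) \<Omega>' = top_of_set \<Omega>'"
    by (auto simp: absorbing_set_def subtopology_subtopology Int_absorb1)
  have sigma: "top_of_set \<Omega>' \<in> sigma_class ?D" and su: "strongly_universal ?D (top_of_set \<Omega>')"
    using abs unfolding absorbing_set_def sub' by blast+
  interpret stable_class ?D
    by (rule stable_class_density_class[OF assms(1,3,5,7,8)])
  have leq: "natLeq \<le>o \<kappa>"
    using assms(3,4) ordLeq_ordLess_trans ordLess_imp_ordLeq by blast
  have inf: "infinite ?K"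
    by (rule infinite_Field_if_natLeq[OF assms(2) leq])
  let ?X = "fin_sqsum ?K \<times> \<Omega>'"
  have XM: "?X \<subseteq> hilb \<kappa> \<times> hilb \<kappa>'"
    using \<Omega>'V by (auto simp: fin_sqsum_def hilb_def)
  then have sub: "subtopology (top_of_set (hilb \<kappa> \<times> hilb \<kappa>')) ?X = top_of_set ?X"
    by (simp only: subtopology_subtopology Int_absorb1)
  have "strongly_universal (sum_class \<kappa> ?D) (top_of_set ?X)"
    unfolding strongly_universal_def
  proof (intro ballI allI impI, elim conjE)
    fix A f B \<U>
    assume A: "A \<in> sum_class \<kappa> ?D" and f: "continuous_map A (top_of_set ?X) f" "closedin A B"
      "Z_embedding (subtopology A B) (top_of_set ?X) f" "open_cover (top_of_set ?X) \<U>"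
    have density: "\<And>A. A \<in> ?D \<Longrightarrow> density_le A \<kappa>'"
      by (simp add: density_class_def)
    obtain \<iota> :: "'k \<times> 'u \<Rightarrow> 'k" where \<iota>: "metrizable_space A"
      "\<And>\<gamma>. openin A {a \<in> topspace A. \<iota> a = \<gamma>}" "\<And>a. a \<in> topspace A \<Longrightarrow> \<iota> a \<in> Field \<kappa>"
      "\<And>\<gamma>. \<gamma> \<in> Field \<kappa> \<Longrightarrow> in_class (subtopology A {a \<in> topspace A. \<iota> a = \<gamma>}) ?D"
      using sum_class_pieces[OF A metrizable] by blast
    show "\<exists>g. Z_embedding A (top_of_set ?X) g \<and> cover_close A \<U> g f \<and> (\<forall>x\<in>B. g x = f x)"
      by (rule Z_embedding_approximation[OF assms(2,1,3,4) density convex_hilb dense su \<iota> f])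
  qed
  then have "absorbing_set (sum_class \<kappa> ?D) (top_of_set (hilb \<kappa> \<times> hilb \<kappa>')) ?X"
    unfolding absorbing_set_def sub
    using XM by (intro conjI homotopy_dense_fin_sqsum_times[OF dense] sigma_class_fin_sqsum_times[OF inf sigma]
      strong_Z_sigma_fin_sqsum[OF inf]) simp_all
  then have abs2: "absorbing_set (sum_class \<kappa> ?D)
      (prod_topology (top_of_set (hilb \<kappa>)) (top_of_set (hilb \<kappa>'))) ?X"
    by (simp only: prod_topology_subtopology_eu)
  have hom: "homeomorphic_maps (prod_topology (top_of_set (hilb \<kappa>)) (top_of_set (hilb \<kappa>')))
      (prod_topology (ell2 \<kappa>) (ell2 \<kappa>')) (\<lambda>(x, y). (k x, k' y)) (\<lambda>(x, y). (of_coords x, of_coords y))"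
    unfolding homeomorphic_maps_prod
    using k[unfolded homeomorphic_maps_sym[of "ell2 \<kappa>"]] k'[unfolded homeomorphic_maps_sym[of "ell2 \<kappa>'"]]
    by (intro disjI2 conjI)
  have "topspace (ell2 \<kappa>) = ell2_space ?K"
    unfolding ell2_def by (rule Metric_space.topspace_mtopology[OF Metric_space_ell2])
  then have "k (of_coords x) = x" if "x \<in> ell2f \<kappa>" for x
    using that homeomorphic_mapsD(4)[OF k, of x] by (simp add: ell2f_def)
  then have "k ` fin_sqsum ?K = ell2f \<kappa>"
    unfolding of_coords_ell2f[symmetric] image_image by simp
  moreover have "k' (of_coords y) = y" if "y \<in> \<Omega>" for y
    using that homeomorphic_mapsD(4)[OF k', of y] assms(9) unfolding absorbing_set_def by blast
  then have "k' ` \<Omega>' = \<Omega>"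
    unfolding \<Omega>'_def image_image by simp
  ultimately have "(\<lambda>(x, y). (k x, k' y)) ` ?X = ell2f \<kappa> \<times> \<Omega>"
    unfolding map_prod_def[symmetric] by (rule map_prod_surj_on)
  then show ?thesis
    using absorbing_set_homeomorphic[OF hom abs2] by simp
qed

end
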